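(* There exists a Suslinian chainable metric continuum whose set of end points, with the subspace topology, is homeomorphic to the space $\mathbb{R}\setminus\mathbb{Q}$ of irrational numbers.
   Context: A continuum is a non-empty, connected, compact metric space. A continuum is non-degenerate if it has more than one point. A subcontinuum of $X$ is a subset of $X$ that is a continuum. A continuum $X$ is chainable if for every $\varepsilon>0$ it has a finite covering by open sets $U_1,\ldots,U_n$ such that $\operatorname{diam} U_i<\varepsilon$ for all $i$, and $U_i\cap U_j\neq\emptyset$ if and only if $|i-j|\le 1$, for $i,j=1,\ldots,n$. A point $p$ of a chainable continuum $X$ is an end point of $X$ if for every $\varepsilon>0$ such a covering can be chosen with, moreover, $p\in U_1$. A continuum is Suslinian if every family of its pairwise disjoint non-degenerate subcontinua is countable (finite or infinite). *)

theory Defs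
  imports "HOL-Analysis.Analysis"
begin

text \<open>
  A metric space is a carrier \<open>M\<close> together with a distance function \<open>d\<close>, as in the locale
  \<open>Metric_space\<close>. A subset \<open>K\<close> of \<open>M\<close> carries the restricted metric, which is again \<open>d\<close>.
\<close>

definition continuum :: "'a set \<Rightarrow> ('a \<Rightarrow> 'a \<Rightarrow> real) \<Rightarrow> bool" where
  "continuum M d \<longleftrightarrow> Metric_space M d \<and> M \<noteq> {} \<and>
     connected_space (Metric_space.mtopology M d) \<and> compact_space (Metric_space.mtopology M d)"

definition nondegenerate :: "'a set \<Rightarrow> bool" where
  "nondegenerate K \<longleftrightarrow> (\<exists>x\<in>K. \<exists>y\<in>K. x \<noteq> y)"

definition subcontinuum :: "'a set \<Rightarrow> ('a \<Rightarrow> 'a \<Rightarrow> real) \<Rightarrow> 'a set \<Rightarrow> bool" where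
  "subcontinuum M d K \<longleftrightarrow> K \<subseteq> M \<and> continuum K d"

text \<open>
  The library's \<open>diameter\<close> with an explicit distance function; as there, the value is only
  meaningful for bounded sets, which all subsets of a compact space are.
\<close>

definition mdiameter :: "('a \<Rightarrow> 'a \<Rightarrow> real) \<Rightarrow> 'a set \<Rightarrow> real" where
  "mdiameter d S = (if S = {} then 0 else SUP (x,y)\<in>S\<times>S. d x y)"

text \<open>The links \<open>U\<^sub>1, \<dots>, U\<^sub>n\<close> are given by an indexed family, of which only the values on
  \<open>{1..n}\<close> matter.\<close>

definition chain_cover ::
  "'a set \<Rightarrow> ('a \<Rightarrow> 'a \<Rightarrow> real) \<Rightarrow> real \<Rightarrow> nat \<Rightarrow> (nat \<Rightarrow> 'a set) \<Rightarrow> bool" where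
  "chain_cover M d \<epsilon> n U \<longleftrightarrow>
     (\<forall>i\<in>{1..n}. openin (Metric_space.mtopology M d) (U i) \<and> mdiameter d (U i) < \<epsilon>) \<and>
     (\<Union>i\<in>{1..n}. U i) = M \<and>
     (\<forall>i\<in>{1..n}. \<forall>j\<in>{1..n}. U i \<inter> U j \<noteq> {} \<longleftrightarrow> \<bar>int i - int j\<bar> \<le> 1)"

definition chainable :: "'a set \<Rightarrow> ('a \<Rightarrow> 'a \<Rightarrow> real) \<Rightarrow> bool" where
  "chainable M d \<longleftrightarrow> continuum M d \<and> (\<forall>\<epsilon>>0. \<exists>n U. chain_cover M d \<epsilon> n U)"

definition end_points :: "'a set \<Rightarrow> ('a \<Rightarrow> 'a \<Rightarrow> real) \<Rightarrow> 'a set" where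
  "end_points M d = {p \<in> M. \<forall>\<epsilon>>0. \<exists>n U. chain_cover M d \<epsilon> n U \<and> p \<in> U 1}"

definition Suslinian :: "'a set \<Rightarrow> ('a \<Rightarrow> 'a \<Rightarrow> real) \<Rightarrow> bool" where
  "Suslinian M d \<longleftrightarrow> continuum M d \<and>
     (\<forall>\<F>. (\<forall>K\<in>\<F>. subcontinuum M d K \<and> nondegenerate K) \<and> pairwise disjnt \<F> \<longrightarrow> countable \<F>)"

end

(*
  The continuum X is the closure of a line Phi in a countable product of intervals. Towards its left
  end the line oscillates over all of X, seen through the coordinates osc(-s), and towards its right end
  over all of X, seen through the coordinates osc(s); so X is the line together with two copies iM X and
  iP X of itself. An additional family of coordinates, through rho, survives in all copies that are nested
  at the right end, because rho - rho o osc tends to 0: the intersection of the sets iP^n X is not a point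
  but a third copy iA X. Thus X consists of countably many lines and of the copies iA X and
  iP^n (iM X), n >= 0, and iterating this decomposition attaches to each point that is never on a line a
  branch in the tree of finite sequences of naturals. The copies along a branch shrink to a point, and
  the copies iP^n (iM X) accumulate only at a point of a line of iA X, so the set E of these points is
  homeomorphic to the Baire space.

  A point on a line lies in two subcontinua neither of which contains the other, so it is no end
  point. For p in E, an e-chain of a small copy around p with p in its first link is prolonged step by
  step: a line that accumulates on all of a copy can be left out of the last link of a chain of the copy and
  followed to its other end. A nondegenerate subcontinuum contains a rational point of one of the lines,
  so X is Suslinian.
*)

theory Submission
  imports Defs "HOL-Real_Asymp.Real_Asymp"
begin

section \<open>Two oscillating functions\<close>

text \<open>If \<open>iP\<close> and \<open>iM\<close> were the only branches, the points never on a
  line would form an intersection of finite unions of compact copies, hence a compact set, which the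
  irrationals are not. So infinitely many branches are needed, and they must accumulate outside
  \<open>E\<close>. This is what \<open>rho\<close> achieves: it expands the limit point of the
  copies nested at the right end to a whole copy \<open>iA X\<close>, and since \<open>rho\<close>
  vanishes towards the left end, the branches \<open>iP^n (iM X)\<close> accumulate at parameter 0
  of the line of that copy.

  For this \<open>rho\<close> has to take all values on every tail although
  \<open>rho - rho o osc\<close> tends to 0. A divergent series with terms tending to 0 has such
  partial sums; here a harmonic one is summed along orbits of \<open>osc\<close>.

  As \<open>iP\<close> keeps the \<open>rho\<close> coordinates, it does not contract. The branches
  are therefore \<open>iA\<close> and the maps \<open>iP^n iM\<close>, each of which makes one more
  coordinate independent of the argument. \<open>E\<close> and the irrationals receive trees of the
  same shape and are matched point by point through their addresses; the Baire space itself never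
  appears.\<close>

definition kap :: "real \<Rightarrow> real" where
  "kap x = x / (1 + \<bar>x\<bar>)"

lemma kap_0 [simp]: "kap 0 = 0"
  by (simp add: kap_def)

lemma abs_kap_less: "\<bar>kap x\<bar> < 1"
proof -
  have "0 < 1 + \<bar>x\<bar>" by linarith
  then show ?thesis unfolding kap_def by (simp only: abs_divide abs_abs abs_of_pos pos_divide_less_eq) simp
qed

lemma kap_strict_mono: "kap x < kap y \<longleftrightarrow> x < y"
proof -
  have *: "kap x < kap y" if "x < y" for x y
  proof -
    have "0 \<le> x \<or> y \<le> 0 \<or> (x < 0 \<and> 0 < y)" by linarith
    then show ?thesis
    proof (elim disjE)
      assume "0 \<le> x" then show ?thesis using that by (simp add: kap_def field_simps)
    next
      assume "y \<le> 0" then show ?thesis using that by (simp add: kap_def field_simps)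
    next
      assume "x < 0 \<and> 0 < y"
      then have "kap x < 0" "0 < kap y" by (auto simp: kap_def divide_neg_pos)
      then show ?thesis by linarith
    qed
  qed
  show ?thesis using *[of x y] *[of y x] by (cases x y rule: linorder_cases) auto
qed

lemma kap_less_eq: "kap x \<le> kap y \<longleftrightarrow> x \<le> y"
  using kap_strict_mono[of y x] by (simp add: not_less[symmetric])

lemma kap_inject: "kap x = kap y \<longleftrightarrow> x = y"
  unfolding order_eq_iff[of "kap x"] kap_less_eq by (rule order_eq_iff[symmetric])

lemma kap_surj: assumes "\<bar>y\<bar> < 1" shows "kap (y / (1 - \<bar>y\<bar>)) = y"
proof -
  have "\<bar>y / (1 - \<bar>y\<bar>)\<bar> = \<bar>y\<bar> / (1 - \<bar>y\<bar>)" using assms by (simp add: abs_divide)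
  then have "1 + \<bar>y / (1 - \<bar>y\<bar>)\<bar> = 1 / (1 - \<bar>y\<bar>)" using assms by (simp add: field_simps)
  then show ?thesis using assms by (simp add: kap_def)
qed

lemma kap_lipschitz: "\<bar>kap x - kap y\<bar> \<le> \<bar>x - y\<bar>"
proof -
  have *: "kap y - kap x \<le> y - x" if "x \<le> y" for x y
  proof -
    have nn: "kap b - kap a \<le> b - a" if "0 \<le> a" "a \<le> b" for a b
    proof -
      have "kap b - kap a = (b - a) / ((1 + a) * (1 + b))" using that
        by (simp add: kap_def field_simps)
      also have "\<dots> \<le> (b - a) / 1" using that mult_mono[of 1 "1+a" 1 "1+b"]
        by (intro divide_left_mono) auto
      finally show ?thesis by simp
    qed
    have neg: "kap (- a) = - kap a" for a by (simp add: kap_def)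
    consider "0 \<le> x" | "y \<le> 0" | "x < 0" "0 < y" by linarith
    then show ?thesis
    proof cases
      case 1 then show ?thesis using nn that by auto
    next
      case 2 then show ?thesis using nn[of "-y" "-x"] that by (auto simp: neg)
    next
      case 3 then show ?thesis using nn[of 0 "-x"] nn[of 0 y] by (auto simp: neg)
    qed
  qed
  have mono: "kap x \<le> kap y" if "x \<le> y" for x y using that by (simp add: kap_less_eq)
  show ?thesis
    using *[of x y] *[of y x] mono[of x y] mono[of y x] by (cases "x \<le> y") auto
qed

lemma kap_at_top: "(kap \<longlongrightarrow> 1) at_top"
proof -
  have "((\<lambda>x::real. x / (1 + x)) \<longlongrightarrow> 1) at_top" by real_asymp
  then show ?thesis
    by (rule Lim_transform_eventually)
      (auto intro: eventually_mono[OF eventually_ge_at_top[of 0]] simp: kap_def)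
qed

lemma kap_at_bot: "(kap \<longlongrightarrow> - 1) at_bot"
proof -
  have "((\<lambda>x::real. x / (1 - x)) \<longlongrightarrow> - 1) at_bot" by real_asymp
  then show ?thesis
    by (rule Lim_transform_eventually)
      (auto intro: eventually_mono[OF eventually_le_at_bot[of 0]] simp: kap_def)
qed

text \<open>Where \<open>cos (ln s) = 1/2\<close>, the factor \<open>2 * exp (- (2 * pi))\<close>
  makes \<open>osc\<close> divide by \<open>exp (2 * pi)\<close>, so \<open>ln s\<close> goes back
  by exactly one period. This gives explicit orbits. The factor is also small enough for
  \<open>osc\<close> to halve distances.\<close>

definition osc :: "real \<Rightarrow> real" where
  "osc s = (if s \<le> 0 then 0 else 2 * exp (- (2 * pi)) * s * cos (ln s))"

text \<open>It tends to 0, but only like the reciprocal of the logarithm: along points whose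
  logarithms increase by \<open>2 * pi\<close>, its values are a constant sine times the terms of a
  harmonic-type series. It is continuous at 1 because \<open>sin (ln 1) = 0\<close>.\<close>

definition delt :: "real \<Rightarrow> real" where
  "delt s = (if s \<le> 1 then 0 else sin (ln s) / (1 + ln s))"

lemma osc_nonpos: "s \<le> 0 \<Longrightarrow> osc s = 0"
  by (simp add: osc_def)

text \<open>On the positive axis the derivative of \<open>osc\<close> is
  \<open>2 * exp (- (2 * pi))\<close> times a difference of a cosine and a sine, so at most
  \<open>4 * exp (- (2 * pi))\<close> in modulus; the constant 8 brings this below 1/2.\<close>

lemma exp_2pi_small: "8 * exp (- (2 * pi)) \<le> 1"
proof -
  have "1 + pi \<le> exp pi" by (rule exp_ge_add_one_self)
  then have "4 \<le> exp pi" using pi_gt3 by linarith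
  then have "4 * 4 \<le> exp pi * exp pi" by (intro mult_mono) auto
  also have "\<dots> = exp (2 * pi)" by (simp add: exp_add[symmetric])
  finally have "8 \<le> exp (2 * pi)" by simp
  then show ?thesis by (simp add: exp_minus field_simps)
qed

lemma lipschitz_from_derivative:
  fixes f :: "real \<Rightarrow> real"
  assumes "convex S" "\<And>x. x \<in> S \<Longrightarrow> (f has_real_derivative f' x) (at x)"
    "\<And>x. x \<in> S \<Longrightarrow> \<bar>f' x\<bar> \<le> B" "x \<in> S" "y \<in> S"
  shows "\<bar>f x - f y\<bar> \<le> B * \<bar>x - y\<bar>"
  using field_differentiable_bound[of S f f' B x y] assms
  by (auto intro: has_field_derivative_at_within)

lemma osc_le_half: "0 \<le> s \<Longrightarrow> \<bar>osc s\<bar> \<le> s / 2"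
proof -
  assume s: "0 \<le> s"
  have "\<bar>osc s\<bar> \<le> 2 * exp (- (2 * pi)) * s"
    using s by (auto simp: osc_def abs_mult intro!: mult_left_le)
  also have "\<dots> \<le> s / 2" using exp_2pi_small s
    mult_right_mono[OF exp_2pi_small s] by simp
  finally show ?thesis .
qed

lemma osc_lipschitz: "\<bar>osc s - osc t\<bar> \<le> \<bar>s - t\<bar> / 2"
proof -
  let ?a = "2 * exp (- (2 * pi))"
  have pos: "\<bar>osc s - osc t\<bar> \<le> (1/2) * \<bar>s - t\<bar>" if "0 < s" "0 < t" for s t
  proof -
    have "\<bar>?a * s * cos (ln s) - ?a * t * cos (ln t)\<bar> \<le> (1/2) * \<bar>s - t\<bar>"
    proof (rule lipschitz_from_derivative[where S = "{0<..}" and f = "\<lambda>s. ?a * s * cos (ln s)"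
          and f' = "\<lambda>x. ?a * (cos (ln x) - sin (ln x))"])
      fix x :: real assume "x \<in> {0<..}"
      then show "((\<lambda>s. ?a * s * cos (ln s)) has_real_derivative ?a * (cos (ln x) - sin (ln x))) (at x)"
        by (auto intro!: derivative_eq_intros simp: field_simps)
      have "\<bar>cos (ln x) - sin (ln x)\<bar> \<le> 2"
        using abs_cos_le_one[of "ln x"] abs_sin_le_one[of "ln x"] by linarith
      then have "?a * \<bar>cos (ln x) - sin (ln x)\<bar> \<le> ?a * 2" by (intro mult_left_mono) auto
      moreover have "\<bar>?a * (cos (ln x) - sin (ln x))\<bar> = ?a * \<bar>cos (ln x) - sin (ln x)\<bar>"
        by (simp add: abs_mult)
      ultimately show "\<bar>?a * (cos (ln x) - sin (ln x))\<bar> \<le> 1/2"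
        using exp_2pi_small by linarith
    qed (use that in auto)
    then show ?thesis using that by (simp add: osc_def)
  qed
  \<comment> \<open>\<open>osc\<close> is not differentiable at 0, so the derivative bound does not
    reach across 0. For a pair on both sides one of the values is 0, and \<open>osc_le_half\<close>
    bounds the other.\<close>
  consider "0 < s" "0 < t" | "s \<le> 0" "t \<le> 0" | "s \<le> 0" "0 < t" | "0 < s" "t \<le> 0" by linarith
  then show ?thesis
  proof cases
    case 1 then show ?thesis using pos by simp
  next
    case 2 then show ?thesis by (simp add: osc_nonpos)
  next
    case 3 then show ?thesis using osc_le_half[of t] by (simp add: osc_nonpos)
  next
    case 4 then show ?thesis using osc_le_half[of s] by (simp add: osc_nonpos)
  qed
qed

lemma lipschitz_real_continuous:
  fixes f :: "real \<Rightarrow> real"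
  assumes "\<And>s t. \<bar>f s - f t\<bar> \<le> L * \<bar>s - t\<bar>"
  shows "continuous_on UNIV f"
proof -
  have "0 \<le> L" using assms[of 0 1] by simp
  show ?thesis
    by (rule lipschitz_on_continuous_on[of L]) (use assms \<open>0 \<le> L\<close> in \<open>auto simp: lipschitz_on_def dist_real_def\<close>)
qed

lemma osc_continuous: "continuous_on UNIV osc"
  by (rule lipschitz_real_continuous[of _ "1/2"]) (use osc_lipschitz in simp)

lemma surj_on_tails:
  fixes f :: "real \<Rightarrow> real"
  assumes f: "continuous_on UNIV f" and up: "\<And>N B. \<exists>s>N. f s > B" and dn: "\<And>N B. \<exists>s>N. f s < B"
  shows "\<exists>s>N. f s = t"
proof -
  obtain a where a: "a > N" "f a < t" using dn by blast
  obtain b where b: "b > N" "f b > t" using up by blast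
  have c: "continuous_on S f" for S using f continuous_on_subset by blast
  show ?thesis
  proof (cases "a \<le> b")
    case True
    then obtain x where "a \<le> x" "x \<le> b" "f x = t" using IVT'[of f a t b] a b c by fastforce
    then show ?thesis using a by (intro exI[of _ x]) auto
  next
    case False
    then obtain x where "b \<le> x" "x \<le> a" "f x = t" using IVT2'[of f a t b] a b c by fastforce
    then show ?thesis using b by (intro exI[of _ x]) auto
  qed
qed

lemma cos_2pi_nat: "cos (x + 2 * pi * real j) = cos x"
proof -
  have "2 * pi * real j = 2 * real j * pi" by simp
  then show ?thesis by (simp only: cos_add cos_2npi sin_2npi mult_1_right mult_zero_right diff_zero)
qed

lemma sin_2pi_nat: "sin (x + 2 * pi * real j) = sin x"
proof -
  have "2 * pi * real j = 2 * real j * pi" by simp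
  then show ?thesis by (simp only: sin_add cos_2npi sin_2npi mult_1_right mult_zero_right add_0_right)
qed

lemma exists_nat_2pi: "\<exists>j::nat. B < 2 * pi * real j"
proof -
  obtain j :: nat where "B < real j" using reals_Archimedean2 by blast
  moreover have "1 * real j \<le> 2 * pi * real j" using pi_gt3 by (intro mult_right_mono) auto
  ultimately show ?thesis by (intro exI[of _ j]) linarith
qed

lemma osc_surj: "\<exists>s>N. osc s = t"
proof (rule surj_on_tails[OF osc_continuous])
  let ?a = "2 * exp (- (2 * pi))"
  have a: "?a > 0" by simp
  fix N B :: real
  obtain j :: nat where j: "max \<bar>N\<bar> (\<bar>B\<bar> / ?a) < 2 * pi * real j" using exists_nat_2pi by blast
  \<comment> \<open>The cosine of the logarithm is 1 here and -1 at \<open>s'\<close> below, so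
    \<open>osc\<close> has its full amplitude with either sign.\<close>
  define s where "s = exp (2 * pi * real j)"
  have s: "s > \<bar>N\<bar>" "s > \<bar>B\<bar> / ?a"
    using j exp_ge_add_one_self[of "2 * pi * real j"] unfolding s_def by linarith+
  have "osc s = ?a * s * cos (0 + 2 * pi * real j)" by (simp add: osc_def s_def)
  then have "osc s = ?a * s" by (simp only: cos_2pi_nat) simp
  moreover have "\<bar>B\<bar> < ?a * s" using s(2) a by (simp add: pos_divide_less_eq mult.commute)
  ultimately show "\<exists>s>N. B < osc s" using s by (intro exI[of _ s]) auto
  define s' where "s' = exp (pi + 2 * pi * real j)"
  have s': "s' > \<bar>N\<bar>" "s' > \<bar>B\<bar> / ?a"
    using j exp_ge_add_one_self[of "pi + 2 * pi * real j"] pi_gt_zero unfolding s'_def by linarith+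
  have "osc s' = ?a * s' * cos (pi + 2 * pi * real j)" by (simp add: osc_def s'_def)
  then have "osc s' = - (?a * s')" by (simp only: cos_2pi_nat) simp
  moreover have "\<bar>B\<bar> < ?a * s'" using s'(2) a by (simp add: pos_divide_less_eq mult.commute)
  ultimately show "\<exists>s>N. osc s < B" using s' by (intro exI[of _ s']) auto
qed

lemma delt_lipschitz: "\<bar>delt s - delt t\<bar> \<le> 2 * \<bar>s - t\<bar>"
proof -
  have pos: "\<bar>sin (ln s) / (1 + ln s) - sin (ln t) / (1 + ln t)\<bar> \<le> 2 * \<bar>s - t\<bar>" if "1 \<le> s" "1 \<le> t" for s t :: real
  proof (rule lipschitz_from_derivative[where S = "{1..}" and f = "\<lambda>s. sin (ln s) / (1 + ln s)"
        and f' = "\<lambda>x. (cos (ln x) * (1 + ln x) - sin (ln x)) / (x * (1 + ln x)^2)"])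
    fix x :: real assume "x \<in> {1..}"
    then have x: "1 \<le> x" "0 \<le> ln x" by auto
    have nz: "1 + ln x \<noteq> 0" using x by linarith
    have "((\<lambda>s. sin (ln s) / (1 + ln s)) has_real_derivative
       (cos (ln x) * (1 / x) * (1 + ln x) - sin (ln x) * (1 / x)) / ((1 + ln x) * (1 + ln x))) (at x)"
      using x nz by (auto intro!: derivative_eq_intros)
    also have "(cos (ln x) * (1 / x) * (1 + ln x) - sin (ln x) * (1 / x)) / ((1 + ln x) * (1 + ln x))
        = (cos (ln x) * (1 + ln x) - sin (ln x)) / (x * (1 + ln x)^2)"
      by (simp add: power2_eq_square diff_divide_distrib mult.assoc)
    finally show "((\<lambda>s. sin (ln s) / (1 + ln s)) has_real_derivative
       (cos (ln x) * (1 + ln x) - sin (ln x)) / (x * (1 + ln x)^2)) (at x)" .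
    have "\<bar>cos (ln x) * (1 + ln x) - sin (ln x)\<bar> \<le> \<bar>cos (ln x) * (1 + ln x)\<bar> + \<bar>sin (ln x)\<bar>" by linarith
    also have "\<dots> \<le> 1 * (1 + ln x) + 1" using x
      by (intro add_mono) (auto simp: abs_mult intro!: mult_left_le_one_le)
    also have "\<dots> \<le> 2 * (1 + ln x)" using x by simp
    also have "1 + ln x \<le> x * (1 + ln x)^2"
    proof -
      have "1 * ((1 + ln x) * 1) \<le> x * ((1 + ln x) * (1 + ln x))"
        using x by (intro mult_mono) auto
      then show ?thesis by (simp add: power2_eq_square)
    qed
    finally have "\<bar>cos (ln x) * (1 + ln x) - sin (ln x)\<bar> \<le> 2 * (x * (1 + ln x)^2)" by simp
    moreover have "0 < x * (1 + ln x)^2" using x nz by simp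
    ultimately show "\<bar>(cos (ln x) * (1 + ln x) - sin (ln x)) / (x * (1 + ln x)^2)\<bar> \<le> 2"
      by (simp only: abs_divide abs_of_pos pos_divide_le_eq)
  qed (use that in auto)
  \<comment> \<open>As the formula vanishes at 1, clamping the argument replaces the case
    distinction, and clamping does not increase distances.\<close>
  have e: "delt s = sin (ln (max 1 s)) / (1 + ln (max 1 s))" for s by (simp add: delt_def max_def)
  have "\<bar>max 1 s - max 1 t\<bar> \<le> \<bar>s - t\<bar>" by linarith
  then show ?thesis using pos[of "max 1 s" "max 1 t"] e by auto
qed

lemma delt_at_top: "(delt \<longlongrightarrow> 0) at_top"
proof -
  have "((\<lambda>s. sin (ln s) / (1 + ln s)) \<longlongrightarrow> (0::real)) at_top" by real_asymp
  then show ?thesis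
    by (rule Lim_transform_eventually)
      (auto intro: eventually_mono[OF eventually_gt_at_top[of 1]] simp: delt_def)
qed

text \<open>The sum of \<open>delt\<close> along the orbit of \<open>s\<close> under
  \<open>osc\<close>, hence a solution of \<open>rho s - rho (osc s) = delt s\<close>. The sum is
  finite: \<open>osc\<close> at most halves a positive argument, so the orbit soon stays at or below
  1, where \<open>delt\<close> vanishes.\<close>

function rho :: "real \<Rightarrow> real" where
  "rho s = (if s \<le> 1 then 0 else delt s + rho (osc s))"
  by auto
termination
proof (relation "Wellfounded.measure (\<lambda>s. nat \<lceil>s\<rceil>)")
  fix s :: real assume "\<not> s \<le> 1"
  moreover have "osc s \<le> s / 2" using osc_le_half[of s] calculation by auto
  moreover have "1 < \<lceil>s\<rceil>" using calculation(1) by linarith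
  ultimately have "\<lceil>osc s\<rceil> < \<lceil>s\<rceil>" by linarith
  then show "(osc s, s) \<in> Wellfounded.measure (\<lambda>s. nat \<lceil>s\<rceil>)" using \<open>1 < \<lceil>s\<rceil>\<close> by simp
qed simp

declare rho.simps [simp del]

lemma rho_le_1: "s \<le> 1 \<Longrightarrow> rho s = 0"
  by (simp add: rho.simps)

lemma osc_le_1: "s \<le> 1 \<Longrightarrow> osc s \<le> 1"
  using osc_le_half[of s] osc_nonpos[of s] by (cases "s \<le> 0") auto

lemma rho_eq: "rho s = delt s + rho (osc s)"
  using osc_le_1[of s] by (cases "s \<le> 1") (auto simp: rho_le_1 delt_def rho.simps[of s])

text \<open>The constant 4 solves \<open>L = 2 + L / 2\<close>: \<open>delt\<close> contributes 2,
  and \<open>osc\<close> halves the constant of the remaining sum. The induction runs over the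
  bounds \<open>2 ^ n\<close>, since \<open>osc\<close> takes arguments below one of them to
  arguments below the previous one.\<close>

lemma rho_lipschitz: "\<bar>rho s - rho t\<bar> \<le> 4 * \<bar>s - t\<bar>"
proof -
  have "\<bar>rho s - rho t\<bar> \<le> 4 * \<bar>s - t\<bar>" if "s \<le> 2^n" "t \<le> 2^n" for n s t
    using that
  proof (induction n arbitrary: s t)
    case 0 then show ?case by (simp add: rho_le_1)
  next
    case (Suc n)
    have "osc x \<le> 2^n" if "x \<le> 2^Suc n" for x
      using that osc_le_half[of x] osc_nonpos[of x] zero_le_power[of "2::real" n] by (cases "x \<le> 0") auto
    then have "\<bar>rho (osc s) - rho (osc t)\<bar> \<le> 4 * \<bar>osc s - osc t\<bar>" using Suc by blast
    moreover have "4 * \<bar>osc s - osc t\<bar> \<le> 2 * \<bar>s - t\<bar>" using osc_lipschitz[of s t] by simp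
    moreover have "rho s - rho t = (delt s - delt t) + (rho (osc s) - rho (osc t))"
      using rho_eq[of s] rho_eq[of t] by simp
    moreover note delt_lipschitz[of s t]
    ultimately show ?case by linarith
  qed
  moreover obtain n where "max s t < 2^n" using real_arch_pow[of 2 "max s t"] by auto
  then have "s \<le> 2^n" "t \<le> 2^n" by linarith+
  ultimately show ?thesis by blast
qed

lemma rho_continuous: "continuous_on UNIV rho"
  by (rule lipschitz_real_continuous[of _ 4]) (rule rho_lipschitz)

text \<open>The points with logarithm \<open>\<theta> + 2\<pi>j\<close>, where \<open>cos \<theta> = 1/2\<close>, form an orbit of \<open>osc\<close> along which
  \<open>rho\<close> is a partial sum of a harmonic series.\<close>

lemma rho_orbit:
  assumes "cos \<theta> = 1/2" "0 < \<theta>" "\<theta> \<le> 2 * pi"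
  shows "rho (exp (\<theta> + 2 * pi * real j)) = sin \<theta> * (\<Sum>i\<le>j. 1 / (1 + \<theta> + 2 * pi * real i))"
proof -
  have d: "delt (exp (\<theta> + 2 * pi * real i)) = sin \<theta> * (1 / (1 + \<theta> + 2 * pi * real i))" for i
  proof -
    have "0 < \<theta> + 2 * pi * real i" using assms by (intro add_pos_nonneg) auto
    then have "1 < exp (\<theta> + 2 * pi * real i)" by simp
    then show ?thesis by (simp add: delt_def sin_2pi_nat add.assoc)
  qed
  have o: "osc (exp (\<theta> + 2 * pi * real i)) = exp (\<theta> + 2 * pi * real i - 2 * pi)" for i
  proof -
    have "osc (exp (\<theta> + 2 * pi * real i)) = 2 * exp (- (2 * pi)) * exp (\<theta> + 2 * pi * real i) * (1/2)"
      unfolding osc_def using assms(1) by (simp only: ln_exp cos_2pi_nat) simp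
    also have "\<dots> = exp (\<theta> + 2 * pi * real i) * exp (- (2 * pi))" by simp
    also have "\<dots> = exp (\<theta> + 2 * pi * real i - 2 * pi)" by (simp only: exp_add[symmetric]) simp
    finally show ?thesis .
  qed
  show ?thesis
  proof (induction j)
    case 0
    \<comment> \<open>Since \<open>\<theta> \<le> 2 * pi\<close>, one more application of
      \<open>osc\<close> lands at or below 1, and the sum ends.\<close>
    have "rho (osc (exp (\<theta> + 2 * pi * real 0))) = 0" using assms o[of 0] by (intro rho_le_1) auto
    then show ?case using rho_eq[of "exp (\<theta> + 2 * pi * real 0)"] d[of 0] by simp
  next
    case (Suc j)
    have "\<theta> + 2 * pi * real (Suc j) - 2 * pi = \<theta> + 2 * pi * real j" by (simp add: distrib_left)
    then have "osc (exp (\<theta> + 2 * pi * real (Suc j))) = exp (\<theta> + 2 * pi * real j)"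
      by (simp only: o)
    then have "rho (exp (\<theta> + 2 * pi * real (Suc j))) =
        sin \<theta> * (1 / (1 + \<theta> + 2 * pi * real (Suc j))) + rho (exp (\<theta> + 2 * pi * real j))"
      using rho_eq[of "exp (\<theta> + 2 * pi * real (Suc j))"] by (simp only: d)
    then show ?case by (simp only: Suc.IH sum.atMost_Suc distrib_left[of "sin \<theta>"] add.commute)
  qed
qed

lemma orbit_sum_unbounded:
  assumes "0 < \<theta>" "\<theta> \<le> 2 * pi"
  shows "\<exists>j. B < (\<Sum>i\<le>j. 1 / (1 + \<theta> + 2 * pi * real i)) \<and> N < exp (\<theta> + 2 * pi * real j)"
proof -
  have p4: "pi < 4" using pi_less_4 .
  \<comment> \<open>As \<open>pi < 4\<close>, each denominator is at most \<open>9 + 8 * i\<close>,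
    hence at most 10 times \<open>i + 1\<close>; so the sum is at least a tenth of a harmonic
    number.\<close>
  have le: "harm (Suc j) / 10 \<le> (\<Sum>i\<le>j. 1 / (1 + \<theta> + 2 * pi * real i))" for j
  proof -
    have "harm (Suc j) / 10 = (\<Sum>i\<le>j. inverse (real (Suc i)) / 10)"
      by (induction j) (simp_all add: harm_Suc harm_def add_divide_distrib)
    also have "\<dots> \<le> (\<Sum>i\<le>j. 1 / (1 + \<theta> + 2 * pi * real i))"
    proof (rule sum_mono)
      fix i
      have "2 * pi * real i \<le> 8 * real i" using p4 by (intro mult_right_mono) auto
      then have "1 + \<theta> + 2 * pi * real i \<le> 10 * real (Suc i)" using assms p4 by simp
      moreover have "0 < 1 + \<theta> + 2 * pi * real i" using assms by (simp add: add_pos_nonneg)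
      ultimately show "inverse (real (Suc i)) / 10 \<le> 1 / (1 + \<theta> + 2 * pi * real i)"
        by (simp add: field_simps)
    qed
    finally show ?thesis .
  qed
  have "filterlim (harm :: nat \<Rightarrow> real) at_top sequentially" by (rule harm_at_top)
  then have "\<forall>\<^sub>F n in sequentially. 10 * B < harm n"
    by (simp add: filterlim_at_top_dense)
  then obtain m where m: "\<And>n. n \<ge> m \<Longrightarrow> 10 * B < harm n"
    by (auto simp: eventually_sequentially)
  obtain k :: nat where k: "N < 2 * pi * real k" using exists_nat_2pi by blast
  define j where "j = max m k"
  have j: "10 * B < harm (Suc j)" "j \<ge> k" using m[of "Suc j"] by (auto simp: j_def)
  have "2 * pi * real k \<le> 2 * pi * real j" using j by (intro mult_left_mono) auto
  then have "N < exp (\<theta> + 2 * pi * real j)"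
    using k exp_ge_add_one_self[of "\<theta> + 2 * pi * real j"] assms by linarith
  then show ?thesis using le[of j] j by (intro exI[of _ j]) auto
qed

text \<open>The angles \<open>pi/3\<close> and \<open>2 * pi - pi/3\<close> both have cosine 1/2,
  but opposite sines: the corresponding orbits drive \<open>rho\<close> to plus and to minus
  infinity.\<close>

lemma rho_surj: "\<exists>s>N. rho s = t"
proof (rule surj_on_tails[OF rho_continuous])
  fix N B :: real
  have pi: "0 < pi / 3" "pi / 3 \<le> 2 * pi" "0 < 2 * pi - pi / 3" "2 * pi - pi / 3 \<le> 2 * pi" using pi_gt_zero by auto
  obtain j where j: "\<bar>B\<bar> / sin (pi/3) < (\<Sum>i\<le>j. 1 / (1 + pi/3 + 2 * pi * real i))"
      "N < exp (pi/3 + 2 * pi * real j)" using orbit_sum_unbounded[OF pi(1,2)] by blast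
  have sp: "0 < sin (pi/3)" by (simp add: sin_60)
  have "rho (exp (pi/3 + 2 * pi * real j)) = sin (pi/3) * (\<Sum>i\<le>j. 1 / (1 + pi/3 + 2 * pi * real i))"
    by (rule rho_orbit) (use pi in \<open>auto simp: cos_60\<close>)
  moreover have "\<bar>B\<bar> < sin (pi/3) * (\<Sum>i\<le>j. 1 / (1 + pi/3 + 2 * pi * real i))"
    using j(1) sp by (simp add: pos_divide_less_eq mult.commute)
  ultimately show "\<exists>s>N. B < rho s" using j(2) by (intro exI[of _ "exp (pi/3 + 2 * pi * real j)"]) auto
  let ?t = "2 * pi - pi/3"
  obtain j where j: "\<bar>B\<bar> / sin (pi/3) < (\<Sum>i\<le>j. 1 / (1 + ?t + 2 * pi * real i))"
      "N < exp (?t + 2 * pi * real j)" using orbit_sum_unbounded[OF pi(3,4)] by blast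
  have st: "sin ?t = - sin (pi/3)" "cos ?t = 1/2" by (simp_all only: sin_diff cos_diff) (simp_all add: cos_60)
  have "rho (exp (?t + 2 * pi * real j)) = sin ?t * (\<Sum>i\<le>j. 1 / (1 + ?t + 2 * pi * real i))"
    by (rule rho_orbit) (use pi st in auto)
  moreover have "\<bar>B\<bar> < sin (pi/3) * (\<Sum>i\<le>j. 1 / (1 + ?t + 2 * pi * real i))"
    using j(1) sp by (simp only: pos_divide_less_eq mult.commute)
  ultimately show "\<exists>s>N. rho s < B" using j(2) st by (intro exI[of _ "exp (?t + 2 * pi * real j)"]) auto
qed

section \<open>The line and its closure\<close>

text \<open>Splits the number of a word into its first letter and the number \<open>m\<close> of the
  remaining word; \<open>m < n\<close> serves the inductions on word numbers.\<close>

lemma mod3_cases: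
  fixes n :: nat
  obtains "n = 0" | m where "n = Suc (3 * m)" "m < n" | m where "n = Suc (Suc (3 * m))" "m < n"
    | m where "n = 3 * m + 3" "m < n"
proof -
  have "n = 0 \<or> (\<exists>m<n. n = Suc (3 * m)) \<or> (\<exists>m<n. n = Suc (Suc (3 * m))) \<or> (\<exists>m<n. n = 3 * m + 3)"
    by presburger
  then show thesis using that by blast
qed

lemma mod3_simps:
  fixes m :: nat
  shows "(Suc (3 * m) = 0) = False" "(Suc (Suc (3 * m)) = 0) = False" "(3 * m + 3 = 0) = False"
    "((Suc (3 * m)) mod 3 = 1) = True" "((Suc (Suc (3 * m))) mod 3 = 1) = False" "((3 * m + 3) mod 3 = 1) = False"
    "((Suc (Suc (3 * m))) mod 3 = 2) = True" "((3 * m + 3) mod 3 = 2) = False"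
    "(Suc (3 * m)) div 3 = m" "(Suc (Suc (3 * m))) div 3 = m" "(3 * m + 3) div 3 - 1 = m"
    "((0::nat) = 0) = True"
  by presburger+

text \<open>The words over a three-letter alphabet are numbered by bijective ternary notation: \<open>0\<close> is the
  empty word, and \<open>3m+1\<close>, \<open>3m+2\<close>, \<open>3m+3\<close> put a letter in front of the word \<open>m\<close>. The letters
  stand for \<open>osc\<close>, for \<open>osc\<close> after reflection, and for \<open>rho\<close>.\<close>

function Phi :: "real \<Rightarrow> nat \<Rightarrow> real" where
  "Phi s n =
    (if n = 0 then kap s
     else if n mod 3 = 1 then Phi (osc s) (n div 3)
     else if n mod 3 = 2 then Phi (osc (- s)) (n div 3)
     else Phi (rho s) (n div 3 - 1))"
  by auto
termination by (relation "Wellfounded.measure snd") auto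

declare Phi.simps [simp del]

lemma Phi_simps [simp]:
  "Phi s 0 = kap s"
  "Phi s (Suc (3 * m)) = Phi (osc s) m"
  "Phi s (Suc (Suc (3 * m))) = Phi (osc (- s)) m"
  "Phi s (3 * m + 3) = Phi (rho s) m"
  by (subst Phi.simps, simp only: mod3_simps if_True if_False)+

text \<open>The limit of \<open>Phi s\<close> when \<open>s\<close> tends to infinity while
  \<open>Phi (osc s)\<close> tends to \<open>z\<close>: \<open>kap s\<close> tends to 1,
  \<open>osc (- s)\<close> is 0, and \<open>rho s\<close> is asymptotic to
  \<open>rho (osc s)\<close>, so the \<open>rho\<close> coordinates are those of \<open>z\<close>
  itself.\<close>

definition iP :: "(nat \<Rightarrow> real) \<Rightarrow> nat \<Rightarrow> real" where
  "iP z n =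
    (if n = 0 then 1 else if n mod 3 = 1 then z (n div 3)
     else if n mod 3 = 2 then Phi 0 (n div 3) else z n)"

text \<open>The limit at the left end, where \<open>Phi (osc (- s))\<close> tends to
  \<open>z\<close> and both \<open>osc s\<close> and \<open>rho s\<close> are 0.\<close>

definition iM :: "(nat \<Rightarrow> real) \<Rightarrow> nat \<Rightarrow> real" where
  "iM z n =
    (if n = 0 then - 1 else if n mod 3 = 1 then Phi 0 (n div 3)
     else if n mod 3 = 2 then z (n div 3) else Phi 0 (n div 3 - 1))"

text \<open>The fixed point of \<open>iP\<close> with prescribed \<open>rho\<close> coordinates:
  being fixed by \<open>iP\<close> determines all other coordinates recursively and leaves these
  free.\<close>

function iA :: "(nat \<Rightarrow> real) \<Rightarrow> nat \<Rightarrow> real" where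
  "iA z n =
    (if n = 0 then 1 else if n mod 3 = 1 then iA z (n div 3)
     else if n mod 3 = 2 then Phi 0 (n div 3) else z (n div 3 - 1))"
  by auto
termination by (relation "Wellfounded.measure snd") auto

declare iA.simps [simp del]

lemma iP_simps [simp]:
  "iP z 0 = 1" "iP z (Suc (3 * m)) = z m" "iP z (Suc (Suc (3 * m))) = Phi 0 m" "iP z (3 * m + 3) = z (3 * m + 3)"
  unfolding iP_def by (simp_all only: mod3_simps if_True if_False)

lemma iM_simps [simp]:
  "iM z 0 = - 1" "iM z (Suc (3 * m)) = Phi 0 m" "iM z (Suc (Suc (3 * m))) = z m" "iM z (3 * m + 3) = Phi 0 m"
  unfolding iM_def by (simp_all only: mod3_simps if_True if_False)

lemma iA_simps [simp]:
  "iA z 0 = 1" "iA z (Suc (3 * m)) = iA z m" "iA z (Suc (Suc (3 * m))) = Phi 0 m" "iA z (3 * m + 3) = z m"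
  by (subst iA.simps, simp only: mod3_simps if_True if_False)+

text \<open>Uniform continuity of each coordinate is needed to pass from \<open>delt s\<close>
  tending to 0 to asymptotically equal \<open>rho\<close> coordinates. All three letters are
  4-Lipschitz, so the constant depends on the word only.\<close>

lemma Phi_lipschitz: "\<exists>L\<ge>0. \<forall>s t. \<bar>Phi s n - Phi t n\<bar> \<le> L * \<bar>s - t\<bar>"
proof (induction n rule: less_induct)
  case (less n)
  have comp: "\<exists>L\<ge>0. \<forall>s t. \<bar>Phi (g s) m - Phi (g t) m\<bar> \<le> L * \<bar>s - t\<bar>"
    if "m < n" and g: "\<And>s t. \<bar>g s - g t\<bar> \<le> 4 * \<bar>s - t\<bar>" for m and g :: "real \<Rightarrow> real"
  proof -
    obtain L where L: "L \<ge> 0" "\<And>s t. \<bar>Phi s m - Phi t m\<bar> \<le> L * \<bar>s - t\<bar>"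
      using less[OF \<open>m < n\<close>] by blast
    have "\<bar>Phi (g s) m - Phi (g t) m\<bar> \<le> (L * 4) * \<bar>s - t\<bar>" for s t
      using L(2)[of "g s" "g t"] mult_left_mono[OF g[of s t] L(1)] by simp
    then show ?thesis using L(1) by (intro exI[of _ "L * 4"]) auto
  qed
  have osc4: "\<bar>osc s - osc t\<bar> \<le> 4 * \<bar>s - t\<bar>" for s t using osc_lipschitz[of s t] by linarith
  have osc4': "\<bar>osc (- s) - osc (- t)\<bar> \<le> 4 * \<bar>s - t\<bar>" for s t using osc4[of "- s" "- t"] by (simp add: abs_minus_commute)
  show ?case
  proof (cases n rule: mod3_cases)
    case 1 then show ?thesis using kap_lipschitz by (intro exI[of _ 1]) auto
  next
    case (2 m) then show ?thesis using comp[OF _ osc4, of m] by simp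
  next
    case (3 m) then show ?thesis using comp[of m "\<lambda>s. osc (- s)", OF _ osc4'] by simp
  next
    case (4 m) then show ?thesis using comp[OF _ rho_lipschitz, of m] by simp
  qed
qed

lemma Phi_coord_continuous: "continuous_on UNIV (\<lambda>s. Phi s n)"
proof -
  obtain L where "\<And>s t. \<bar>Phi s n - Phi t n\<bar> \<le> L * \<bar>s - t\<bar>" using Phi_lipschitz by blast
  then show ?thesis by (rule lipschitz_real_continuous)
qed

lemma Phi_continuous: "continuous_on S Phi"
  by (rule continuous_on_coordinatewise_then_product)
    (rule continuous_on_subset[OF Phi_coord_continuous subset_UNIV])

lemma Phi_bounded: "\<bar>Phi s n\<bar> \<le> 1"
proof (induction n arbitrary: s rule: less_induct)
  case (less n)
  show ?case
  proof (cases n rule: mod3_cases)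
    case 1 then show ?thesis using abs_kap_less[of s] by simp
  next
    case (2 m) then show ?thesis using less by simp
  qed (use less in simp_all)
qed

section \<open>Compactness and connectedness of the closure of the line\<close>

definition X :: "(nat \<Rightarrow> real) set" where
  "X = closure (range Phi)"

lemma Phi_in_X [simp]: "Phi s \<in> X"
  unfolding X_def by (rule subsetD[OF closure_subset]) simp

lemma closed_X: "closed X"
  by (simp add: X_def)

lemma continuous_on_coord: "continuous_on S (\<lambda>x :: nat \<Rightarrow> real. x n)"
  by (rule continuous_on_product_coordinates[THEN continuous_on_subset]) simp

lemma X_bounded: "x \<in> X \<Longrightarrow> \<bar>x n\<bar> \<le> 1"
proof -
  have c: "closed {x :: nat \<Rightarrow> real. \<bar>x n\<bar> \<le> 1}"
    by (intro closed_Collect_le continuous_intros continuous_on_coord)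
  have "X \<subseteq> {x. \<bar>x n\<bar> \<le> 1}"
    unfolding X_def by (rule closure_minimal) (use Phi_bounded c in auto)
  then show "x \<in> X \<Longrightarrow> \<bar>x n\<bar> \<le> 1" by blast
qed

lemma compact_cube: "compact {x :: nat \<Rightarrow> real. \<forall>n. \<bar>x n\<bar> \<le> 1}"
proof -
  have "compactin (product_topology (\<lambda>n. euclidean) UNIV) (PiE UNIV (\<lambda>n::nat. {-1..1::real}))"
    by (simp add: compactin_PiE)
  moreover have "PiE UNIV (\<lambda>n::nat. {-1..1::real}) = {x. \<forall>n. \<bar>x n\<bar> \<le> 1}"
    by (auto simp: PiE_def Pi_def abs_le_iff minus_le_iff)
  ultimately show ?thesis by (simp add: euclidean_product_topology)
qed

lemma compact_X: "compact X"
proof -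
  have "X = {x. \<forall>n. \<bar>x n\<bar> \<le> 1} \<inter> X" using X_bounded by blast
  then show ?thesis using compact_cube closed_X compact_Int_closed by metis
qed

lemma connected_X: "connected X"
  unfolding X_def by (intro connected_imp_connected_closure connected_continuous_image Phi_continuous) simp

section \<open>Continuity and injectivity of the three embeddings\<close>

lemma iP_continuous: "continuous_on S iP"
proof (intro continuous_on_coordinatewise_then_product)
  fix n show "continuous_on S (\<lambda>x. iP x n)"
    by (cases n rule: mod3_cases) (simp_all add: continuous_on_coord continuous_on_const)
qed

lemma iM_continuous: "continuous_on S iM"
proof (intro continuous_on_coordinatewise_then_product)
  fix n show "continuous_on S (\<lambda>x. iM x n)"
    by (cases n rule: mod3_cases) (simp_all add: continuous_on_coord continuous_on_const)
qed

lemma iA_continuous: "continuous_on S iA"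
proof (intro continuous_on_coordinatewise_then_product)
  fix n show "continuous_on S (\<lambda>x. iA x n)"
  proof (induction n rule: less_induct)
    case (less n)
    show ?case
    proof (cases n rule: mod3_cases)
      case (2 m) then show ?thesis using less by simp
    qed (auto intro: continuous_on_coord)
  qed
qed

lemma iP_inject: "iP x = iP y \<longleftrightarrow> x = y"
  using iP_simps(2) by (metis ext)

lemma iM_inject: "iM x = iM y \<longleftrightarrow> x = y"
  using iM_simps(3) by (metis ext)

lemma iA_inject: "iA x = iA y \<longleftrightarrow> x = y"
  using iA_simps(4) by (metis ext)

lemma tendsto_coordwise:
  fixes f :: "nat \<Rightarrow> nat \<Rightarrow> real"
  assumes "\<And>n. (\<lambda>k. f k n) \<longlonglongrightarrow> l n"
  shows "f \<longlonglongrightarrow> l"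
proof -
  have "limitin (product_topology (\<lambda>n::nat. euclidean) UNIV) f l sequentially"
    using assms by (simp add: limitin_componentwise)
  then show ?thesis by (simp add: euclidean_product_topology)
qed

lemma coord_tendsto:
  fixes f :: "nat \<Rightarrow> nat \<Rightarrow> real"
  assumes "f \<longlonglongrightarrow> l"
  shows "(\<lambda>k. f k n) \<longlonglongrightarrow> l n"
  using continuous_on_tendsto_compose[OF continuous_on_coord[of UNIV n] assms] by simp

lemma image_closure_X:
  assumes "continuous_on UNIV f" "\<And>t. f (Phi t) \<in> X" "x \<in> X"
  shows "f x \<in> X"
proof -
  have "f ` closure (range Phi) \<subseteq> X"
    by (rule image_closure_subset) (use assms closed_X in \<open>auto intro: continuous_on_subset[OF assms(1)]\<close>)
  then show ?thesis using assms(3) unfolding X_def by blast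
qed

lemma X_limit:
  assumes "\<And>k. f k \<in> X" "f \<longlonglongrightarrow> l" shows "l \<in> X"
  using closed_X assms closed_sequentially by blast

section \<open>Limits of the line at its two ends\<close>

lemma sequence_to_infinity:
  fixes g :: "real \<Rightarrow> real"
  assumes "\<And>N. \<exists>s>N. g s = t"
  obtains s :: "nat \<Rightarrow> real" where "\<And>k. g (s k) = t" "filterlim s at_top sequentially"
proof -
  have "\<forall>k::nat. \<exists>s. s > real k \<and> g s = t" using assms by blast
  then obtain s where s: "\<And>k::nat. s k > real k \<and> g (s k) = t" by metis
  have "filterlim s at_top sequentially"
    by (rule filterlim_at_top_mono[OF filterlim_real_sequentially]) (use s in \<open>auto intro: less_imp_le always_eventually\<close>)
  then show thesis using that s by blast
qed

text \<open>Here the decay of \<open>delt\<close> enters. It makes the \<open>rho\<close>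
  coordinates survive under \<open>iP\<close>.\<close>

lemma Phi_rho_asymptotic:
  assumes "filterlim s at_top sequentially"
  shows "(\<lambda>k. Phi (rho (s k)) m - Phi (rho (osc (s k))) m) \<longlonglongrightarrow> 0"
proof -
  obtain L where L: "L \<ge> 0" "\<And>s t. \<bar>Phi s m - Phi t m\<bar> \<le> L * \<bar>s - t\<bar>" using Phi_lipschitz by blast
  have "(\<lambda>k. delt (s k)) \<longlonglongrightarrow> 0" using filterlim_compose[OF delt_at_top assms] .
  then have "(\<lambda>k. L * \<bar>delt (s k)\<bar>) \<longlonglongrightarrow> L * \<bar>0\<bar>" by (intro tendsto_intros)
  then have "(\<lambda>k. L * \<bar>delt (s k)\<bar>) \<longlonglongrightarrow> 0" by simp
  moreover have "norm (Phi (rho (s k)) m - Phi (rho (osc (s k))) m) \<le> L * \<bar>delt (s k)\<bar>" for k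
    using L(2)[of "rho (s k)" "rho (osc (s k))"] rho_eq[of "s k"] by simp
  then have "\<forall>\<^sub>F k in sequentially. norm (Phi (rho (s k)) m - Phi (rho (osc (s k))) m) \<le> L * \<bar>delt (s k)\<bar>"
    by (intro always_eventually allI)
  ultimately show ?thesis by (rule Lim_null_comparison[rotated])
qed

lemma Phi_tail_limit:
  assumes t: "filterlim s at_top sequentially" and z: "(\<lambda>k. Phi (osc (s k))) \<longlonglongrightarrow> z"
  shows "(\<lambda>k. Phi (s k)) \<longlonglongrightarrow> iP z"
proof (rule tendsto_coordwise)
  fix n
  show "(\<lambda>k. Phi (s k) n) \<longlonglongrightarrow> iP z n"
  proof (cases n rule: mod3_cases)
    case 1 then show ?thesis using filterlim_compose[OF kap_at_top t] by simp
  next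
    case (2 m) then show ?thesis using coord_tendsto[OF z, of m] by simp
  next
    case (3 m)
    have "\<forall>\<^sub>F k in sequentially. s k \<ge> 0" using t by (simp add: filterlim_at_top)
    then have "\<forall>\<^sub>F k in sequentially. Phi (osc (- s k)) m = Phi 0 m"
      by (rule eventually_mono) (simp add: osc_nonpos)
    then show ?thesis using 3 by (simp add: tendsto_eventually)
  next
    case (4 m)
    \<comment> \<open>Coordinate \<open>3 * m + 3\<close> of \<open>Phi (osc (s k))\<close> belongs
      to \<open>rho\<close> applied after \<open>osc\<close>; the asymptotic equality then removes
      \<open>osc\<close>.\<close>
    have "(\<lambda>k. Phi (osc (s k)) (3 * m + 3)) \<longlonglongrightarrow> z (3 * m + 3)" by (rule coord_tendsto[OF z])
    then have "(\<lambda>k. Phi (rho (osc (s k))) m) \<longlonglongrightarrow> z (3 * m + 3)" by simp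
    from tendsto_add[OF Phi_rho_asymptotic[OF t, of m] this] show ?thesis using 4 by simp
  qed
qed

lemma Phi_head_limit:
  assumes t: "filterlim (\<lambda>k. - s k) at_top sequentially" and z: "(\<lambda>k. Phi (osc (- s k))) \<longlonglongrightarrow> z"
  shows "(\<lambda>k. Phi (s k)) \<longlonglongrightarrow> iM z"
proof (rule tendsto_coordwise)
  fix n
  have neg: "\<forall>\<^sub>F k in sequentially. - s k \<ge> 0" using t unfolding filterlim_at_top by blast
  have bot: "filterlim s at_bot sequentially" using t by (simp add: filterlim_uminus_at_bot)
  show "(\<lambda>k. Phi (s k) n) \<longlonglongrightarrow> iM z n"
  proof (cases n rule: mod3_cases)
    case 1 then show ?thesis using filterlim_compose[OF kap_at_bot bot] by simp
  next
    case (2 m)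
    have "\<forall>\<^sub>F k in sequentially. Phi (osc (s k)) m = Phi 0 m"
      using neg by (rule eventually_mono) (simp add: osc_nonpos)
    then show ?thesis using 2 by (simp add: tendsto_eventually)
  next
    case (3 m) then show ?thesis using coord_tendsto[OF z, of m] by simp
  next
    case (4 m)
    have "\<forall>\<^sub>F k in sequentially. Phi (rho (s k)) m = Phi 0 m"
      using neg by (rule eventually_mono) (simp add: rho_le_1)
    then show ?thesis using 4 by (simp add: tendsto_eventually)
  qed
qed

text \<open>By continuity it suffices to treat the points \<open>Phi t\<close>. Since
  \<open>osc\<close> takes the value \<open>t\<close> arbitrarily far out, \<open>iP (Phi t)\<close>
  is a limit of points of the line.\<close>

lemma iP_in_X: "x \<in> X \<Longrightarrow> iP x \<in> X"
proof (rule image_closure_X[OF iP_continuous])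
  fix t
  obtain s where s: "\<And>k. osc (s k) = t" "filterlim s at_top sequentially"
    by (rule sequence_to_infinity[of osc t, OF osc_surj]) (rule that)
  have "(\<lambda>k. Phi (s k)) \<longlonglongrightarrow> iP (Phi t)" by (rule Phi_tail_limit) (simp_all add: s)
  then show "iP (Phi t) \<in> X" by (rule X_limit[rotated]) simp
qed

lemma iM_in_X: "x \<in> X \<Longrightarrow> iM x \<in> X"
proof (rule image_closure_X[OF iM_continuous])
  fix t
  obtain s where s: "\<And>k. osc (s k) = t" "filterlim s at_top sequentially"
    by (rule sequence_to_infinity[of osc t, OF osc_surj]) (rule that)
  have "(\<lambda>k. Phi (- s k)) \<longlonglongrightarrow> iM (Phi t)" by (rule Phi_head_limit) (simp_all add: s)
  then show "iM (Phi t) \<in> X" by (rule X_limit[rotated]) simp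
qed

lemma iP_power_in_X: "x \<in> X \<Longrightarrow> (iP ^^ n) x \<in> X"
  by (induction n) (auto intro: iP_in_X)

lemma iP_power_rho: "(iP ^^ n) z (3 * m + 3) = z (3 * m + 3)"
  by (induction n) auto

text \<open>\<open>iP\<close> keeps the \<open>rho\<close> coordinates and computes the others from
  shorter words, so every application settles at least one further coordinate.\<close>

lemma iP_power_eq_iA:
  "m < n \<Longrightarrow> (iP ^^ n) x m = iA (\<lambda>k. x (3 * k + 3)) m"
proof (induction m arbitrary: n rule: less_induct)
  case (less m)
  then obtain n' where n: "n = Suc n'" by (cases n) auto
  show ?case
  proof (cases m rule: mod3_cases)
    case 1 then show ?thesis using n by simp
  next
    case (2 l) then show ?thesis using n less.IH[of l n'] less.prems by simp
  next
    case (3 l) then show ?thesis using n by simp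
  next
    case (4 l) then show ?thesis using iP_power_rho[of n x l] by simp
  qed
qed

lemma iP_power_limit: "(\<lambda>n. (iP ^^ n) x) \<longlonglongrightarrow> iA (\<lambda>k. x (3 * k + 3))"
proof (rule tendsto_coordwise)
  fix m
  have "\<forall>\<^sub>F n in sequentially. (iP ^^ n) x m = iA (\<lambda>k. x (3 * k + 3)) m"
    using eventually_gt_at_top[of m] by (rule eventually_mono) (rule iP_power_eq_iA)
  then show "(\<lambda>n. (iP ^^ n) x m) \<longlonglongrightarrow> iA (\<lambda>k. x (3 * k + 3)) m" by (rule tendsto_eventually)
qed

text \<open>The iterates of \<open>iP\<close> at \<open>Phi s\<close> converge to the image under
  \<open>iA\<close> of the \<open>rho\<close> coordinates of \<open>Phi s\<close>, that is of
  \<open>Phi (rho s)\<close>, and \<open>rho\<close> is onto.\<close>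

lemma iA_in_X: "x \<in> X \<Longrightarrow> iA x \<in> X"
proof (rule image_closure_X[OF iA_continuous])
  fix t
  obtain s where s: "rho s = t" using rho_surj by blast
  have "(\<lambda>n. (iP ^^ n) (Phi s)) \<longlonglongrightarrow> iA (\<lambda>k. Phi s (3 * k + 3))" by (rule iP_power_limit)
  then have "(\<lambda>n. (iP ^^ n) (Phi s)) \<longlonglongrightarrow> iA (Phi t)" using s by simp
  then show "iA (Phi t) \<in> X" by (rule X_limit[rotated]) (simp add: iP_power_in_X)
qed

section \<open>Decomposition of the closure into the line and the copies\<close>

lemma X_approximate:
  assumes "x \<in> X" obtains s where "(\<lambda>k. Phi (s k)) \<longlonglongrightarrow> x" "(\<lambda>k. kap (s k)) \<longlonglongrightarrow> x 0"
proof -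
  have "\<exists>f. (\<forall>k. f k \<in> range Phi) \<and> f \<longlonglongrightarrow> x"
    using assms by (simp add: X_def closure_sequential)
  then obtain f where f: "\<forall>k. f k \<in> range Phi" "f \<longlonglongrightarrow> x" by auto
  from f(1) have "\<forall>k. \<exists>r. f k = Phi r" by auto
  then have "\<exists>s. \<forall>k. f k = Phi (s k)" by (rule choice)
  then obtain s where "\<forall>k. f k = Phi (s k)" by auto
  then have "f = (\<lambda>k. Phi (s k))" by (intro ext) simp
  then show thesis using that[of s] f(2) coord_tendsto[OF f(2), of 0] by simp
qed

lemma kap_tendsto_1_imp_at_top:
  assumes "(\<lambda>k. kap (s k)) \<longlonglongrightarrow> 1" shows "filterlim s at_top sequentially"
  unfolding filterlim_at_top
proof
  fix N
  have "kap N < 1" using abs_kap_less[of N] by linarith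
  then have "\<forall>\<^sub>F k in sequentially. kap N < kap (s k)" using assms order_tendstoD(1) by blast
  then show "\<forall>\<^sub>F k in sequentially. N \<le> s k" by (rule eventually_mono) (simp add: kap_strict_mono)
qed

lemma kap_minus: "kap (- s) = - kap s"
  by (simp add: kap_def)

text \<open>The preimage can be read off \<open>x\<close>: its coordinates are those of
  \<open>x\<close> at words beginning with \<open>osc\<close>. It lies in \<open>X\<close> as the
  limit of \<open>Phi (osc (s k))\<close>, whose coordinates occur among those of the convergent
  sequence \<open>Phi (s k)\<close>.\<close>

lemma X_top:
  assumes "x \<in> X" "x 0 = 1" shows "x \<in> iP ` X"
proof -
  obtain s where s: "(\<lambda>k. Phi (s k)) \<longlonglongrightarrow> x" "(\<lambda>k. kap (s k)) \<longlonglongrightarrow> x 0" by (rule X_approximate[OF assms(1)])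
  let ?z = "\<lambda>m. x (Suc (3 * m))"
  have "(\<lambda>k. Phi (osc (s k))) \<longlonglongrightarrow> ?z"
    by (rule tendsto_coordwise) (use coord_tendsto[OF s(1), of "Suc (3 * _)"] in \<open>simp\<close>)
  moreover from this have "?z \<in> X" by (rule X_limit[rotated]) simp
  moreover have "filterlim s at_top sequentially" using s assms kap_tendsto_1_imp_at_top by simp
  ultimately show ?thesis using Phi_tail_limit LIMSEQ_unique[OF s(1)] by blast
qed

lemma X_bot:
  assumes "x \<in> X" "x 0 = - 1" shows "x \<in> iM ` X"
proof -
  obtain s where s: "(\<lambda>k. Phi (s k)) \<longlonglongrightarrow> x" "(\<lambda>k. kap (s k)) \<longlonglongrightarrow> x 0" by (rule X_approximate[OF assms(1)])
  let ?z = "\<lambda>m. x (Suc (Suc (3 * m)))"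
  have "(\<lambda>k. Phi (osc (- s k))) \<longlonglongrightarrow> ?z"
    by (rule tendsto_coordwise) (use coord_tendsto[OF s(1), of "Suc (Suc (3 * _))"] in simp)
  moreover from this have "?z \<in> X" by (rule X_limit[rotated]) simp
  moreover have "(\<lambda>k. kap (- s k)) \<longlonglongrightarrow> 1" using tendsto_minus[OF s(2)] assms by (simp add: kap_minus)
  then have "filterlim (\<lambda>k. - s k) at_top sequentially" by (rule kap_tendsto_1_imp_at_top)
  ultimately show ?thesis using Phi_head_limit LIMSEQ_unique[OF s(1)] by blast
qed

text \<open>Coordinate 0 of the approximating points converges inside the open interval, so the
  inverse of \<open>kap\<close> turns it into a convergent sequence of parameters.\<close>

lemma X_mid:
  assumes "x \<in> X" "\<bar>x 0\<bar> < 1" shows "x = Phi (x 0 / (1 - \<bar>x 0\<bar>))"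
proof -
  obtain s where s: "(\<lambda>k. Phi (s k)) \<longlonglongrightarrow> x" "(\<lambda>k. kap (s k)) \<longlonglongrightarrow> x 0" by (rule X_approximate[OF assms(1)])
  have "(\<lambda>k. kap (s k) / (1 - \<bar>kap (s k)\<bar>)) \<longlonglongrightarrow> x 0 / (1 - \<bar>x 0\<bar>)"
    using assms by (intro tendsto_intros s) auto
  moreover have "kap r / (1 - \<bar>kap r\<bar>) = r" for r
    using kap_surj[OF abs_kap_less, of r] by (simp add: kap_inject)
  ultimately have "s \<longlonglongrightarrow> x 0 / (1 - \<bar>x 0\<bar>)" by simp
  then have "(\<lambda>k. Phi (s k)) \<longlonglongrightarrow> Phi (x 0 / (1 - \<bar>x 0\<bar>))"
    using continuous_on_tendsto_compose[OF Phi_continuous[of UNIV]] by simp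
  then show ?thesis using LIMSEQ_unique s(1) by blast
qed

lemma X_cases:
  assumes "x \<in> X"
  obtains s where "x = Phi s" | "x \<in> iP ` X" | "x \<in> iM ` X"
proof -
  have "\<bar>x 0\<bar> < 1 \<or> x 0 = 1 \<or> x 0 = - 1" using X_bounded[OF assms, of 0] by linarith
  then show thesis using that X_mid X_top X_bot assms by blast
qed

text \<open>Lying in the image of a high power of \<open>iP\<close> forces each coordinate to be the
  one that \<open>iA\<close> computes from the \<open>rho\<close> coordinates of \<open>x\<close>.
  Those form a point of \<open>X\<close>, the limit of \<open>Phi (rho (s k))\<close>.\<close>

lemma X_Inter_iP:
  assumes "\<And>n. x \<in> (iP ^^ n) ` X" shows "x \<in> iA ` X"
proof -
  have x: "x \<in> X" using assms[of 0] by simp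
  define z where "z = (\<lambda>k. x (3 * k + 3))"
  have "x = iA z"
  proof
    fix m
    obtain y where y: "x = (iP ^^ Suc m) y" using assms[of "Suc m"] by blast
    then have "x m = iA (\<lambda>k. y (3 * k + 3)) m" by (simp only: iP_power_eq_iA lessI)
    moreover have "(\<lambda>k. y (3 * k + 3)) = z" unfolding z_def y by (simp only: iP_power_rho)
    ultimately show "x m = iA z m" by simp
  qed
  moreover have "z \<in> X"
  proof -
    obtain s where s: "(\<lambda>k. Phi (s k)) \<longlonglongrightarrow> x" "(\<lambda>k. kap (s k)) \<longlonglongrightarrow> x 0"
      by (rule X_approximate[OF x])
    have "(\<lambda>k. Phi (rho (s k))) \<longlonglongrightarrow> z" unfolding z_def
      by (rule tendsto_coordwise) (use coord_tendsto[OF s(1), of "3 * _ + 3"] in simp)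
    then show ?thesis by (rule X_limit[rotated]) simp
  qed
  ultimately show ?thesis by blast
qed

section \<open>Chains and continuous functions with small fibres\<close>

lemma Metric_space_dist: "Metric_space M (dist :: 'a::metric_space \<Rightarrow> 'a \<Rightarrow> real)"
  using Met_TC.subspace by blast

lemma mtopology_dist: "Metric_space.mtopology M (dist :: 'a::metric_space \<Rightarrow> 'a \<Rightarrow> real) = top_of_set M"
proof -
  interpret Submetric "UNIV :: 'a set" dist M by unfold_locales simp
  show ?thesis using mtopology_submetric by simp
qed

lemma continuum_dist:
  "continuum M (dist :: 'a::metric_space \<Rightarrow> 'a \<Rightarrow> real) \<longleftrightarrow> M \<noteq> {} \<and> connected M \<and> compact M"
  by (auto simp: continuum_def Metric_space_dist mtopology_dist connectedin_def compactin_subspace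
      simp flip: connectedin_iff_connected compactin_euclidean_iff)

lemma mdiameter_le:
  assumes "0 \<le> r" "\<And>x y. x \<in> S \<Longrightarrow> y \<in> S \<Longrightarrow> d x y \<le> r"
  shows "mdiameter d S \<le> r"
  using assms by (auto simp: mdiameter_def intro!: cSUP_least)

lemma mdiameter_ge:
  fixes S :: "'a::metric_space set"
  assumes "bounded S" "x \<in> S" "y \<in> S"
  shows "dist x y \<le> mdiameter dist S"
proof -
  obtain B where "\<forall>x\<in>S. \<forall>y\<in>S. dist x y \<le> B" using assms(1) bounded_two_points by blast
  then have "bdd_above ((\<lambda>(x,y). dist x y) ` (S \<times> S))" by (auto simp: bdd_above_def)
  then have "(\<lambda>(x,y). dist x y) (x, y) \<le> (SUP (x,y)\<in>S\<times>S. dist x y)"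
    using assms by (intro cSUP_upper) auto
  then show ?thesis using assms by (auto simp: mdiameter_def)
qed

text \<open>If \<open>h\<close> is the identity, a continuous \<open>g\<close> with these properties pulls a chain of short intervals
  back to an \<open>e\<close>-chain whose first link contains \<open>p\<close>. A general \<open>h\<close> measures distances in a copy of
  \<open>M\<close>.\<close>

definition has_end_map :: "'a::metric_space set \<Rightarrow> ('a \<Rightarrow> 'b::metric_space) \<Rightarrow> real \<Rightarrow> 'a \<Rightarrow> bool" where
  "has_end_map M h e p \<longleftrightarrow> (\<exists>g::'a \<Rightarrow> real. continuous_on M g \<and> (\<forall>x\<in>M. g p \<le> g x) \<and>
     (\<forall>x\<in>M. \<forall>y\<in>M. g x = g y \<longrightarrow> dist (h x) (h y) < e))"

lemma continuous_on_fst_snd: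
  assumes "continuous_on M q"
  shows "continuous_on (M \<times> N) (\<lambda>z. q (fst z))" "continuous_on (N \<times> M) (\<lambda>z. q (snd z))"
  by (auto intro!: continuous_on_compose2[OF assms] continuous_intros)

text \<open>The pairs at \<open>h\<close>-distance at least \<open>e\<close> form a compact set on
  which the maximum of \<open>F\<close>, \<open>F\<close> and the difference of the values of
  \<open>G\<close> is positive; half of its minimum serves as \<open>\<theta>\<close>. With
  \<open>F = 0\<close> this is the uniform version of having small fibres.\<close>

lemma small_fibres_near_zero_set:
  fixes F G :: "'a::metric_space \<Rightarrow> real" and h :: "'a \<Rightarrow> 'b::metric_space"
  assumes M: "compact M" and F: "continuous_on M F" and G: "continuous_on M G" and h: "continuous_on M h"
    and F0: "\<And>x. x \<in> M \<Longrightarrow> 0 \<le> F x"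
    and fib: "\<And>x y. \<lbrakk>x \<in> M; y \<in> M; F x = 0; F y = 0; G x = G y\<rbrakk> \<Longrightarrow> dist (h x) (h y) < e"
  obtains \<theta> where "0 < \<theta>"
    "\<And>x y. \<lbrakk>x \<in> M; y \<in> M; F x \<le> \<theta>; F y \<le> \<theta>; \<bar>G x - G y\<bar> \<le> \<theta>\<rbrakk> \<Longrightarrow> dist (h x) (h y) < e"
proof -
  define C where "C = {z \<in> M \<times> M. e \<le> dist (h (fst z)) (h (snd z))}"
  have "closedin (top_of_set (M \<times> M)) ((M \<times> M) \<inter> (\<lambda>z. dist (h (fst z)) (h (snd z))) -` {e..})"
    by (intro continuous_closedin_preimage continuous_on_dist continuous_on_fst_snd h) simp
  moreover have "(M \<times> M) \<inter> (\<lambda>z. dist (h (fst z)) (h (snd z))) -` {e..} = C" by (auto simp: C_def)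
  ultimately have C: "compact C" using closedin_compact[OF compact_Times[OF M M]] by auto
  define q where "q z = max (max (F (fst z)) (F (snd z))) \<bar>G (fst z) - G (snd z)\<bar>" for z
  have q: "continuous_on C q"
    unfolding q_def
    by (rule continuous_on_subset[of "M \<times> M"])
      (auto intro!: continuous_intros continuous_on_fst_snd F G simp: C_def)
  have pos: "0 < q z" if "z \<in> C" for z
  proof (rule ccontr)
    assume "\<not> 0 < q z"
    then have "F (fst z) \<le> 0" "F (snd z) \<le> 0" "G (fst z) = G (snd z)" by (auto simp: q_def)
    then show False using that fib[of "fst z" "snd z"] F0[of "fst z"] F0[of "snd z"] by (force simp: C_def)
  qed
  obtain \<theta> where \<theta>: "0 < \<theta>" "\<And>z. z \<in> C \<Longrightarrow> \<theta> < q z"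
  proof (cases "C = {}")
    case True then show thesis using that[of 1] by simp
  next
    case False
    then obtain z where z: "z \<in> C" "\<forall>y\<in>C. q z \<le> q y" using continuous_attains_inf[OF C _ q] by blast
    have "0 < q z / 2" "q z / 2 < q y" if "y \<in> C" for y
      using z pos[of z] that by force+
    then show thesis using that[of "q z / 2"] z(1) by blast
  qed
  show thesis
  proof (rule that[OF \<theta>(1)])
    fix x y assume "x \<in> M" "y \<in> M" "F x \<le> \<theta>" "F y \<le> \<theta>" "\<bar>G x - G y\<bar> \<le> \<theta>"
    then show "dist (h x) (h y) < e" using \<theta>(2)[of "(x, y)"] by (fastforce simp: C_def q_def)
  qed
qed

text \<open>The function \<open>F\<close> measures the position along a line that is compactified by the zero set of
  \<open>F\<close>. The extension of \<open>g\<close> is cut off at the height of a point \<open>z\<close> of the line near a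
  maximum point of \<open>g\<close>.\<close>

lemma end_map_up_to_line:
  fixes F :: "'a::{metric_space,second_countable_topology} \<Rightarrow> real" and h :: "'a \<Rightarrow> 'b::metric_space"
  assumes M: "compact M" and F: "continuous_on M F" and h: "continuous_on M h"
    and F0: "\<And>x. x \<in> M \<Longrightarrow> 0 \<le> F x"
    and dense: "\<And>x r. \<lbrakk>x \<in> M; F x = 0; 0 < r\<rbrakk> \<Longrightarrow> \<exists>z\<in>M. 0 < F z \<and> dist z x < r"
    and e: "has_end_map {x \<in> M. F x = 0} h e p" and p: "p \<in> M" "F p = 0"
  obtains G :: "'a \<Rightarrow> real" and z where "continuous_on M G" "z \<in> M" "0 < F z" "F z < 1"
    "\<And>x. x \<in> M \<Longrightarrow> G p \<le> G x" "\<And>x. x \<in> M \<Longrightarrow> G x \<le> G z"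
    "\<And>x y. \<lbrakk>x \<in> M; y \<in> M; F x \<le> F z; F y \<le> F z; G x = G y\<rbrakk> \<Longrightarrow> dist (h x) (h y) < e"
proof -
  let ?S = "{x \<in> M. F x = 0}"
  obtain g :: "'a \<Rightarrow> real" where g: "continuous_on ?S g" "\<And>x. x \<in> ?S \<Longrightarrow> g p \<le> g x"
    "\<And>x y. \<lbrakk>x \<in> ?S; y \<in> ?S; g x = g y\<rbrakk> \<Longrightarrow> dist (h x) (h y) < e"
    using e unfolding has_end_map_def by blast
  have "closedin (top_of_set M) (M \<inter> F -` {0})"
    by (intro continuous_closedin_preimage F) simp
  moreover have "M \<inter> F -` {0} = ?S" by auto
  ultimately have cS: "closedin (top_of_set M) ?S" by simp
  then have "compact ?S" using M closedin_compact by blast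
  then obtain q where q: "q \<in> ?S" "\<And>x. x \<in> ?S \<Longrightarrow> g x \<le> g q"
    using continuous_attains_sup[OF _ _ g(1)] p by blast
  obtain E where E: "continuous_on M E" "\<And>x. x \<in> ?S \<Longrightarrow> E x = g x"
      "\<And>x. x \<in> M \<Longrightarrow> E x \<in> cbox (g p) (g q)"
  proof (rule Tietze_closed_interval[OF g(1) cS, of "g p" "g q"])
    show "cbox (g p) (g q) \<noteq> {}" using g(2)[OF q(1)] by simp
    show "\<And>x. x \<in> ?S \<Longrightarrow> g x \<in> cbox (g p) (g q)" using g(2) q(2) by simp
  qed (rule that)
  obtain \<theta> where \<theta>: "0 < \<theta>"
    "\<And>x y. \<lbrakk>x \<in> M; y \<in> M; F x \<le> \<theta>; F y \<le> \<theta>; \<bar>E x - E y\<bar> \<le> \<theta>\<rbrakk> \<Longrightarrow> dist (h x) (h y) < e"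
    by (rule small_fibres_near_zero_set[OF M F E(1) h F0, of e]) (use E(2) g(3) in auto)
  have qM: "q \<in> M" "F q = 0" using q by auto
  \<comment> \<open>The bound 1 on \<open>F z\<close> is for joining two ends of one line: it keeps
    their two cut-off points in the right order.\<close>
  obtain r1 where r1: "r1 > 0" "\<And>x. \<lbrakk>x \<in> M; dist x q < r1\<rbrakk> \<Longrightarrow> dist (F x) (F q) < min \<theta> 1"
    using F qM(1) \<theta>(1) unfolding continuous_on_iff by (metis min_less_iff_conj zero_less_one)
  obtain r2 where r2: "r2 > 0" "\<And>x. \<lbrakk>x \<in> M; dist x q < r2\<rbrakk> \<Longrightarrow> dist (E x) (E q) < \<theta>"
    using E(1) qM(1) \<theta>(1) unfolding continuous_on_iff by metis
  obtain z where z: "z \<in> M" "0 < F z" "dist z q < min r1 r2"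
    using dense[OF qM, of "min r1 r2"] r1 r2 by auto
  have Fz: "F z < \<theta>" "F z < 1" using r1(2)[OF z(1)] z qM by (auto simp: dist_real_def)
  have Ez: "E z > g q - \<theta>" using r2(2)[OF z(1)] z E(2)[OF q(1)] by (auto simp: dist_real_def)
  \<comment> \<open>The truncation makes \<open>z\<close> a maximum point. Because
    \<open>E z\<close> is within \<open>\<theta>\<close> of the maximum of \<open>E\<close>, it
    identifies only values that differ by at most \<open>\<theta>\<close>.\<close>
  define G where "G x = min (E x) (E z)" for x
  show thesis
  proof (rule that[of G z])
    show "continuous_on M G" unfolding G_def by (intro continuous_intros E)
    show "G p \<le> G x" if "x \<in> M" for x using E(2)[of p] E(3)[OF that] E(3)[OF z(1)] p by (auto simp: G_def)
    show "G x \<le> G z" for x by (simp add: G_def)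
    fix x y assume xy: "x \<in> M" "y \<in> M" "F x \<le> F z" "F y \<le> F z" "G x = G y"
    have "\<bar>E x - E y\<bar> \<le> \<theta>"
      using E(3)[OF xy(1)] E(3)[OF xy(2)] Ez \<theta>(1) xy(5) by (auto simp: G_def min_def split: if_splits)
    then show "dist (h x) (h y) < e" using \<theta>(2)[OF xy(1,2)] xy(3,4) Fz by simp
  qed (use z Fz in auto)
qed

text \<open>The map \<open>k\<close> has three pieces: \<open>G\<close> on the left up to
  \<open>y\<close>, where it is maximal; then the position along the line from \<open>y\<close> to
  \<open>z\<close>; then \<open>H\<close> upside down, beginning at its maximum point
  \<open>z\<close>. The values of the pieces overlap only at the values of \<open>y\<close> and
  \<open>z\<close>, so every fibre lies in one piece.\<close>

lemma end_map_join:
  fixes f :: "'a::{metric_space,second_countable_topology} \<Rightarrow> real" and h :: "'a \<Rightarrow> 'b::metric_space"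
  assumes M: "compact M" and f: "continuous_on M f" and h: "continuous_on M h" and e: "0 < e"
    and f1: "\<And>x. x \<in> M \<Longrightarrow> \<bar>f x\<bar> \<le> 1"
    and inj: "\<And>x y. \<lbrakk>x \<in> M; y \<in> M; f x = f y; \<bar>f x\<bar> < 1\<rbrakk> \<Longrightarrow> x = y"
    and dense: "\<And>x r. \<lbrakk>x \<in> M; 0 < r\<rbrakk> \<Longrightarrow> \<exists>z\<in>M. \<bar>f z\<bar> < 1 \<and> dist z x < r"
    and p: "has_end_map {x \<in> M. f x = - 1} h e p" "p \<in> M" "f p = - 1"
    and q: "has_end_map {x \<in> M. f x = 1} h e q" "q \<in> M" "f q = 1"
  shows "has_end_map M h e p"
proof -
  have eq: "{x \<in> M. f x + 1 = 0} = {x \<in> M. f x = - 1}" "{x \<in> M. 1 - f x = 0} = {x \<in> M. f x = 1}" by auto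
  obtain G :: "'a \<Rightarrow> real" and y where G: "continuous_on M G" "y \<in> M" "0 < f y + 1" "f y + 1 < 1"
    "\<And>x. x \<in> M \<Longrightarrow> G p \<le> G x" "\<And>x. x \<in> M \<Longrightarrow> G x \<le> G y"
    "\<And>u v. \<lbrakk>u \<in> M; v \<in> M; f u + 1 \<le> f y + 1; f v + 1 \<le> f y + 1; G u = G v\<rbrakk> \<Longrightarrow> dist (h u) (h v) < e"
  proof (rule end_map_up_to_line[of M "\<lambda>x. f x + 1" h e p])
    show "\<exists>z\<in>M. 0 < f z + 1 \<and> dist z x < r" if "x \<in> M" "f x + 1 = 0" "0 < r" for x r
      using dense[OF that(1,3)] by force
    show "0 \<le> f x + 1" if "x \<in> M" for x using f1[OF that] by simp
    show "has_end_map {x \<in> M. f x + 1 = 0} h e p" using p eq by simp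
  qed (use M f h p in \<open>auto intro!: continuous_intros\<close>)
  obtain H :: "'a \<Rightarrow> real" and z where H: "continuous_on M H" "z \<in> M" "0 < 1 - f z" "1 - f z < 1"
    "\<And>x. x \<in> M \<Longrightarrow> H q \<le> H x" "\<And>x. x \<in> M \<Longrightarrow> H x \<le> H z"
    "\<And>u v. \<lbrakk>u \<in> M; v \<in> M; 1 - f u \<le> 1 - f z; 1 - f v \<le> 1 - f z; H u = H v\<rbrakk> \<Longrightarrow> dist (h u) (h v) < e"
  proof (rule end_map_up_to_line[of M "\<lambda>x. 1 - f x" h e q])
    show "\<exists>z\<in>M. 0 < 1 - f z \<and> dist z x < r" if "x \<in> M" "1 - f x = 0" "0 < r" for x r
      using dense[OF that(1,3)] by force
    show "0 \<le> 1 - f x" if "x \<in> M" for x using f1[OF that] by simp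
    show "has_end_map {x \<in> M. 1 - f x = 0} h e q" using q eq by simp
  qed (use M f h q in \<open>auto intro!: continuous_intros\<close>)
  define k where "k x = (if f x \<le> f y then G x else
      if f x \<le> f z then G y + (f x - f y) else G y + (f z - f y) + (H z - H x))" for x
  \<comment> \<open>The levels of \<open>y\<close> and \<open>z\<close> are single points, so
    neighbouring pieces agree where they meet and \<open>k\<close> is continuous.\<close>
  have at_y: "x = y" if "x \<in> M" "f x = f y" for x using inj[of x y] that G(2-4) by auto
  have at_z: "x = z" if "x \<in> M" "f x = f z" for x using inj[of x z] that H(2-4) by auto
  have lt: "f y < f z" using G(4) H(4) by simp
  have sub: "continuous_on {x \<in> A. P x} q" if "continuous_on A q" for q :: "'a \<Rightarrow> real" and A P
    by (rule continuous_on_subset[OF that]) auto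
  show ?thesis
    unfolding has_end_map_def
  proof (intro exI[of _ k] conjI ballI impI)
    show "continuous_on M k"
      unfolding k_def
    proof (rule continuous_on_cases_le[OF sub[OF G(1)] _ f])
      have "continuous_on M (\<lambda>x. if f x \<le> f z then G y + (f x - f y) else G y + (f z - f y) + (H z - H x))"
        by (rule continuous_on_cases_le[OF sub sub f]) (use at_z f H(1) in \<open>auto intro!: continuous_intros\<close>)
      then show "continuous_on {x \<in> M. f y \<le> f x}
         (\<lambda>x. if f x \<le> f z then G y + (f x - f y) else G y + (f z - f y) + (H z - H x))"
        by (rule sub)
      show "G x = (if f x \<le> f z then G y + (f x - f y) else G y + (f z - f y) + (H z - H x))"
        if "x \<in> M" "f x = f y" for x using at_y[OF that] lt by simp
    qed
    have kp: "k p = G p" using p G(3) by (simp add: k_def)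
    have low: "k x \<le> G y" if "f x \<le> f y" "x \<in> M" for x using that G(6) by (simp add: k_def)
    have mid: "k x = G y + (f x - f y)" if "f y \<le> f x" "f x \<le> f z" "x \<in> M" for x
      using that at_y[of x] by (cases "f x = f y") (auto simp: k_def)
    have high: "k x = G y + (f z - f y) + (H z - H x)" if "f z \<le> f x" "x \<in> M" for x
      using that at_z[of x] lt by (cases "f x = f z") (auto simp: k_def)
    show "k p \<le> k x" if "x \<in> M" for x
      using G(5)[OF that] G(5)[OF G(2)] H(6)[OF that] lt kp low[OF _ that] mid[OF _ _ that] high[OF _ that]
      by (cases "f x \<le> f y"; cases "f x \<le> f z") (auto simp: k_def)
    fix u v assume uv: "u \<in> M" "v \<in> M" "k u = k v"
    have main: "dist (h u) (h v) < e" if uv: "u \<in> M" "v \<in> M" "k u = k v" and le: "f u \<le> f v" for u v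
    proof -
      consider "f v \<le> f y" | "f z \<le> f u" | "f y < f v" "f v \<le> f z" | "f y < f v" "f z < f v" "f u < f z" by linarith
      then show ?thesis
      proof cases
        case 1 then show ?thesis using G(7)[OF uv(1,2)] uv le by (simp add: k_def)
      next
        case 2
        then have "H u = H v" using high[OF _ uv(1)] high[OF _ uv(2)] uv le by simp
        then show ?thesis using H(7)[OF uv(1,2)] 2 le by simp
      next
        case 3
        have "f y < f u"
        proof (rule ccontr)
          assume "\<not> f y < f u"
          then show False using low[of u] mid[of v] 3 uv by simp
        qed
        then have "f u = f v" using mid[of u] mid[of v] 3 le uv by simp
        moreover have "\<bar>f v\<bar> < 1" using 3 G(3) H(3) by simp
        ultimately have "u = v" using inj[OF uv(1,2)] by simp
        then show ?thesis using e by simp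
      next
        case 4
        have "k u < G y + (f z - f y)"
          using low[of u] mid[of u] 4 uv lt by (cases "f u \<le> f y") auto
        then show ?thesis using high[of v] H(6)[OF uv(2)] 4 uv by simp
      qed
    qed
    show "dist (h u) (h v) < e"
      using main[OF uv] main[OF uv(2,1) uv(3)[symmetric]] by (cases "f u \<le> f v") (auto simp: dist_commute)
  qed
qed

lemma compact_decreasing_sequence:
  fixes C :: "nat \<Rightarrow> 'a::t2_space set"
  assumes "\<And>n. compact (C n)" "\<And>n. C (Suc n) \<subseteq> C n" "\<And>n. C n \<noteq> {}"
  shows "\<exists>x. \<forall>n. x \<in> C n"
proof -
  have dec: "C n \<subseteq> C m" if "m \<le> n" for m n using that assms(2) lift_Suc_antimono_le by blast
  have "C 0 \<inter> (\<Inter>n\<in>UNIV. C n) \<noteq> {}"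
  proof (rule compact_imp_fip_image[OF assms(1)])
    fix I :: "nat set" assume "finite I"
    then have "C (Max (insert 0 I)) \<subseteq> C n" if "n \<in> I" for n using that by (intro dec) simp
    moreover have "C (Max (insert 0 I)) \<subseteq> C 0" by (rule dec) simp
    ultimately have "C (Max (insert 0 I)) \<subseteq> C 0 \<inter> (\<Inter>n\<in>I. C n)" by blast
    then show "C 0 \<inter> (\<Inter>n\<in>I. C n) \<noteq> {}" using assms(3)[of "Max (insert 0 I)"] by blast
  qed (rule compact_imp_closed[OF assms(1)])
  then obtain x where "x \<in> (\<Inter>n. C n)" by blast
  then show ?thesis by blast
qed

text \<open>Extend the map from \<open>A\<close> by Tietze without leaving its range, so that
  \<open>p\<close> stays a minimum point. The pairs in \<open>Z n\<close> with equal values at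
  distance at least \<open>e\<close> form decreasing compact sets; a common pair would lie in
  \<open>A\<close>, so one of these sets is empty.\<close>

lemma end_map_decreasing:
  fixes Z :: "nat \<Rightarrow> 'a::{metric_space,second_countable_topology} set" and h :: "'a \<Rightarrow> 'b::metric_space"
  assumes Z: "\<And>n. compact (Z n)" "\<And>n. Z (Suc n) \<subseteq> Z n" and A: "compact A" "\<And>n. A \<subseteq> Z n"
    and int: "\<And>x. (\<And>n. x \<in> Z n) \<Longrightarrow> x \<in> A" and h: "continuous_on (Z 0) h"
    and p: "p \<in> A" "has_end_map A h e p"
  obtains n where "has_end_map (Z n) h e p"
proof -
  obtain g :: "'a \<Rightarrow> real" where g: "continuous_on A g" "\<And>x. x \<in> A \<Longrightarrow> g p \<le> g x"
    "\<And>x y. \<lbrakk>x \<in> A; y \<in> A; g x = g y\<rbrakk> \<Longrightarrow> dist (h x) (h y) < e"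
    using p unfolding has_end_map_def by blast
  obtain q where q: "q \<in> A" "\<And>x. x \<in> A \<Longrightarrow> g x \<le> g q"
    using continuous_attains_sup[OF A(1) _ g(1)] p by blast
  have cA: "closedin (top_of_set (Z 0)) A"
    using A(2)[of 0] compact_imp_closed[OF A(1)] by (simp add: closed_subset)
  obtain G where G: "continuous_on (Z 0) G" "\<And>x. x \<in> A \<Longrightarrow> G x = g x"
      "\<And>x. x \<in> Z 0 \<Longrightarrow> G x \<in> cbox (g p) (g q)"
  proof (rule Tietze_closed_interval[OF g(1) cA, of "g p" "g q"])
    show "cbox (g p) (g q) \<noteq> {}" using g(2)[OF q(1)] by simp
    show "\<And>x. x \<in> A \<Longrightarrow> g x \<in> cbox (g p) (g q)" using g(2) q(2) by simp
  qed (rule that)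
  have dec: "Z n \<subseteq> Z 0" for n using Z(2) lift_Suc_antimono_le[of Z 0 n] by blast
  define C where "C n = {z \<in> Z n \<times> Z n. G (fst z) = G (snd z) \<and> e \<le> dist (h (fst z)) (h (snd z))}" for n
  have Gn: "continuous_on (Z n) G" and hn: "continuous_on (Z n) h" for n
    using G(1) h dec continuous_on_subset by metis+
  have comp: "compact (C n)" for n
  proof -
    have "closedin (top_of_set (Z n \<times> Z n)) ((Z n \<times> Z n) \<inter> (\<lambda>z. G (fst z) - G (snd z)) -` {0})"
      by (intro continuous_closedin_preimage continuous_on_diff continuous_on_fst_snd Gn) simp
    moreover have "closedin (top_of_set (Z n \<times> Z n)) ((Z n \<times> Z n) \<inter> (\<lambda>z. dist (h (fst z)) (h (snd z))) -` {e..})"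
      by (intro continuous_closedin_preimage continuous_on_dist continuous_on_fst_snd hn) simp
    ultimately have "closedin (top_of_set (Z n \<times> Z n)) (((Z n \<times> Z n) \<inter> (\<lambda>z. G (fst z) - G (snd z)) -` {0}) \<inter>
        ((Z n \<times> Z n) \<inter> (\<lambda>z. dist (h (fst z)) (h (snd z))) -` {e..}))" by (rule closedin_Int)
    moreover have "((Z n \<times> Z n) \<inter> (\<lambda>z. G (fst z) - G (snd z)) -` {0}) \<inter>
        ((Z n \<times> Z n) \<inter> (\<lambda>z. dist (h (fst z)) (h (snd z))) -` {e..}) = C n" by (auto simp: C_def)
    ultimately show ?thesis using closedin_compact[OF compact_Times[OF Z(1) Z(1)]] by auto
  qed
  have sub: "C (Suc n) \<subseteq> C n" for n using Z(2)[of n] by (auto simp: C_def)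
  have no: "\<not> (\<forall>n. z \<in> C n)" for z
  proof
    assume z: "\<forall>n. z \<in> C n"
    then have "fst z \<in> A" "snd z \<in> A" by (auto simp: C_def intro!: int)
    then show False using z g(3)[of "fst z" "snd z"] G(2) by (force simp: C_def)
  qed
  have "\<exists>n. C n = {}"
  proof (rule ccontr)
    assume "\<not> (\<exists>n. C n = {})"
    then have ne: "C n \<noteq> {}" for n by simp
    have "\<exists>z. \<forall>n. z \<in> C n" by (rule compact_decreasing_sequence[of C, OF comp sub ne])
    then show False using no by simp
  qed
  then obtain n where n: "C n = {}" ..
  have "has_end_map (Z n) h e p"
    unfolding has_end_map_def
  proof (intro exI[of _ G] conjI ballI impI)
    show "continuous_on (Z n) G" by (rule Gn)
    show "G p \<le> G x" if "x \<in> Z n" for x using G(2)[OF p(1)] G(3)[of x] dec[of n] that by auto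
    show "dist (h x) (h y) < e" if "x \<in> Z n" "y \<in> Z n" "G x = G y" for x y
    proof -
      have "(x, y) \<notin> C n" using n by simp
      then show ?thesis using that by (simp add: C_def not_le)
    qed
  qed
  then show thesis by (rule that)
qed

lemma has_end_map_image:
  fixes i :: "'a::metric_space \<Rightarrow> 'c::metric_space"
  assumes "compact M" "continuous_on M i" "inj_on i M" "p \<in> M"
  shows "has_end_map (i ` M) h e (i p) \<longleftrightarrow> has_end_map M (h \<circ> i) e p"
proof
  assume "has_end_map (i ` M) h e (i p)"
  then obtain g :: "'c \<Rightarrow> real" where g: "continuous_on (i ` M) g" "\<forall>x\<in>i ` M. g (i p) \<le> g x"
    "\<forall>x\<in>i ` M. \<forall>y\<in>i ` M. g x = g y \<longrightarrow> dist (h x) (h y) < e"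
    unfolding has_end_map_def by blast
  have "continuous_on M (g \<circ> i)" by (rule continuous_on_compose[OF assms(2) g(1)])
  then show "has_end_map M (h \<circ> i) e p"
    unfolding has_end_map_def using g by (intro exI[of _ "g \<circ> i"]) auto
next
  assume "has_end_map M (h \<circ> i) e p"
  then obtain g :: "'a \<Rightarrow> real" where g: "continuous_on M g" "\<forall>x\<in>M. g p \<le> g x"
    "\<forall>x\<in>M. \<forall>y\<in>M. g x = g y \<longrightarrow> dist (h (i x)) (h (i y)) < e"
    unfolding has_end_map_def by auto
  define k where "k = inv_into M i"
  have k: "k (i x) = x" if "x \<in> M" for x using assms(3) that by (simp add: k_def)
  have "continuous_on (i ` M) k" by (rule continuous_on_inv[OF assms(2,1)]) (use k in auto)
  moreover have "k ` i ` M = M" using k by (auto simp: image_image)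
  ultimately have "continuous_on (i ` M) (g \<circ> k)" using g(1) by (intro continuous_on_compose) auto
  then show "has_end_map (i ` M) h e (i p)"
    unfolding has_end_map_def using g assms(4) k by (intro exI[of _ "g \<circ> k"]) auto
qed

text \<open>The links are preimages of overlapping intervals. Connectedness makes the range of
  \<open>g\<close> an interval, so that links which should meet do meet.\<close>

lemma end_map_chain_cover:
  fixes M :: "'a::metric_space set"
  assumes M: "compact M" "connected M" and p: "p \<in> M" and e: "0 < e" and g: "has_end_map M (\<lambda>x. x) (e/2) p"
  shows "\<exists>n U. chain_cover M dist e n U \<and> p \<in> U 1"
proof -
  obtain g :: "'a \<Rightarrow> real" where g: "continuous_on M g" "\<And>x. x \<in> M \<Longrightarrow> g p \<le> g x"
    "\<And>x y. \<lbrakk>x \<in> M; y \<in> M; g x = g y\<rbrakk> \<Longrightarrow> dist x y < e/2"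
    using g unfolding has_end_map_def by blast
  obtain \<theta> where \<theta>: "0 < \<theta>" "\<And>x y. \<lbrakk>x \<in> M; y \<in> M; \<bar>g x - g y\<bar> \<le> \<theta>\<rbrakk> \<Longrightarrow> dist x y < e/2"
    by (rule small_fibres_near_zero_set[OF M(1), of "\<lambda>x. 0" g "\<lambda>x. x" "e/2"])
      (use g in \<open>auto intro: continuous_on_const continuous_on_id\<close>)
  obtain q where q: "q \<in> M" "\<And>x. x \<in> M \<Longrightarrow> g x \<le> g q"
    using continuous_attains_sup[OF M(1) _ g(1)] p by blast
  have onto: "\<exists>x\<in>M. g x = t" if "g p \<le> t" "t \<le> g q" for t
    using connectedD_interval[OF connected_continuous_image[OF g(1) M(2)], of "g p" "g q" t] p q(1) that
    by auto
  define \<delta> where "\<delta> = \<theta> / 2"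
  have \<delta>: "0 < \<delta>" using \<theta> by (simp add: \<delta>_def)
  define \<mu> where "\<mu> = g q - g p"
  have \<mu>: "0 \<le> \<mu>" using q p by (simp add: \<mu>_def)
  \<comment> \<open>The summand 1 gives
    \<open>(n - 1) * \<delta> \<le> \<mu> < n * \<delta>\<close>: the links cover the whole range,
    and the centre of the last one is still a value of \<open>g\<close>.\<close>
  define n where "n = nat \<lfloor>\<mu> / \<delta>\<rfloor> + 1"
  have "real n - 1 \<le> \<mu> / \<delta>" "\<mu> / \<delta> < real n" using \<mu> \<delta> unfolding n_def by (auto simp: le_floor_iff) linarith
  then have n: "(real n - 1) * \<delta> \<le> \<mu>" "\<mu> < real n * \<delta>" using \<delta> by (simp_all add: field_simps)
  \<comment> \<open>Intervals of length \<open>2 * \<delta> = \<theta>\<close> whose centres are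
    \<open>\<delta>\<close> apart: only neighbours overlap. The first is centred at the minimum
    \<open>g p\<close>.\<close>
  define U where "U i = {x \<in> M. g p + (real i - 2) * \<delta> < g x \<and> g x < g p + real i * \<delta>}" for i :: nat
  have "openin (top_of_set M) (U i)" for i
  proof -
    have "openin (top_of_set M) (M \<inter> g -` {g p + (real i - 2) * \<delta> <..< g p + real i * \<delta>})"
      by (intro continuous_openin_preimage_gen g) simp
    moreover have "M \<inter> g -` {g p + (real i - 2) * \<delta> <..< g p + real i * \<delta>} = U i" by (auto simp: U_def)
    ultimately show ?thesis by simp
  qed
  moreover have "mdiameter dist (U i) < e" for i
  proof -
    \<comment> \<open>A supremum of distances below \<open>e/2\<close> may equal \<open>e/2\<close>;
      starting from an end map for \<open>e/2\<close> leaves room for the strict bound.\<close>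
    have "mdiameter dist (U i) \<le> e/2"
    proof (rule mdiameter_le)
      fix x y assume "x \<in> U i" "y \<in> U i"
      then have xy: "x \<in> M" "y \<in> M" "\<bar>g x - g y\<bar> < real i * \<delta> - (real i - 2) * \<delta>" by (auto simp: U_def)
      have "real i * \<delta> - (real i - 2) * \<delta> = \<theta>" by (simp add: \<delta>_def algebra_simps)
      then show "dist x y \<le> e/2" using \<theta>(2)[OF xy(1,2)] xy(3) by simp
    qed (use e in simp)
    then show ?thesis using e by simp
  qed
  moreover have "(\<Union>i\<in>{1..n}. U i) = M"
  proof
    show "M \<subseteq> (\<Union>i\<in>{1..n}. U i)"
    proof
      fix x assume x: "x \<in> M"
      define t where "t = (g x - g p) / \<delta>"
      have t: "g x = g p + t * \<delta>" using \<delta> by (simp add: t_def)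
      have t0: "0 \<le> t" using g(2)[OF x] \<delta> by (simp add: t_def)
      define i where "i = nat \<lfloor>t\<rfloor> + 1"
      have i: "real i - 1 \<le> t" "t < real i" using t0 unfolding i_def by (auto simp: le_floor_iff) linarith
      have "t * \<delta> \<le> \<mu>" using q(2)[OF x] t by (simp add: \<mu>_def)
      then have "t * \<delta> < real n * \<delta>" using n(2) by linarith
      then have "t < real n" using \<delta> by simp
      then have "i \<le> n" using i(1) by linarith
      have "(real i - 2) * \<delta> < t * \<delta>" "t * \<delta> < real i * \<delta>"
        using i \<delta> by (auto intro!: mult_strict_right_mono)
      then have "x \<in> U i" using x t by (simp add: U_def)
      then show "x \<in> (\<Union>i\<in>{1..n}. U i)" using \<open>i \<le> n\<close> by (auto simp: i_def)
    qed
  qed (auto simp: U_def)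
  moreover have "U i \<inter> U j \<noteq> {} \<longleftrightarrow> \<bar>int i - int j\<bar> \<le> 1" if ij: "i \<in> {1..n}" "j \<in> {1..n}" for i j
  proof
    assume "U i \<inter> U j \<noteq> {}"
    then have "(real i - 2) * \<delta> < real j * \<delta>" "(real j - 2) * \<delta> < real i * \<delta>" by (auto simp: U_def)
    then have "real i - 2 < real j" "real j - 2 < real i" using \<delta> by simp_all
    then show "\<bar>int i - int j\<bar> \<le> 1" by linarith
  next
    assume ij1: "\<bar>int i - int j\<bar> \<le> 1"
    have *: "U i \<inter> U j \<noteq> {}" if "1 \<le> i" "i \<le> j" "j \<le> n" "j \<le> i + 1" for i j :: nat
    proof -
      \<comment> \<open>The midpoint of the centres of links \<open>i\<close> and \<open>j\<close>,
        in units of \<open>\<delta>\<close> above \<open>g p\<close>; it lies in both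
        intervals.\<close>
      define t where "t = (real i + real j) / 2 - 1"
      have t: "0 \<le> t" "t \<le> real n - 1" "real j - 2 < t" "t < real i"
      proof -
        have "1 \<le> real i" "real i \<le> real j" "real j \<le> real n" "real j \<le> real i + 1"
          using that by linarith+
        then show "0 \<le> t" "t \<le> real n - 1" "real j - 2 < t" "t < real i"
          by (simp_all add: t_def field_simps)
      qed
      have "t * \<delta> \<le> (real n - 1) * \<delta>" using t \<delta> by (intro mult_right_mono) auto
      then have "t * \<delta> \<le> \<mu>" using n(1) by (rule order_trans)
      moreover have "0 \<le> t * \<delta>" using t(1) \<delta> by simp
      ultimately have "g p \<le> g p + t * \<delta>" "g p + t * \<delta> \<le> g q" by (simp_all add: \<mu>_def)
      then obtain x where x: "x \<in> M" "g x = g p + t * \<delta>" using onto[of "g p + t * \<delta>"] by blast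
      have "real i - 2 < t" "t < real j" using t that by linarith+
      then have "(real i - 2) * \<delta> < t * \<delta>" "t * \<delta> < real i * \<delta>" "(real j - 2) * \<delta> < t * \<delta>" "t * \<delta> < real j * \<delta>"
        using t \<delta> by (auto intro!: mult_strict_right_mono)
      then have "x \<in> U i \<inter> U j" using x by (simp add: U_def)
      then show ?thesis by blast
    qed
    show "U i \<inter> U j \<noteq> {}"
    proof (cases "i \<le> j")
      case True then show ?thesis using *[of i j] ij ij1 by auto
    next
      case False
      have "U j \<inter> U i \<noteq> {}" by (rule *) (use False ij ij1 in auto)
      then show ?thesis by (simp add: Int_commute)
    qed
  qed
  ultimately have "chain_cover M dist e n U" by (simp add: chain_cover_def mtopology_dist)
  moreover have "p \<in> U 1" using p \<delta> by (simp add: U_def)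
  ultimately show ?thesis by blast
qed

text \<open>If \<open>K\<close> missed link \<open>i\<close>, the links before \<open>i\<close> and
  those after \<open>i\<close> would cover \<open>K\<close> by two disjoint open sets, one
  containing \<open>p\<close> and the other \<open>b\<close>.\<close>

lemma chain_connected_meets:
  fixes M :: "'a::metric_space set"
  assumes ch: "chain_cover M dist e n U" and K: "connected K" "K \<subseteq> M"
    and p: "p \<in> K" "p \<in> U 1" and b: "b \<in> K" "b \<in> U j" and ij: "1 \<le> i" "i \<le> j" "j \<le> n"
  shows "K \<inter> U i \<noteq> {}"
proof
  assume empty: "K \<inter> U i = {}"
  note ch = ch[unfolded chain_cover_def mtopology_dist]
  note op = bspec[OF conjunct1[OF ch], THEN conjunct1] and un = conjunct1[OF conjunct2[OF ch]]
  have dj: "U l \<inter> U m = {}" if "l \<in> {1..n}" "m \<in> {1..n}" "\<bar>int l - int m\<bar> > 1" for l m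
    using bspec[OF bspec[OF conjunct2[OF conjunct2[OF ch]] that(1)] that(2)] that(3) by linarith
  define A where "A = (\<Union>l\<in>{1..<i}. U l)"
  define B where "B = (\<Union>l\<in>{i<..n}. U l)"
  have "openin (top_of_set M) A" "openin (top_of_set M) B"
    unfolding A_def B_def by (rule openin_Union, use op ij in auto)+
  then have "openin (top_of_set K) (K \<inter> A)" "openin (top_of_set K) (K \<inter> B)"
    using K(2) by (fastforce simp: openin_open)+
  moreover have "K \<subseteq> (K \<inter> A) \<union> (K \<inter> B)"
  proof
    fix x assume x: "x \<in> K"
    then obtain l where l: "l \<in> {1..n}" "x \<in> U l" using un K(2) by blast
    moreover have "l \<noteq> i" using x l empty by blast
    ultimately show "x \<in> (K \<inter> A) \<union> (K \<inter> B)" using x by (cases "l < i") (auto simp: A_def B_def)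
  qed
  moreover have "A \<inter> B = {}"
  proof -
    have "U l \<inter> U m = {}" if "l \<in> {1..<i}" "m \<in> {i<..n}" for l m
      by (rule dj) (use that ij in auto)
    then show ?thesis unfolding A_def B_def by blast
  qed
  moreover have "i \<noteq> 1" "i \<noteq> j" using empty p b by auto
  then have "1 \<in> {1..<i}" "j \<in> {i<..n}" using ij by auto
  then have "p \<in> K \<inter> A" "b \<in> K \<inter> B" using p b unfolding A_def B_def by blast+
  ultimately show False using K(1) unfolding connected_openin by blast
qed

text \<open>In a chain starting at \<open>p\<close>, suppose that \<open>a\<close> comes no later
  than \<open>b\<close>. Then \<open>K\<close>, which joins \<open>p\<close> to \<open>b\<close>,
  meets the link of \<open>a\<close>, so \<open>a\<close> is closer to \<open>K\<close> than
  \<open>e\<close> allows. Otherwise \<open>H\<close> is too close to \<open>b\<close> in the same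
  way.\<close>

lemma not_end_point:
  fixes M :: "'a::metric_space set"
  assumes M: "bounded M" and H: "compact H" "connected H" "H \<subseteq> M" and K: "compact K" "connected K" "K \<subseteq> M"
    and p: "p \<in> H" "p \<in> K" and a: "a \<in> H" "a \<notin> K" and b: "b \<in> K" "b \<notin> H"
  shows "p \<notin> end_points M dist"
proof
  assume "p \<in> end_points M dist"
  define e where "e = min (infdist a K) (infdist b H)"
  have "0 < infdist a K" "0 < infdist b H"
    by (rule infdist_pos_not_in_closed; use a b p H(1) K(1) in \<open>auto intro: compact_imp_closed\<close>)+
  then have "0 < e" by (simp add: e_def)
  then obtain n U where ch: "chain_cover M dist e n U" and pU: "p \<in> U 1"
    using \<open>p \<in> end_points M dist\<close> unfolding end_points_def by blast
  note ch' = ch[unfolded chain_cover_def]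
  note dm = bspec[OF conjunct1[OF ch'], THEN conjunct2] and un = conjunct1[OF conjunct2[OF ch']]
  have "a \<in> M" "b \<in> M" using a b H K by blast+
  then obtain i j where i: "i \<in> {1..n}" "a \<in> U i" and j: "j \<in> {1..n}" "b \<in> U j" using un by blast
  have near: False if "connected C" "C \<subseteq> M" "p \<in> C" "y \<in> C" "y \<in> U l" "k \<in> {1..n}" "l \<in> {1..n}"
      "k \<le> l" "x \<in> U k" "e \<le> infdist x C" for C x y k l
  proof -
    have "C \<inter> U k \<noteq> {}"
      by (rule chain_connected_meets[OF ch that(1,2,3) pU that(4,5)]) (use that in auto)
    then obtain w where w: "w \<in> C" "w \<in> U k" by blast
    have "bounded (U k)" using un M that(6) by (meson UN_upper bounded_subset)
    then have "dist x w < e" using mdiameter_ge[of "U k" x w] dm[OF that(6)] w that(9) by simp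
    then show False using infdist_le[OF w(1), of x] that(10) by simp
  qed
  show False
  proof (cases "i \<le> j")
    case True
    then show False using near[OF K(2,3) p(2) b(1) j(2) i(1) j(1) True i(2)] by (simp add: e_def)
  next
    case False
    then show False using near[OF H(2,3) p(1) a(1) i(2) j(1) i(1) _ j(2)] by (simp add: e_def)
  qed
qed

lemma countable_if_disjoint_meets_countable:
  assumes "countable Q" "pairwise disjnt \<F>" "\<And>K. K \<in> \<F> \<Longrightarrow> K \<inter> Q \<noteq> {}"
  shows "countable \<F>"
proof -
  have "\<forall>K\<in>\<F>. \<exists>q. q \<in> K \<inter> Q" using assms(3) by blast
  then obtain c where c: "\<And>K. K \<in> \<F> \<Longrightarrow> c K \<in> K \<inter> Q" by metis
  have "inj_on c \<F>"
  proof (rule inj_onI)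
    fix K L assume "K \<in> \<F>" "L \<in> \<F>" "c K = c L"
    then have "\<not> disjnt K L" using c[of K] c[of L] by (auto simp: disjnt_def)
    then show "K = L" using assms(2) \<open>K \<in> \<F>\<close> \<open>L \<in> \<F>\<close> unfolding pairwise_def by blast
  qed
  moreover have "c ` \<F> \<subseteq> Q" using c by blast
  ultimately show ?thesis using assms(1) countable_subset countable_image_inj_on by blast
qed

section \<open>Lusin schemes\<close>

definition lusin_scheme :: "'a::topological_space set \<Rightarrow> (nat list \<Rightarrow> 'a set) \<Rightarrow> bool" where
  "lusin_scheme P V \<longleftrightarrow> V [] = P \<and> (\<forall>w. V w = (\<Union>k. V (w @ [k]))) \<and>
     (\<forall>w k l. k \<noteq> l \<longrightarrow> V (w @ [k]) \<inter> V (w @ [l]) = {}) \<and> (\<forall>w. openin (top_of_set P) (V w)) \<and>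
     (\<forall>\<alpha>::nat \<Rightarrow> nat. \<exists>x. \<forall>n. x \<in> V (map \<alpha> [0..<n])) \<and>
     (\<forall>(\<alpha>::nat \<Rightarrow> nat) x U. (\<forall>n. x \<in> V (map \<alpha> [0..<n])) \<longrightarrow> open U \<longrightarrow> x \<in> U \<longrightarrow>
        (\<exists>n. V (map \<alpha> [0..<n]) \<subseteq> U))"

lemma lusin_schemeD:
  assumes "lusin_scheme P V"
  shows lusin_scheme_Nil: "V [] = P"
    and lusin_scheme_UN: "V w = (\<Union>k. V (w @ [k]))"
    and lusin_scheme_disjoint: "k \<noteq> l \<Longrightarrow> V (w @ [k]) \<inter> V (w @ [l]) = {}"
    and lusin_scheme_open: "openin (top_of_set P) (V w)"
    and lusin_scheme_branch: "\<exists>x. \<forall>n. x \<in> V (map \<alpha> [0..<n])"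
    and lusin_scheme_small: "\<lbrakk>\<forall>n. x \<in> V (map \<alpha> [0..<n]); open U; x \<in> U\<rbrakk> \<Longrightarrow> \<exists>n. V (map \<alpha> [0..<n]) \<subseteq> U"
proof -
  note a = assms[unfolded lusin_scheme_def]
  show "V [] = P" by (rule a[THEN conjunct1])
  note a = a[THEN conjunct2]
  show "V w = (\<Union>k. V (w @ [k]))" by (rule a[THEN conjunct1, THEN spec])
  note a = a[THEN conjunct2]
  show "k \<noteq> l \<Longrightarrow> V (w @ [k]) \<inter> V (w @ [l]) = {}" by (rule a[THEN conjunct1, rule_format])
  note a = a[THEN conjunct2]
  show "openin (top_of_set P) (V w)" by (rule a[THEN conjunct1, THEN spec])
  note a = a[THEN conjunct2]
  show "\<exists>x. \<forall>n. x \<in> V (map \<alpha> [0..<n])" by (rule a[THEN conjunct1, THEN spec])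
  note a = a[THEN conjunct2, THEN spec, THEN spec, THEN spec, THEN mp, THEN mp, THEN mp]
  show "\<lbrakk>\<forall>n. x \<in> V (map \<alpha> [0..<n]); open U; x \<in> U\<rbrakk> \<Longrightarrow> \<exists>n. V (map \<alpha> [0..<n]) \<subseteq> U" by (rule a)
qed

lemma lusin_scheme_unique:
  assumes "lusin_scheme P V" "x \<in> V u" "x \<in> V w" "length u = length w"
  shows "u = w"
  using assms(2-4)
proof (induction u arbitrary: w rule: rev_induct)
  case (snoc k u)
  obtain l v where w: "w = v @ [l]" using snoc.prems(3) by (cases w rule: rev_cases) auto
  note un = lusin_scheme_UN[OF assms(1)]
  have "x \<in> (\<Union>k. V (u @ [k]))" using snoc.prems(1) by blast
  then have "x \<in> V u" by (simp only: un[symmetric])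
  have "x \<in> (\<Union>k. V (v @ [k]))" using snoc.prems(2) unfolding w by blast
  then have "x \<in> V v" by (simp only: un[symmetric])
  have "u = v" by (rule snoc.IH[OF \<open>x \<in> V u\<close> \<open>x \<in> V v\<close>]) (use snoc.prems(3) w in simp)
  moreover have "k = l"
  proof (rule ccontr)
    assume "k \<noteq> l"
    then have "V (u @ [k]) \<inter> V (u @ [l]) = {}" by (rule lusin_scheme_disjoint[OF assms(1)])
    then show False using snoc.prems(1,2) unfolding w \<open>u = v\<close> by auto
  qed
  ultimately show ?case using w by simp
qed simp

lemma lusin_scheme_code:
  assumes "lusin_scheme P V" "x \<in> P"
  obtains \<alpha> :: "nat \<Rightarrow> nat" where "\<forall>n. x \<in> V (map \<alpha> [0..<n])"
proof -
  note un = lusin_scheme_UN[OF assms(1)] and nil = lusin_scheme_Nil[OF assms(1)]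
  define c where "c = rec_nat [] (\<lambda>_ w. w @ [SOME k. x \<in> V (w @ [k])])"
  have c: "c 0 = []" "c (Suc n) = c n @ [SOME k. x \<in> V (c n @ [k])]" for n by (simp_all add: c_def)
  have cV: "x \<in> V (c n)" for n
  proof (induction n)
    case 0 then show ?case using c nil assms by simp
  next
    case (Suc n)
    then have "x \<in> (\<Union>k. V (c n @ [k]))" by (simp only: un[symmetric])
    then have "\<exists>k. x \<in> V (c n @ [k])" by simp
    then show ?case unfolding c(2) by (rule someI_ex)
  qed
  define \<alpha> where "\<alpha> n = (SOME k. x \<in> V (c n @ [k]))" for n
  have "map \<alpha> [0..<n] = c n" for n by (induction n) (simp_all add: c \<alpha>_def)
  then show thesis using that[of \<alpha>] cV by simp
qed

text \<open>Take for \<open>y\<close> a point with the address of \<open>x\<close>. As sets of equal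
  depth are disjoint, the address decides membership in all sets of the scheme.\<close>

lemma lusin_scheme_transfer:
  assumes P: "lusin_scheme P V" and Q: "lusin_scheme Q W" and x: "x \<in> P"
  shows "\<exists>y\<in>Q. \<forall>w. x \<in> V w \<longleftrightarrow> y \<in> W w"
proof -
  obtain \<alpha> :: "nat \<Rightarrow> nat" where \<alpha>: "\<forall>n. x \<in> V (map \<alpha> [0..<n])" by (rule lusin_scheme_code[OF P x])
  obtain y where y: "\<forall>n. y \<in> W (map \<alpha> [0..<n])" using lusin_scheme_branch[OF Q] by (rule exE)
  have "x \<in> V w \<longleftrightarrow> y \<in> W w" for w
  proof
    assume "x \<in> V w"
    then have "w = map \<alpha> [0..<length w]" using lusin_scheme_unique[OF P _ \<alpha>[rule_format]] by simp
    then show "y \<in> W w" using y by metis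
  next
    assume "y \<in> W w"
    then have "w = map \<alpha> [0..<length w]" using lusin_scheme_unique[OF Q _ y[rule_format]] by simp
    then show "x \<in> V w" using \<alpha> by metis
  qed
  moreover note lusin_scheme_Nil[OF Q]
  then have "y \<in> Q" using y[rule_format, of 0] by simp
  ultimately show ?thesis by (intro bexI[of _ y]) auto
qed

lemma lusin_scheme_separates:
  fixes Q :: "'a::t1_space set"
  assumes Q: "lusin_scheme Q W" and "y \<in> Q" "\<And>w. y \<in> W w \<longleftrightarrow> z \<in> W w"
  shows "y = z"
proof (rule ccontr)
  assume "y \<noteq> z"
  obtain \<alpha> :: "nat \<Rightarrow> nat" where \<alpha>: "\<forall>n. y \<in> W (map \<alpha> [0..<n])" by (rule lusin_scheme_code[OF Q assms(2)])
  have "open (- {z})" "y \<in> - {z}" using \<open>y \<noteq> z\<close> by auto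
  then obtain n where "W (map \<alpha> [0..<n]) \<subseteq> - {z}" using lusin_scheme_small[OF Q \<alpha>] by blast
  then show False using \<alpha> assms(3) by blast
qed

lemma lusin_scheme_continuous:
  assumes P: "lusin_scheme P V" and Q: "lusin_scheme Q W"
    and f: "\<And>x. x \<in> P \<Longrightarrow> f x \<in> Q" "\<And>x w. x \<in> P \<Longrightarrow> x \<in> V w \<longleftrightarrow> f x \<in> W w"
  shows "continuous_on P f"
  unfolding continuous_on_topological
proof (intro ballI allI impI)
  fix x U assume x: "x \<in> P" and U: "open U" "f x \<in> U"
  obtain \<alpha> :: "nat \<Rightarrow> nat" where \<alpha>: "\<forall>n. x \<in> V (map \<alpha> [0..<n])" by (rule lusin_scheme_code[OF P x])
  have "\<forall>n. f x \<in> W (map \<alpha> [0..<n])" using f(2)[OF x] \<alpha> by simp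
  then obtain n where n: "W (map \<alpha> [0..<n]) \<subseteq> U" using lusin_scheme_small[OF Q _ U] by blast
  have "openin (top_of_set P) (V (map \<alpha> [0..<n]))" by (rule lusin_scheme_open[OF P])
  then obtain T where T: "open T" "V (map \<alpha> [0..<n]) = P \<inter> T" by (auto simp: openin_open)
  have "\<forall>y\<in>P. y \<in> T \<longrightarrow> f y \<in> U" using n f(2)[where w = "map \<alpha> [0..<n]"] T(2) by auto
  moreover have "x \<in> T" using \<alpha> T(2) by blast
  ultimately show "\<exists>A. open A \<and> x \<in> A \<and> (\<forall>y\<in>P. y \<in> A \<longrightarrow> f y \<in> U)" using T(1) by auto
qed

lemma lusin_schemes_homeomorphic:
  fixes P :: "'a::t1_space set" and Q :: "'b::t1_space set"
  assumes P: "lusin_scheme P V" and Q: "lusin_scheme Q W"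
  shows "top_of_set P homeomorphic_space top_of_set Q"
proof -
  obtain f where f: "\<And>x. x \<in> P \<Longrightarrow> f x \<in> Q" "\<And>x w. x \<in> P \<Longrightarrow> x \<in> V w \<longleftrightarrow> f x \<in> W w"
    using lusin_scheme_transfer[OF P Q] by metis
  obtain g where g: "\<And>x. x \<in> Q \<Longrightarrow> g x \<in> P" "\<And>x w. x \<in> Q \<Longrightarrow> x \<in> W w \<longleftrightarrow> g x \<in> V w"
    using lusin_scheme_transfer[OF Q P] by metis
  have "continuous_on P f" "continuous_on Q g"
    by (rule lusin_scheme_continuous[OF P Q f], assumption+)
      (rule lusin_scheme_continuous[OF Q P g], assumption+)
  moreover have "g (f x) = x" if "x \<in> P" for x
  proof (rule lusin_scheme_separates[OF P, symmetric, OF that])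
    show "x \<in> V w \<longleftrightarrow> g (f x) \<in> V w" for w
      by (rule trans[OF f(2)[OF that] g(2)[OF f(1)[OF that]]])
  qed
  moreover have "f (g y) = y" if "y \<in> Q" for y
  proof (rule lusin_scheme_separates[OF Q, symmetric, OF that])
    show "y \<in> W w \<longleftrightarrow> f (g y) \<in> W w" for w
      by (rule trans[OF g(2)[OF that] f(2)[OF g(1)[OF that]]])
  qed
  ultimately have "homeomorphic_maps (top_of_set P) (top_of_set Q) f g"
    using f(1) g(1) by (auto simp: homeomorphic_maps_def)
  then show ?thesis by (rule homeomorphic_maps_imp_homeomorphic_space)
qed

primrec word_map :: "('k \<Rightarrow> 'a \<Rightarrow> 'a) \<Rightarrow> 'k list \<Rightarrow> 'a \<Rightarrow> 'a" where
  "word_map j [] = (\<lambda>x. x)"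
| "word_map j (k # w) = (\<lambda>x. j k (word_map j w x))"

lemma word_map_append: "word_map j (u @ w) x = word_map j u (word_map j w x)"
  by (induction u) auto

lemma word_map_in: "(\<And>k x. x \<in> P \<Longrightarrow> j k x \<in> P) \<Longrightarrow> x \<in> P \<Longrightarrow> word_map j w x \<in> P"
  by (induction w) auto

lemma word_map_inject:
  assumes "\<And>k x. x \<in> P \<Longrightarrow> j k x \<in> P" "\<And>k. inj_on (j k) P"
  shows "inj_on (word_map j w) P"
proof (induction w)
  case (Cons k w)
  show ?case
  proof (rule inj_onI)
    fix x y assume xy: "x \<in> P" "y \<in> P" "word_map j (k # w) x = word_map j (k # w) y"
    then have "word_map j w x = word_map j w y"
      using inj_onD[OF assms(2)[of k]] word_map_in[of P j, OF assms(1)] by simp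
    then show "x = y" using Cons xy by (auto dest: inj_onD)
  qed
qed simp

lemma word_map_continuous:
  assumes "\<And>k x. x \<in> P \<Longrightarrow> j k x \<in> P" "\<And>k. continuous_on P (j k)"
  shows "continuous_on P (word_map j w)"
proof (induction w)
  case (Cons k w)
  show ?case
    using continuous_on_compose2[OF assms(2) Cons.IH, of k] word_map_in[of P j, OF assms(1)] by auto
qed simp

text \<open>Only the first level is assumed disjoint and open in \<open>P\<close>. Injectivity of
  the word maps carries disjointness to deeper levels, and openness of every \<open>j k\<close> as a
  map into \<open>P\<close> carries openness.\<close>

lemma lusin_scheme_word_map:
  fixes j :: "nat \<Rightarrow> 'a::topological_space \<Rightarrow> 'a"
  assumes j: "\<And>k x. x \<in> P \<Longrightarrow> j k x \<in> P" and inj: "\<And>k. inj_on (j k) P"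
    and cover: "\<And>x. x \<in> P \<Longrightarrow> \<exists>k. x \<in> j k ` P"
    and dj: "\<And>k l x y. \<lbrakk>x \<in> P; y \<in> P; j k x = j l y\<rbrakk> \<Longrightarrow> k = l"
    and op: "\<And>k U. openin (top_of_set P) U \<Longrightarrow> openin (top_of_set P) (j k ` U)"
    and branch: "\<And>\<alpha>::nat \<Rightarrow> nat. \<exists>x. \<forall>n. x \<in> word_map j (map \<alpha> [0..<n]) ` P"
    and small: "\<And>(\<alpha>::nat \<Rightarrow> nat) x U. \<lbrakk>\<forall>n. x \<in> word_map j (map \<alpha> [0..<n]) ` P; open U; x \<in> U\<rbrakk> \<Longrightarrow>
        \<exists>n. word_map j (map \<alpha> [0..<n]) ` P \<subseteq> U"
  shows "lusin_scheme P (\<lambda>w. word_map j w ` P)"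
proof -
  have snoc: "word_map j (w @ [k]) ` P = word_map j w ` j k ` P" for w k
    by (auto simp: word_map_append)
  have P: "P = (\<Union>k. j k ` P)" using cover j by blast
  have "word_map j w ` P = (\<Union>k. word_map j (w @ [k]) ` P)" for w
  proof -
    have "word_map j w ` P = word_map j w ` (\<Union>k. j k ` P)" using P by simp
    then show ?thesis by (simp only: snoc image_UN)
  qed
  moreover have "word_map j (w @ [k]) ` P \<inter> word_map j (w @ [l]) ` P = {}" if "k \<noteq> l" for w k l
  proof -
    have "j k ` P \<inter> j l ` P = {}" using dj that by blast
    moreover have "word_map j w ` (j k ` P \<inter> j l ` P) = word_map j w ` j k ` P \<inter> word_map j w ` j l ` P"
      by (rule inj_on_image_Int[OF word_map_inject[of P j, OF j inj]]) (use j in auto)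
    ultimately show ?thesis by (simp add: snoc)
  qed
  moreover have "openin (top_of_set P) (word_map j w ` P)" for w
  proof (induction w)
    case (Cons k w)
    have "word_map j (k # w) ` P = j k ` word_map j w ` P" by auto
    then show ?case using op[OF Cons] by simp
  qed simp
  moreover have "word_map j [] ` P = P" by simp
  ultimately show ?thesis unfolding lusin_scheme_def using branch small by (intro conjI allI impI)
qed

section \<open>A self-similar continuum\<close>

text \<open>The branches at a node: number 0 is the limit copy, number \<open>n + 1\<close> is the
  left-end copy inside \<open>n\<close> nested right-end copies. \<open>P\<close> itself is no
  branch, as its powers do not shrink to points.\<close>

definition child :: "('a \<Rightarrow> 'a) \<Rightarrow> ('a \<Rightarrow> 'a) \<Rightarrow> ('a \<Rightarrow> 'a) \<Rightarrow> nat \<Rightarrow> 'a \<Rightarrow> 'a" where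
  "child P M A k x = (case k of 0 \<Rightarrow> A x | Suc n \<Rightarrow> (P ^^ n) (M x))"

lemma child_simps [simp]: "child P M A 0 x = A x" "child P M A (Suc n) x = (P ^^ n) (M x)"
  by (simp_all add: child_def)

lemma connected_preimage_of_embedding:
  fixes i :: "'a::metric_space \<Rightarrow> 'b::metric_space"
  assumes "compact S" "continuous_on S i" "inj_on i S" "connected K" "K \<subseteq> i ` S"
  obtains L where "L \<subseteq> S" "connected L" "K = i ` L"
proof -
  define j where "j = inv_into S i"
  have "continuous_on (i ` S) j" by (rule continuous_on_inv[OF assms(2,1)]) (use assms(3) in \<open>simp add: j_def\<close>)
  then have "connected (j ` K)"
    by (intro connected_continuous_image continuous_on_subset[OF _ assms(5)] assms(4))
  moreover have "j ` K \<subseteq> S" using assms(5) by (auto simp: j_def inv_into_into)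
  moreover have "K = i ` j ` K" using assms(5) by (force simp: j_def f_inv_into_f image_image)
  ultimately show thesis by (intro that)
qed

lemma has_end_map_subset:
  assumes "has_end_map M h e p" "N \<subseteq> M"
  shows "has_end_map N h e p"
  using assms continuous_on_subset unfolding has_end_map_def by (meson subsetD)

text \<open>\<open>X\<close> compactifies a line by a copy \<open>P ` X\<close> of itself at the right end and a copy \<open>M ` X\<close>
  at the left end. The copies nested at the right end shrink to a third copy \<open>A ` X\<close>; the function
  \<open>r\<close> is the position of the projection to that copy.\<close>

locale self_similar =
  fixes X :: "'a::{metric_space,second_countable_topology} set" and line :: "real \<Rightarrow> 'a"
    and f r :: "'a \<Rightarrow> real" and P M A :: "'a \<Rightarrow> 'a"
  assumes compact_X: "compact X"
    and line_continuous: "continuous_on UNIV line" and X_closure: "X = closure (range line)"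
    and P_in: "\<And>x. x \<in> X \<Longrightarrow> P x \<in> X" and P_continuous: "continuous_on X P" and P_inj: "inj_on P X"
    and M_in: "\<And>x. x \<in> X \<Longrightarrow> M x \<in> X" and M_continuous: "continuous_on X M" and M_inj: "inj_on M X"
    and A_in: "\<And>x. x \<in> X \<Longrightarrow> A x \<in> X" and A_continuous: "continuous_on X A" and A_inj: "inj_on A X"
    and X_cases: "\<And>x. x \<in> X \<Longrightarrow> x \<in> range line \<or> x \<in> P ` X \<or> x \<in> M ` X"
    and f_continuous: "continuous_on X f" and f_line: "\<And>s. f (line s) = kap s"
    and f_P: "\<And>x. x \<in> X \<Longrightarrow> f (P x) = 1" and f_M: "\<And>x. x \<in> X \<Longrightarrow> f (M x) = - 1"
    and P_A: "\<And>x. x \<in> X \<Longrightarrow> P (A x) = A x"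
    and Inter_P: "\<And>x. (\<forall>n. x \<in> (P ^^ n) ` X) \<Longrightarrow> x \<in> A ` X"
    and r_continuous: "continuous_on X r" and r_A: "\<And>x. x \<in> X \<Longrightarrow> r (A x) = f x"
    and r_P: "\<And>x. x \<in> X \<Longrightarrow> r (P x) = r x" and r_M: "\<And>x. x \<in> X \<Longrightarrow> r (M x) = 0"
    and small_copies: "\<And>e. 0 < e \<Longrightarrow> \<exists>N. \<forall>w. N \<le> length w \<longrightarrow>
      (\<forall>x\<in>X. \<forall>y\<in>X. dist (word_map (child P M A) w x) (word_map (child P M A) w y) < e)"
begin

abbreviation C :: "nat \<Rightarrow> 'a \<Rightarrow> 'a" where "C \<equiv> child P M A"

abbreviation W :: "nat list \<Rightarrow> 'a \<Rightarrow> 'a" where "W \<equiv> word_map (child P M A)"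

section \<open>The embeddings and the disjointness of the child copies\<close>

lemma closed_X: "closed X" by (simp add: X_closure)

lemma line_in [simp]: "line s \<in> X"
  unfolding X_closure by (rule subsetD[OF closure_subset]) simp

lemma connected_X: "connected X"
  unfolding X_closure
  by (intro connected_imp_connected_closure connected_continuous_image line_continuous) simp

lemma P_power_in: "x \<in> X \<Longrightarrow> (P ^^ n) x \<in> X"
  by (induction n) (auto intro: P_in)

lemma P_power_inj: "inj_on (P ^^ n) X"
proof (induction n)
  case (Suc n)
  show ?case
  proof (rule inj_onI)
    fix x y assume xy: "x \<in> X" "y \<in> X" "(P ^^ Suc n) x = (P ^^ Suc n) y"
    then have "(P ^^ n) x = (P ^^ n) y" using inj_onD[OF P_inj] P_power_in by simp
    then show "x = y" using inj_onD[OF Suc] xy by simp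
  qed
qed simp

lemma P_power_continuous: "continuous_on X (P ^^ n)"
proof (induction n)
  case (Suc n)
  have "continuous_on X (\<lambda>x. P ((P ^^ n) x))"
    by (rule continuous_on_compose2[OF P_continuous Suc]) (use P_power_in in auto)
  then show ?case by (simp add: o_def)
qed simp

lemma P_power_A: "x \<in> X \<Longrightarrow> (P ^^ n) (A x) = A x"
  by (induction n) (auto simp: P_A)

lemma C_in: "x \<in> X \<Longrightarrow> C k x \<in> X"
  by (cases k) (auto intro: A_in M_in P_power_in)

lemma C_inj: "inj_on (C k) X"
proof (cases k)
  case 0 then show ?thesis using A_inj by (auto simp: inj_on_def)
next
  case (Suc n)
  show ?thesis
  proof (rule inj_onI)
    fix x y assume xy: "x \<in> X" "y \<in> X" "C k x = C k y"
    then have "M x = M y" using inj_onD[OF P_power_inj[of n]] M_in Suc by simp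
    then show "x = y" using inj_onD[OF M_inj] xy by simp
  qed
qed

lemma C_continuous: "continuous_on X (C k)"
proof (cases k)
  case 0 then show ?thesis using A_continuous by simp
next
  case (Suc n)
  have "continuous_on X (\<lambda>x. (P ^^ n) (M x))"
    by (rule continuous_on_compose2[OF P_power_continuous M_continuous]) (use M_in in auto)
  then show ?thesis by (simp add: Suc)
qed

lemma W_in: "x \<in> X \<Longrightarrow> W w x \<in> X" by (rule word_map_in[OF C_in])

lemma W_inj: "inj_on (W w) X" by (rule word_map_inject[OF C_in C_inj])

lemma W_continuous: "continuous_on X (W w)" by (rule word_map_continuous[OF C_in C_continuous])

lemma P_neq_M: "x \<in> X \<Longrightarrow> y \<in> X \<Longrightarrow> P x \<noteq> M y"
  using f_P[of x] f_M[of y] by auto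

text \<open>Cancelling \<open>n\<close> factors \<open>P\<close> leaves a point in the images of
  both \<open>M\<close> and \<open>P\<close>, where \<open>f\<close> would be -1 and 1.\<close>

lemma P_power_M_disjoint:
  assumes "x \<in> X" "y \<in> X" "n < m" shows "(P ^^ n) (M x) \<noteq> (P ^^ m) y"
proof
  assume eq: "(P ^^ n) (M x) = (P ^^ m) y"
  obtain d where d: "m = n + Suc d" using \<open>n < m\<close> less_iff_Suc_add by auto
  have "(P ^^ m) y = (P ^^ n) (P ((P ^^ d) y))" unfolding d by (simp only: funpow_add funpow.simps o_apply)
  then have "M x = P ((P ^^ d) y)"
    using inj_onD[OF P_power_inj[of n]] eq M_in P_in P_power_in assms by metis
  then show False using P_neq_M[of "(P ^^ d) y" x] P_power_in assms by metis
qed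

text \<open>Since \<open>P\<close> fixes the image of \<open>A\<close> pointwise, that image lies in
  the image of every power of \<open>P\<close>, and this separates it from all other
  children.\<close>

lemma C_disjoint:
  assumes "x \<in> X" "y \<in> X" "C k x = C l y" shows "k = l"
proof (rule ccontr)
  assume "k \<noteq> l"
  have *: False if "k < l" "x \<in> X" "y \<in> X" "C k x = C l y" for k l x y
  proof -
    obtain m where m: "l = Suc m" using \<open>k < l\<close> by (cases l) auto
    show False
    proof (cases k)
      case 0
      have "(P ^^ m) (M y) = (P ^^ Suc m) (A x)" using that m 0 P_power_A[of x "Suc m"] by simp
      then show False using P_power_M_disjoint[of y "A x" m "Suc m"] A_in that by simp
    next
      case (Suc n)
      then show False using P_power_M_disjoint[of x "M y" n m] M_in that m by simp
    qed
  qed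
  show False using *[of k l x y] *[of l k y x] assms \<open>k \<noteq> l\<close> by (cases "k < l") auto
qed

lemma X_f_cases:
  assumes "x \<in> X"
  shows "(\<exists>s. x = line s \<and> \<bar>f x\<bar> < 1) \<or> (x \<in> P ` X \<and> f x = 1) \<or> (x \<in> M ` X \<and> f x = - 1)"
  using X_cases[OF assms] f_P f_M f_line abs_kap_less by auto

lemma f_abs_le: "x \<in> X \<Longrightarrow> \<bar>f x\<bar> \<le> 1"
  using X_f_cases[of x] by auto

lemma f_eq_1: "{x \<in> X. f x = 1} = P ` X"
  using X_f_cases P_in f_P by force

lemma f_eq_minus_1: "{x \<in> X. f x = - 1} = M ` X"
  using X_f_cases M_in f_M by force

lemma f_inj:
  assumes "x \<in> X" "y \<in> X" "f x = f y" "\<bar>f x\<bar> < 1" shows "x = y"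
proof -
  obtain s t where "x = line s" "y = line t" using X_f_cases[OF assms(1)] X_f_cases[OF assms(2)] assms(3,4) by auto
  then show ?thesis using assms(3) by (simp add: f_line kap_inject)
qed

lemma line_dense: "x \<in> X \<Longrightarrow> 0 < e \<Longrightarrow> \<exists>z\<in>X. \<bar>f z\<bar> < 1 \<and> dist z x < e"
  unfolding X_closure closure_approachable using line_in abs_kap_less
  by (metis (no_types, lifting) X_closure f_line imageE)

section \<open>Prolonging end maps along the line\<close>

lemma continuous_on_comp_X:
  assumes "continuous_on X h" "continuous_on X i" "\<And>x. x \<in> X \<Longrightarrow> i x \<in> X"
  shows "continuous_on X (h \<circ> i)"
  unfolding o_def by (rule continuous_on_compose2[OF assms(1,2)]) (use assms(3) in auto)

text \<open>Joining for \<open>- f\<close>, which exchanges the two ends: the map starts in the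
  \<open>P\<close>-image, follows the line and finishes in the \<open>M\<close>-image.\<close>

lemma join_P:
  fixes h :: "'a \<Rightarrow> 'b::metric_space"
  assumes h: "continuous_on X h" and e: "0 < e" and p: "p \<in> X" "has_end_map X (h \<circ> P) e p"
    and q: "q \<in> X" "has_end_map X (h \<circ> M) e q"
  shows "has_end_map X h e (P p)"
proof (rule end_map_join[OF compact_X, of "\<lambda>x. - f x" h e "P p" "M q"])
  have "{x \<in> X. - f x = - 1} = P ` X" "{x \<in> X. - f x = 1} = M ` X"
    using f_eq_1 f_eq_minus_1 by auto
  then show "has_end_map {x \<in> X. - f x = - 1} h e (P p)" "has_end_map {x \<in> X. - f x = 1} h e (M q)"
    using iffD2[OF has_end_map_image[OF compact_X P_continuous P_inj p(1)] p(2)]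
      iffD2[OF has_end_map_image[OF compact_X M_continuous M_inj q(1)] q(2)] by simp_all
  show "x = y" if "x \<in> X" "y \<in> X" "- f x = - f y" "\<bar>- f x\<bar> < 1" for x y
    using f_inj that by simp
  show "\<exists>z\<in>X. \<bar>- f z\<bar> < 1 \<and> dist z x < e" if "x \<in> X" "0 < e" for x e
    using line_dense[OF that] by simp
  show "continuous_on X (\<lambda>x. - f x)" by (intro continuous_intros f_continuous)
  show "\<bar>- f x\<bar> \<le> 1" if "x \<in> X" for x using f_abs_le[OF that] by simp
qed (use h e p q P_in M_in f_P f_M in simp_all)

lemma join_M:
  fixes h :: "'a \<Rightarrow> 'b::metric_space"
  assumes h: "continuous_on X h" and e: "0 < e" and p: "p \<in> X" "has_end_map X (h \<circ> M) e p"
    and q: "q \<in> X" "has_end_map X (h \<circ> P) e q"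
  shows "has_end_map X h e (M p)"
proof (rule end_map_join[OF compact_X f_continuous h e f_abs_le f_inj line_dense, of "M p" "P q"])
  show "has_end_map {x \<in> X. f x = - 1} h e (M p)" "has_end_map {x \<in> X. f x = 1} h e (P q)"
    unfolding f_eq_1 f_eq_minus_1
    by (rule iffD2[OF has_end_map_image[OF compact_X M_continuous M_inj p(1)] p(2)],
        rule iffD2[OF has_end_map_image[OF compact_X P_continuous P_inj q(1)] q(2)])
qed (use p q P_in M_in f_P f_M in simp_all)

text \<open>Each use of \<open>join_P\<close> moves one factor \<open>P\<close> from the measuring
  map to the point, starting in the innermost of the nested copies.\<close>

lemma join_P_power:
  fixes h :: "'a \<Rightarrow> 'b::metric_space"
  assumes h: "continuous_on X h" and e: "0 < e" and M: "\<And>k. \<exists>q\<in>X. has_end_map X (h \<circ> (P ^^ k) \<circ> M) e q"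
  shows "p \<in> X \<Longrightarrow> has_end_map X (h \<circ> (P ^^ n)) e p \<Longrightarrow> has_end_map X h e ((P ^^ n) p)"
proof (induction n arbitrary: p)
  case (Suc n)
  obtain q where q: "q \<in> X" "has_end_map X (h \<circ> (P ^^ n) \<circ> M) e q" using M by blast
  have "has_end_map X (h \<circ> (P ^^ n) \<circ> P) e p"
    using Suc.prems(2) by (simp only: funpow_Suc_right comp_assoc)
  then have "has_end_map X (h \<circ> (P ^^ n)) e (P p)"
    by (intro join_P[OF _ e Suc.prems(1) _ q] continuous_on_comp_X[OF h P_power_continuous P_power_in])
  then have "has_end_map X h e ((P ^^ n) (P p))" by (intro Suc.IH P_in Suc.prems(1))
  then show ?case by (simp add: funpow_swap1)
qed simp

text \<open>For points of the limit copy: as this copy is the intersection of the images of the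
  powers of \<open>P\<close>, an end map on it extends to one of these images, and from there it is
  joined outwards. For a point of another child the map crosses the line next to it and needs an end
  map on the nested copy beyond; the fact \<open>deep\<close> supplies one, based at a point of the
  limit copy.\<close>

lemma join_child:
  fixes h :: "'a \<Rightarrow> 'b::metric_space"
  assumes h: "continuous_on X h" and e: "0 < e" and all: "\<And>k. \<exists>q\<in>X. has_end_map X (h \<circ> C k) e q"
    and p: "p \<in> X" "has_end_map X (h \<circ> C k) e p"
  shows "has_end_map X h e (C k p)"
proof -
  have C0: "h \<circ> C 0 = h \<circ> A" and CS: "h \<circ> C (Suc n) = h \<circ> (P ^^ n) \<circ> M" for n by auto
  have M: "\<exists>q\<in>X. has_end_map X (h \<circ> (P ^^ n) \<circ> M) e q" for n using all[of "Suc n"] unfolding CS .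
  have deep: "has_end_map X (h \<circ> (P ^^ n)) e (A q)" if q: "q \<in> X" "has_end_map X (h \<circ> A) e q" for q n
  proof -
    obtain m where m: "has_end_map ((P ^^ m) ` X) h e (A q)"
    proof (rule end_map_decreasing[of "\<lambda>m. (P ^^ m) ` X" "A ` X" h "A q" e])
      show "compact ((P ^^ m) ` X)" for m
        by (rule compact_continuous_image[OF P_power_continuous compact_X])
      show "(P ^^ Suc m) ` X \<subseteq> (P ^^ m) ` X" for m
        using P_in by (auto simp: funpow_swap1)
      show "compact (A ` X)" by (rule compact_continuous_image[OF A_continuous compact_X])
      show "A ` X \<subseteq> (P ^^ m) ` X" for m
      proof
        fix y assume "y \<in> A ` X"
        then obtain x where "x \<in> X" "y = A x" by blast
        then have "y = (P ^^ m) (A x)" "A x \<in> X" by (simp_all add: P_power_A A_in)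
        then show "y \<in> (P ^^ m) ` X" by blast
      qed
      show "x \<in> A ` X" if "\<And>n. x \<in> (P ^^ n) ` X" for x using Inter_P that by blast
      show "has_end_map (A ` X) h e (A q)"
        by (rule iffD2[OF has_end_map_image[OF compact_X A_continuous A_inj q(1)] q(2)])
    qed (use h q in auto)
    \<comment> \<open>The exponent has to be at least \<open>m\<close> for the end map to exist and
      at least \<open>n\<close> for the target; the \<open>m\<close> surplus factors are then
      removed by \<open>join_P_power\<close>.\<close>
    define l where "l = n + m"
    have "(P ^^ l) ` X \<subseteq> (P ^^ m) ` X"
      unfolding l_def using P_power_in by (auto simp: funpow_add add.commute[of n])
    then have "has_end_map ((P ^^ l) ` X) h e ((P ^^ l) (A q))"
      using has_end_map_subset[OF m] P_power_A[OF q(1)] by simp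
    then have "has_end_map X (h \<circ> (P ^^ l)) e (A q)"
      using has_end_map_image[OF compact_X P_power_continuous P_power_inj A_in[OF q(1)]] by blast
    then have "has_end_map X (h \<circ> (P ^^ n) \<circ> (P ^^ m)) e (A q)"
      by (simp only: l_def funpow_add comp_assoc)
    then have "has_end_map X (h \<circ> (P ^^ n)) e ((P ^^ m) (A q))"
    proof (rule join_P_power[rotated 4])
      show "\<exists>q\<in>X. has_end_map X (h \<circ> (P ^^ n) \<circ> (P ^^ k) \<circ> M) e q" for k
        using M[of "n + k"] by (simp only: funpow_add comp_assoc)
    qed (use e A_in q continuous_on_comp_X[OF h P_power_continuous P_power_in] in auto)
    then show ?thesis using P_power_A[OF q(1)] by simp
  qed
  show ?thesis
  proof (cases k)
    case 0
    then show ?thesis using deep[OF p(1), of 0] p(2) by (simp add: C0)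
  next
    case (Suc n)
    obtain q where q: "q \<in> X" "has_end_map X (h \<circ> A) e q" using all[of 0] unfolding C0 by blast
    have "has_end_map X (h \<circ> (P ^^ n) \<circ> P) e (A q)"
      using deep[OF q, of "Suc n"] by (simp only: funpow_Suc_right comp_assoc)
    then have "has_end_map X (h \<circ> (P ^^ n)) e (M p)"
      using p(2) unfolding Suc CS
      by (intro join_M[OF _ e p(1) _ A_in[OF q(1)]] continuous_on_comp_X[OF h P_power_continuous P_power_in])
    then have "has_end_map X h e ((P ^^ n) (M p))"
      by (rule join_P_power[OF h e M M_in[OF p(1)]])
    then show ?thesis by (simp add: Suc)
  qed
qed

section \<open>Points with addresses of every length, and chains that start at them\<close>

definition E :: "'a set" where
  "E = {x \<in> X. \<forall>n. \<exists>w. length w = n \<and> x \<in> W w ` X}"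

lemma E_subset: "E \<subseteq> X" by (auto simp: E_def)

lemma C_in_E: assumes "x \<in> E" shows "C k x \<in> E"
proof -
  have "\<exists>w. length w = n \<and> C k x \<in> W w ` X" for n
  proof (cases n)
    case 0 then show ?thesis using assms C_in by (intro exI[of _ "[]"]) (auto simp: E_def)
  next
    case (Suc m)
    obtain w y where "length w = m" "x = W w y" "y \<in> X" using assms unfolding E_def by blast
    then show ?thesis using Suc by (intro exI[of _ "k # w"]) auto
  qed
  then show ?thesis using assms C_in by (auto simp: E_def)
qed

text \<open>\<open>E\<close> does not ask the addresses of a point to extend one another. But
  children are disjoint, so every nonempty address of \<open>C k y\<close> begins with
  \<open>k\<close>, and its remainder is an address of \<open>y\<close>.\<close>

lemma E_C_cancel: assumes "y \<in> X" "C k y \<in> E" shows "y \<in> E"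
proof -
  have "\<exists>w. length w = n \<and> y \<in> W w ` X" for n
  proof -
    obtain w z where w: "length w = Suc n" "C k y = W w z" "z \<in> X" using assms unfolding E_def by blast
    then obtain l v where v: "w = l # v" by (cases w) auto
    have z: "W v z \<in> X" by (rule W_in[OF w(3)])
    have "k = l" using C_disjoint[OF assms(1) z] w(2) v by simp
    then have "y = W v z" using inj_onD[OF C_inj _ assms(1) z, of k] w(2) v by simp
    then show ?thesis using w v by auto
  qed
  then show ?thesis using assms(1) by (simp add: E_def)
qed

lemma E_cases: assumes "x \<in> E" obtains k y where "y \<in> E" "x = C k y"
proof -
  obtain w z where w: "length w = Suc 0" "x = W w z" "z \<in> X" using assms unfolding E_def by blast
  then obtain k where "w = [k]" by (cases w) auto
  then have x: "x = C k z" using w by simp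
  show thesis by (rule that[OF E_C_cancel[OF w(3)] x]) (use assms x in simp)
qed

lemma E_W: assumes "x \<in> E" "x \<in> W w ` X" shows "x \<in> W w ` E"
proof -
  have "y \<in> E" if "y \<in> X" "W w y \<in> E" for y
    using that
  proof (induction w)
    case (Cons k w)
    then show ?case using E_C_cancel[OF W_in[OF Cons.prems(1)], of k w] by simp
  qed simp
  then show ?thesis using assms by blast
qed

lemma branch_in_E: "\<exists>x. \<forall>n. x \<in> W (map \<alpha> [0..<n]) ` E"
proof -
  have "\<exists>x. \<forall>n. x \<in> W (map \<alpha> [0..<n]) ` X"
  proof (rule compact_decreasing_sequence)
    show "compact (W (map \<alpha> [0..<n]) ` X)" for n by (rule compact_continuous_image[OF W_continuous compact_X])
    show "W (map \<alpha> [0..<Suc n]) ` X \<subseteq> W (map \<alpha> [0..<n]) ` X" for n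
      using C_in by (auto simp: word_map_append)
    show "W (map \<alpha> [0..<n]) ` X \<noteq> {}" for n using line_in by blast
  qed
  then obtain x where x: "\<forall>n. x \<in> W (map \<alpha> [0..<n]) ` X" by blast
  have "x \<in> E"
    unfolding E_def
  proof (intro CollectI conjI allI)
    show "x \<in> X" using x[rule_format, of 0] by simp
    show "\<exists>w. length w = n \<and> x \<in> W w ` X" for n using x by (intro exI[of _ "map \<alpha> [0..<n]"]) simp
  qed
  then show ?thesis using x E_W by blast
qed

lemma E_nonempty: "E \<noteq> {}"
proof -
  obtain x where "\<forall>n. x \<in> W (map (\<lambda>_. 0) [0..<n]) ` E" using branch_in_E by blast
  from this[rule_format, of 0] show ?thesis by auto
qed

text \<open>Induction on a depth at which all copies are small when measured by \<open>h\<close>. At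
  depth 0 the whole space is small and a constant map suffices. The step passes from
  \<open>h\<close> to \<open>h\<close> composed with \<open>C k\<close>, which is why
  \<open>h\<close> is arbitrary, and glues by \<open>join_child\<close>.\<close>

lemma has_end_map_E:
  fixes h :: "'a \<Rightarrow> 'b::metric_space"
  assumes "continuous_on X h" "0 < e" "p \<in> E"
    "\<And>w x y. \<lbrakk>length w = N; x \<in> X; y \<in> X\<rbrakk> \<Longrightarrow> dist (h (W w x)) (h (W w y)) < e"
  shows "has_end_map X h e p"
  using assms
proof (induction N arbitrary: h p)
  case 0
  then show ?case
    unfolding has_end_map_def using 0(4)[of "[]"] by (intro exI[of _ "\<lambda>_. 0"]) auto
next
  case (Suc N)
  have *: "has_end_map X (h \<circ> C k) e q" if "q \<in> E" for k q
  proof (rule Suc.IH[OF continuous_on_comp_X[OF Suc.prems(1) C_continuous C_in] \<open>0 < e\<close> that])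
    show "dist ((h \<circ> C k) (W w x)) ((h \<circ> C k) (W w y)) < e" if "length w = N" "x \<in> X" "y \<in> X" for w x y
      using Suc.prems(4)[of "k # w" x y] that by simp
  qed
  obtain k q where kq: "q \<in> E" "p = C k q" by (rule E_cases[OF Suc.prems(3)])
  have "\<exists>q\<in>X. has_end_map X (h \<circ> C k) e q" for k using * E_nonempty E_subset by blast
  then show ?case
    unfolding kq(2) by (rule join_child[OF Suc.prems(1,2)]) (use kq(1) E_subset * in auto)
qed

lemma E_chain_cover: assumes "p \<in> E" "0 < e" shows "\<exists>n U. chain_cover X dist e n U \<and> p \<in> U 1"
proof -
  obtain N where N: "\<forall>w. N \<le> length w \<longrightarrow> (\<forall>x\<in>X. \<forall>y\<in>X. dist (W w x) (W w y) < e/2)"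
    using small_copies[of "e/2"] \<open>0 < e\<close> by auto
  have "has_end_map X (\<lambda>x. x) (e/2) p"
    by (rule has_end_map_E[where N = N]) (use N assms in auto)
  then show ?thesis using end_map_chain_cover[OF compact_X connected_X] assms E_subset by blast
qed

text \<open>Peel off factors \<open>P\<close> while possible; this stops because the point is not in
  the limit copy. What remains lies in neither end copy, so it is on the line.\<close>

lemma not_in_child:
  assumes "x \<in> X" "\<And>k. x \<notin> C k ` X" obtains n s where "x = (P ^^ n) (line s)"
proof -
  have "x \<notin> A ` X" using assms(2)[of 0] by auto
  then obtain m where "x \<notin> (P ^^ m) ` X" using Inter_P by blast
  then have "\<exists>m. x \<notin> (P ^^ m) ` X" ..
  then obtain m where m: "x \<notin> (P ^^ m) ` X" "\<And>l. l < m \<Longrightarrow> x \<in> (P ^^ l) ` X"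
    using exists_least_iff[of "\<lambda>m. x \<notin> (P ^^ m) ` X"] by auto
  obtain n where n: "m = Suc n" using m(1) assms(1) by (cases m) auto
  obtain y where y: "y \<in> X" "x = (P ^^ n) y" using m(2)[of n] n by auto
  have "y \<notin> P ` X" using m(1) y(2) unfolding n by (auto simp: funpow_swap1)
  moreover have "y \<notin> M ` X" using assms(2)[of "Suc n"] y(2) by auto
  ultimately obtain s where "y = line s" using X_cases[OF y(1)] by auto
  then show thesis using that y by simp
qed

lemma not_in_E: assumes "x \<in> X" "x \<notin> E" obtains w n s where "x = W w ((P ^^ n) (line s))"
proof -
  obtain N where "\<forall>w. length w = N \<longrightarrow> x \<notin> W w ` X" using assms unfolding E_def by blast
  then have "\<exists>w n s. x = W w ((P ^^ n) (line s))" using assms(1)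
  proof (induction N arbitrary: x)
    case 0 then show ?case using 0(1)[rule_format, of "[]"] by auto
  next
    case (Suc N)
    show ?case
    proof (cases "\<exists>k. x \<in> C k ` X")
      case True
      then obtain k y where y: "y \<in> X" "x = C k y" by blast
      have "y \<notin> W w ` X" if "length w = N" for w
      proof
        assume "y \<in> W w ` X"
        then have "x \<in> W (k # w) ` X" using y(2) by auto
        then show False using Suc.prems(1)[rule_format, of "k # w"] that by (simp del: word_map.simps)
      qed
      then obtain w n s where "y = W w ((P ^^ n) (line s))" using Suc.IH[of y] y(1) by blast
      then have "x = W (k # w) ((P ^^ n) (line s))" using y(2) by simp
      then show ?thesis by blast
    next
      case False
      then obtain n s where "x = (P ^^ n) (line s)" using not_in_child[OF Suc.prems(2)] by blast
      then have "x = W [] ((P ^^ n) (line s))" by simp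
      then show ?thesis by blast
    qed
  qed
  then show thesis using that by blast
qed

lemma W_P_power:
  "continuous_on X (\<lambda>x. W w ((P ^^ n) x))" "inj_on (\<lambda>x. W w ((P ^^ n) x)) X"
  "x \<in> X \<Longrightarrow> W w ((P ^^ n) x) \<in> X"
proof -
  show "continuous_on X (\<lambda>x. W w ((P ^^ n) x))"
    by (rule continuous_on_compose2[OF W_continuous P_power_continuous]) (use P_power_in in auto)
  show "inj_on (\<lambda>x. W w ((P ^^ n) x)) X"
  proof (rule inj_onI)
    fix x y assume xy: "x \<in> X" "y \<in> X" "W w ((P ^^ n) x) = W w ((P ^^ n) y)"
    then have "(P ^^ n) x = (P ^^ n) y" using inj_onD[OF W_inj] P_power_in by metis
    then show "x = y" using inj_onD[OF P_power_inj] xy by metis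
  qed
  show "x \<in> X \<Longrightarrow> W w ((P ^^ n) x) \<in> X" by (intro W_in P_power_in)
qed

lemma closed_f: "closed {x \<in> X. f x \<le> c}" "closed {x \<in> X. c \<le> f x}"
proof -
  have "closed (X \<inter> f -` {..c})" "closed (X \<inter> f -` {c..})"
    by (intro continuous_closed_preimage f_continuous closed_X; simp)+
  moreover have "X \<inter> f -` {..c} = {x \<in> X. f x \<le> c}" "X \<inter> f -` {c..} = {x \<in> X. c \<le> f x}" by auto
  ultimately show "closed {x \<in> X. f x \<le> c}" "closed {x \<in> X. c \<le> f x}" by simp_all
qed

text \<open>The two subcontinua are the images of the closures of the half-lines that meet at
  \<open>line s\<close>. The values of \<open>f\<close> confine these closures to either side of
  \<open>kap s\<close>, so neither contains the other.\<close>

lemma line_point_not_end_point: "W w ((P ^^ n) (line s)) \<notin> end_points X dist"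
proof -
  define i where "i = (\<lambda>x. W w ((P ^^ n) x))"
  have i: "continuous_on X i" "inj_on i X" "\<And>x. x \<in> X \<Longrightarrow> i x \<in> X" unfolding i_def by (rule W_P_power; assumption)+
  have cl: "compact (i ` closure (line ` S)) \<and> connected (i ` closure (line ` S)) \<and> i ` closure (line ` S) \<subseteq> X"
    if "connected S" for S
  proof -
    have sub: "closure (line ` S) \<subseteq> X" by (rule closure_minimal) (use closed_X in auto)
    then have ci: "continuous_on (closure (line ` S)) i" using i(1) continuous_on_subset by blast
    have "compact (closure (line ` S))" using sub compact_X
      by (metis closed_closure compact_Int_closed inf.absorb_iff2)
    moreover have "connected (closure (line ` S))"
      using line_continuous continuous_on_subset[OF _ subset_UNIV] that
      by (intro connected_imp_connected_closure connected_continuous_image) auto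
    ultimately show ?thesis using ci sub i(3) by (auto intro: compact_continuous_image connected_continuous_image)
  qed
  define H where "H = closure (line ` {..s})"
  define K where "K = closure (line ` {s..})"
  have Hf: "H \<subseteq> {x \<in> X. f x \<le> kap s}" and Kf: "K \<subseteq> {x \<in> X. kap s \<le> f x}"
    unfolding H_def K_def by (rule closure_minimal; use closed_f in \<open>auto simp: f_line kap_less_eq\<close>)+
  have lH: "t \<le> s \<Longrightarrow> line t \<in> H" and lK: "s \<le> t \<Longrightarrow> line t \<in> K" for t
    unfolding H_def K_def by (rule subsetD[OF closure_subset]; simp)+
  have nH: "line (s + 1) \<notin> H" and nK: "line (s - 1) \<notin> K"
    using Hf Kf kap_strict_mono[of s "s + 1"] kap_strict_mono[of "s - 1" s] by (auto simp: f_line)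
  have HX: "H \<subseteq> X" "K \<subseteq> X" using Hf Kf by auto
  have inj: "i x \<in> i ` S \<longleftrightarrow> x \<in> S" if "x \<in> X" "S \<subseteq> X" for x S
    using inj_on_image_mem_iff[OF i(2)] that by blast
  have "i (line s) \<notin> end_points X dist"
  proof (rule not_end_point[of X "i ` H" "i ` K" _ "i (line (s - 1))" "i (line (s + 1))"])
    show "bounded X" using compact_X compact_imp_bounded by blast
    show "i (line (s - 1)) \<notin> i ` K" "i (line (s + 1)) \<notin> i ` H"
      using inj nH nK HX by simp_all
    show "compact (i ` H)" "connected (i ` H)" "i ` H \<subseteq> X" using cl[of "{..s}"] by (auto simp: H_def)
    show "compact (i ` K)" "connected (i ` K)" "i ` K \<subseteq> X" using cl[of "{s..}"] by (auto simp: K_def)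
  qed (use lH lK in auto)
  then show ?thesis by (simp add: i_def)
qed

lemma end_points_eq: "end_points X dist = E"
proof
  show "end_points X dist \<subseteq> E"
  proof
    fix x assume x: "x \<in> end_points X dist"
    then have "x \<in> X" by (simp add: end_points_def)
    show "x \<in> E"
    proof (rule ccontr)
      assume "x \<notin> E"
      then obtain w n s where "x = W w ((P ^^ n) (line s))" by (rule not_in_E[OF \<open>x \<in> X\<close>])
      then show False using line_point_not_end_point x by blast
    qed
  qed
  show "E \<subseteq> end_points X dist"
    using E_chain_cover E_subset unfolding end_points_def by blast
qed

lemma continuum_X: "continuum X dist"
  unfolding continuum_dist using connected_X compact_X line_in by blast

lemma chainable_X: "chainable X dist"
  unfolding chainable_def using continuum_X E_chain_cover E_nonempty by blast

section \<open>Subcontinua and the rational points of the lines\<close>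

definition Q :: "'a set" where
  "Q = (\<lambda>(w, n, q). W w ((P ^^ n) (line (real_of_rat q)))) ` UNIV"

lemma countable_Q: "countable Q"
  unfolding Q_def by (rule countable_image) (rule countableI_type)

lemma W_in_Q: "x \<in> Q \<Longrightarrow> C k x \<in> Q"
proof -
  assume "x \<in> Q"
  then obtain w n q where "x = W w ((P ^^ n) (line (real_of_rat q)))" unfolding Q_def by auto
  then have "C k x = W (k # w) ((P ^^ n) (line (real_of_rat q)))" by simp
  then show "C k x \<in> Q" unfolding Q_def by (auto intro: image_eqI[of _ _ "(k # w, n, q)"])
qed

lemma P_power_line_in_Q: "(P ^^ n) (line (real_of_rat q)) \<in> Q"
  unfolding Q_def by (auto intro: image_eqI[of _ _ "([], n, q)"])

text \<open>If \<open>f\<close> were constant on \<open>K\<close>, then \<open>K\<close> would lie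
  in an end copy or be a single point. So \<open>f\<close> takes an interval of values on
  \<open>K\<close>, and a value strictly between -1 and 1 determines the point of the line.\<close>

lemma connected_meets_rational_line:
  assumes K: "connected K" "K \<subseteq> X" "x \<in> K" "y \<in> K" "x \<noteq> y" and "\<not> K \<subseteq> P ` X" "\<not> K \<subseteq> M ` X"
  shows "\<exists>q. line (real_of_rat q) \<in> K"
proof -
  have "\<exists>a\<in>K. \<exists>b\<in>K. f a < f b"
  proof (rule ccontr)
    assume no: "\<not> (\<exists>a\<in>K. \<exists>b\<in>K. f a < f b)"
    then have eq: "f z = f x" if "z \<in> K" for z using K(3) that by (meson linorder_neqE_linordered_idom)
    consider "f x = 1" | "f x = - 1" | "\<bar>f x\<bar> < 1" using f_abs_le[of x] K by fastforce
    then show False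
    proof cases
      case 1 then show False using assms(6) eq K(2) unfolding f_eq_1[symmetric] by auto
    next
      case 2 then show False using assms(7) eq K(2) unfolding f_eq_minus_1[symmetric] by auto
    next
      case 3 then show False using f_inj[of x y] eq[of y] K by auto
    qed
  qed
  then obtain a b where ab: "a \<in> K" "b \<in> K" "f a < f b" by blast
  have bd: "\<bar>f a\<bar> \<le> 1" "\<bar>f b\<bar> \<le> 1" using ab K f_abs_le by auto
  \<comment> \<open>The values at one and two thirds are strictly between -1 and 1 even if
    \<open>f a\<close> or \<open>f b\<close> is not, so they lie in the range of
    \<open>kap\<close>.\<close>
  define c d where "c = (2 * f a + f b) / 3" and "d = (f a + 2 * f b) / 3"
  have cd: "f a < c" "c < d" "d < f b" "\<bar>c\<bar> < 1" "\<bar>d\<bar> < 1" using ab(3) bd by (auto simp: c_def d_def)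
  obtain s t where st: "kap s = c" "kap t = d" using kap_surj cd by metis
  then have "s < t" using cd kap_strict_mono by metis
  then obtain q where q: "s < real_of_rat q" "real_of_rat q < t" using of_rat_dense by blast
  have "c < kap (real_of_rat q)" "kap (real_of_rat q) < d" using q kap_strict_mono st by metis+
  then have "kap (real_of_rat q) \<in> f ` K"
    using connectedD_interval[OF connected_continuous_image[OF continuous_on_subset[OF f_continuous K(2)] K(1)],
        of "f a" "f b"] ab cd by auto
  then obtain z where z: "z \<in> K" "f z = kap (real_of_rat q)" by auto
  have "z = line (real_of_rat q)" by (rule f_inj) (use z K(2) abs_kap_less in \<open>auto simp: f_line\<close>)
  then show ?thesis using z by blast
qed

text \<open>Either \<open>K\<close> lies in the image of every power of \<open>P\<close>, hence in
  the limit copy, or there is a last power; then the preimage of \<open>K\<close> under it is not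
  contained in the right-end copy and, meeting no rational point of the line, lies in the left-end
  copy.\<close>

lemma connected_avoiding_Q_in_child:
  assumes K: "connected K" "K \<subseteq> X" "x \<in> K" "y \<in> K" "x \<noteq> y" and Q: "K \<inter> Q = {}"
  shows "\<exists>k. K \<subseteq> C k ` X"
proof (cases "\<forall>n. K \<subseteq> (P ^^ n) ` X")
  case True
  then have "K \<subseteq> A ` X" using Inter_P by blast
  moreover have "C 0 = A" by auto
  ultimately show ?thesis by metis
next
  case False
  then obtain m where m: "\<not> K \<subseteq> (P ^^ m) ` X" "\<And>l. l < m \<Longrightarrow> K \<subseteq> (P ^^ l) ` X"
    using exists_least_iff[of "\<lambda>m. \<not> K \<subseteq> (P ^^ m) ` X"] by auto
  obtain n where n: "m = Suc n" using m(1) K(2) by (cases m) auto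
  have "K \<subseteq> (P ^^ n) ` X" using m(2)[of n] n by simp
  then obtain L where L: "L \<subseteq> X" "connected L" "K = (P ^^ n) ` L"
    by (rule connected_preimage_of_embedding[OF compact_X P_power_continuous P_power_inj K(1)])
  obtain u v where uv: "u \<in> L" "v \<in> L" "u \<noteq> v" using K L(3) by auto
  have nP: "\<not> L \<subseteq> P ` X"
  proof
    assume "L \<subseteq> P ` X"
    then have "K \<subseteq> (P ^^ n) ` P ` X" using L(3) by blast
    then show False using m(1) unfolding n by (simp add: image_comp funpow_Suc_right del: funpow.simps)
  qed
  have "L \<subseteq> M ` X"
  proof (rule ccontr)
    assume "\<not> L \<subseteq> M ` X"
    then obtain q where "line (real_of_rat q) \<in> L"
      using connected_meets_rational_line[OF L(2,1) uv nP] by blast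
    then show False using P_power_line_in_Q[of n q] L(3) Q by blast
  qed
  then have "K \<subseteq> C (Suc n) ` X" using L(3) by auto
  then show ?thesis ..
qed

lemma connected_avoiding_Q_in_copy:
  assumes "connected K" "K \<subseteq> X" "\<exists>x\<in>K. \<exists>y\<in>K. x \<noteq> y" "K \<inter> Q = {}"
  shows "\<exists>w. length w = N \<and> K \<subseteq> W w ` X"
  using assms
proof (induction N arbitrary: K)
  case 0 then show ?case by (intro exI[of _ "[]"]) simp
next
  case (Suc N)
  obtain k where k: "K \<subseteq> C k ` X" using connected_avoiding_Q_in_child[OF Suc.prems(1,2)] Suc.prems(3,4) by blast
  obtain L where L: "L \<subseteq> X" "connected L" "K = C k ` L"
    by (rule connected_preimage_of_embedding[OF compact_X C_continuous C_inj Suc.prems(1) k])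
  have "\<exists>w. length w = N \<and> L \<subseteq> W w ` X"
  proof (rule Suc.IH[OF L(2,1)])
    obtain a b where ab: "a \<in> K" "b \<in> K" "a \<noteq> b" using Suc.prems(3) by (elim bexE)
    obtain u where u: "u \<in> L" "a = C k u" using ab(1) unfolding L(3) by (elim imageE)
    obtain v where v: "v \<in> L" "b = C k v" using ab(2) unfolding L(3) by (elim imageE)
    have "u \<noteq> v" using ab(3) u(2) v(2) by metis
    then show "\<exists>x\<in>L. \<exists>y\<in>L. x \<noteq> y" using u(1) v(1) by (intro bexI)
    show "L \<inter> Q = {}" using Suc.prems(4) L(3) W_in_Q by auto
  qed
  then obtain w where "length w = N" "L \<subseteq> W w ` X" by blast
  then show ?case using L(3) by (intro exI[of _ "k # w"]) auto
qed

lemma Suslinian_X: "Suslinian X dist"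
  unfolding Suslinian_def
proof (intro conjI allI impI)
  fix \<F> assume F: "(\<forall>K\<in>\<F>. subcontinuum X dist K \<and> nondegenerate K) \<and> pairwise disjnt \<F>"
  have "K \<inter> Q \<noteq> {}" if "K \<in> \<F>" for K
  proof
    \<comment> \<open>Such a \<open>K\<close> lies in copies of every depth, which become smaller
      than the distance of two of its points.\<close>
    assume Q: "K \<inter> Q = {}"
    have K: "K \<subseteq> X" "connected K" "nondegenerate K"
      using F that by (auto simp: subcontinuum_def continuum_dist)
    then obtain x y where xy: "x \<in> K" "y \<in> K" "x \<noteq> y" by (auto simp: nondegenerate_def)
    obtain N where N: "\<forall>w. N \<le> length w \<longrightarrow> (\<forall>u\<in>X. \<forall>v\<in>X. dist (W w u) (W w v) < dist x y)"
      using small_copies[of "dist x y"] xy by auto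
    obtain w where w: "length w = N" "K \<subseteq> W w ` X"
      using connected_avoiding_Q_in_copy[OF K(2,1) _ Q] xy by blast
    obtain u v where "u \<in> X" "v \<in> X" "x = W w u" "y = W w v" using w(2) xy by blast
    then show False using N w(1) by fastforce
  qed
  then show "countable \<F>" using countable_if_disjoint_meets_countable[OF countable_Q] F by blast
qed (rule continuum_X)

lemma f_E: assumes "x \<in> E" shows "f x \<noteq> 0"
proof -
  obtain k y where y: "y \<in> E" "x = C k y" by (rule E_cases[OF assms])
  have yX: "y \<in> X" using y E_subset by blast
  show ?thesis
  proof (cases k)
    case 0 then show ?thesis using y f_P[OF A_in[OF yX]] P_A[OF yX] by simp
  next
    case (Suc n)
    show ?thesis
    proof (cases n)
      case 0 then show ?thesis using y Suc f_M[OF yX] by simp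
    next
      case (Suc m)
      then show ?thesis using y \<open>k = Suc n\<close> f_P[OF P_power_in[OF M_in[OF yX]], of m] by simp
    qed
  qed
qed

section \<open>Relative openness of the copies of \<open>E\<close>\<close>

lemma r_P_power: "x \<in> X \<Longrightarrow> r ((P ^^ n) x) = r x"
  by (induction n) (auto simp: r_P P_power_in)

text \<open>The limit copy of \<open>E\<close> is the part of \<open>E\<close> where
  \<open>r\<close> is nonzero, because \<open>r\<close> is 0 on all other children. The child
  \<open>n + 1\<close> is what remains of \<open>E\<close> after removing finitely many compact
  sets: the children \<open>1\<close> to \<open>n\<close>, and the image of
  \<open>P ^^ Suc n\<close>, which contains the limit copy and all later children.\<close>

lemma C_E_open: "openin (top_of_set E) (C k ` E)"
proof (cases k)
  case 0
  have "continuous_on E r" using r_continuous E_subset continuous_on_subset by blast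
  then have "openin (top_of_set E) (E \<inter> r -` (- {0}))" by (intro continuous_openin_preimage_gen) auto
  moreover have "E \<inter> r -` (- {0}) = C k ` E"
  proof (intro equalityI subsetI)
    fix x assume x: "x \<in> E \<inter> r -` (- {0})"
    then obtain l y where y: "y \<in> E" "x = C l y" using E_cases by blast
    have "l = 0"
    proof (cases l)
      case (Suc n)
      then have "r x = 0" using y E_subset r_P_power M_in r_M by auto
      then show ?thesis using x by simp
    qed
    then show "x \<in> C k ` E" using y 0 by blast
  next
    fix x assume "x \<in> C k ` E"
    then obtain y where y: "y \<in> E" "x = C k y" by blast
    then show "x \<in> E \<inter> r -` (- {0})" using C_in_E[of y k] f_E[of y] r_A[of y] 0 E_subset by auto
  qed
  ultimately show ?thesis by simp
next
  case (Suc n)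
  define T where "T = (P ^^ Suc n) ` X \<union> (\<Union>m<n. C (Suc m) ` X)"
  have "closed T"
    unfolding T_def
    by (intro closed_Un closed_UN compact_imp_closed compact_continuous_image compact_X
        P_power_continuous C_continuous finite_lessThan ballI)
  moreover have "C k ` E = E \<inter> - T"
  proof (intro equalityI subsetI)
    fix x assume "x \<in> C k ` E"
    then obtain y where y: "y \<in> E" "x = C k y" by blast
    then have yX: "y \<in> X" using E_subset by blast
    have "x \<notin> (P ^^ Suc n) ` X" using P_power_M_disjoint[OF yX, of _ n "Suc n"] y(2) Suc by auto
    moreover have "x \<notin> C (Suc m) ` X" if "m < n" for m
      using C_disjoint[OF yX, of _ k "Suc m"] y(2) Suc that by auto
    ultimately show "x \<in> E \<inter> - T" using C_in_E[OF y(1)] y(2) by (auto simp: T_def)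
  next
    fix x assume x: "x \<in> E \<inter> - T"
    then obtain l y where y: "y \<in> E" "x = C l y" using E_cases by blast
    then have yX: "y \<in> X" using E_subset by blast
    have xT: "x \<notin> (P ^^ Suc n) ` X" "\<And>m. m < n \<Longrightarrow> x \<notin> C (Suc m) ` X" using x by (auto simp: T_def)
    have "l \<noteq> 0"
    proof
      assume "l = 0"
      then have "x = (P ^^ Suc n) (A y)" using y P_power_A[OF yX, of "Suc n"] by simp
      then show False using xT(1) A_in[OF yX] by blast
    qed
    then obtain m where m: "l = Suc m" by (cases l) auto
    have "\<not> m < n" using xT(2)[of m] y m yX by blast
    moreover have "\<not> n < m"
    proof
      assume "n < m"
      then obtain d where d: "m = Suc n + d" using less_iff_Suc_add by auto
      have "x = (P ^^ Suc n) ((P ^^ d) (M y))" unfolding y(2) m d child_simps by (simp only: funpow_add o_apply)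
      then show False using xT(1) P_power_in[OF M_in[OF yX]] by blast
    qed
    ultimately have "l = k" using m Suc by simp
    then show "x \<in> C k ` E" using y by blast
  qed
  ultimately show ?thesis by (auto simp: openin_open open_Compl)
qed

lemma C_open_map:
  assumes "openin (top_of_set E) U" shows "openin (top_of_set E) (C k ` U)"
proof -
  obtain T where T: "open T" "U = E \<inter> T" using assms by (auto simp: openin_open)
  define j where "j = inv_into X (C k)"
  have j: "j (C k x) = x" if "x \<in> X" for x using that C_inj by (simp add: j_def)
  have "continuous_on (C k ` X) j" by (rule continuous_on_inv[OF C_continuous compact_X]) (use j in blast)
  then have "continuous_on (C k ` E) j" by (rule continuous_on_subset) (use E_subset in blast)
  then have "openin (top_of_set (C k ` E)) (C k ` E \<inter> j -` T)" using T by (intro continuous_openin_preimage_gen)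
  moreover have "C k ` E \<inter> j -` T = C k ` U" using T(2) j E_subset by auto
  ultimately show ?thesis using openin_trans C_E_open by metis
qed

lemma E_lusin_scheme: "lusin_scheme E (\<lambda>w. W w ` E)"
proof (rule lusin_scheme_word_map)
  show "inj_on (C k) E" for k using C_inj E_subset inj_on_subset by blast
  show "\<exists>k. x \<in> C k ` E" if "x \<in> E" for x using that by (rule E_cases) blast
  show "k = l" if "x \<in> E" "y \<in> E" "C k x = C l y" for k l x y using C_disjoint that E_subset by blast
  fix \<alpha> :: "nat \<Rightarrow> nat" and x U assume x: "\<forall>n. x \<in> W (map \<alpha> [0..<n]) ` E" and U: "open U" "x \<in> U"
  obtain e where e: "0 < e" "ball x e \<subseteq> U" using U open_contains_ball by blast
  obtain N where N: "\<forall>w. N \<le> length w \<longrightarrow> (\<forall>x\<in>X. \<forall>y\<in>X. dist (W w x) (W w y) < e)"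
    using small_copies[OF e(1)] by blast
  have "W (map \<alpha> [0..<N]) ` E \<subseteq> ball x e"
  proof
    fix y assume "y \<in> W (map \<alpha> [0..<N]) ` E"
    then obtain v where v: "v \<in> X" "y = W (map \<alpha> [0..<N]) v" using E_subset by blast
    obtain u where u: "u \<in> X" "x = W (map \<alpha> [0..<N]) u" using x E_subset by blast
    show "y \<in> ball x e" using N[rule_format, of "map \<alpha> [0..<N]" u v] u v by simp
  qed
  then show "\<exists>n. W (map \<alpha> [0..<n]) ` E \<subseteq> U" using e(2) by blast
qed (use C_in_E C_open_map branch_in_E in auto)

end

section \<open>The continuum \<open>X\<close> is self-similar\<close>

text \<open>Coordinate \<open>j\<close> of the image depends only on coordinates of the argument
  below \<open>j\<close>. This gain of one coordinate per letter is what makes the copies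
  shrink.\<close>

lemma iA_agree: "\<forall>i<m. z i = z' i \<Longrightarrow> j \<le> m \<Longrightarrow> iA z j = iA z' j"
proof (induction j rule: less_induct)
  case (less j)
  show ?case
  proof (cases j rule: mod3_cases)
    case (2 l) then show ?thesis using less.IH[of l] less.prems by simp
  next
    case (4 l) then show ?thesis using less.prems by simp
  qed simp_all
qed

lemma iM_agree: "\<forall>i<m. z i = z' i \<Longrightarrow> j \<le> m \<Longrightarrow> iM z j = iM z' j"
  by (cases j rule: mod3_cases) simp_all

text \<open>No coordinate is gained here, since \<open>iP\<close> keeps the \<open>rho\<close>
  coordinates; but the agreement gained by \<open>iM\<close> is not lost, whatever the
  exponent.\<close>

lemma iP_power_agree: "\<forall>i\<le>m. z i = z' i \<Longrightarrow> \<forall>j\<le>m. (iP ^^ n) z j = (iP ^^ n) z' j"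
proof (induction n)
  case (Suc n)
  show ?case
  proof (intro allI impI)
    fix j assume "j \<le> m"
    then show "(iP ^^ Suc n) z j = (iP ^^ Suc n) z' j"
      using Suc by (cases j rule: mod3_cases) simp_all
  qed
qed simp

lemma child_agree:
  assumes "\<forall>i<m. z i = z' i" "j \<le> m"
  shows "child iP iM iA k z j = child iP iM iA k z' j"
proof (cases k)
  case 0 then show ?thesis using iA_agree[OF assms] by simp
next
  case (Suc n)
  have "\<forall>i\<le>m. iM z i = iM z' i" using iM_agree[OF assms(1)] by simp
  from iP_power_agree[OF this, of n] show ?thesis using assms(2) Suc by simp
qed

lemma word_map_agree:
  "j < length w \<Longrightarrow> word_map (child iP iM iA) w z j = word_map (child iP iM iA) w z' j"
proof (induction w arbitrary: j)
  case (Cons k w)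
  have "child iP iM iA k (word_map (child iP iM iA) w z) j = child iP iM iA k (word_map (child iP iM iA) w z') j"
    by (rule child_agree[of "length w"]) (use Cons in auto)
  then show ?case by simp
qed simp

lemma dist_fun_small:
  assumes "0 < e"
  shows "\<exists>N. \<forall>x y :: nat \<Rightarrow> real. (\<forall>j<N. x j = y j) \<longrightarrow> dist x y < e"
proof -
  obtain K where K: "(1/2::real) ^ K < e" using real_arch_pow_inv[OF assms, of "1/2"] by auto
  \<comment> \<open>The metric on functions weights the coordinates in the order of
    \<open>from_nat\<close>. All coordinates enumerated up to \<open>K\<close> are below
    \<open>N\<close>, and the remaining ones contribute at most \<open>(1/2) ^ K\<close>.\<close>
  define N where "N = Suc (Max (from_nat ` {..K}))"
  have "dist x y < e" if eq: "\<forall>j<N. x j = y j" for x y :: "nat \<Rightarrow> real"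
  proof -
    have "x (from_nat n) = y (from_nat n)" if "n \<le> K" for n
      using eq that by (simp add: N_def less_Suc_eq_le)
    then have "{dist (x (from_nat n)) (y (from_nat n)) |n. n \<le> K} = {0}" by force
    then have "2 * Max {dist (x (from_nat n)) (y (from_nat n)) |n. n \<le> K} = 0" by simp
    then show ?thesis using dist_fun_le_dist_first_terms[of x y K] K by linarith
  qed
  then show ?thesis by (intro exI allI impI)
qed

lemma child_copies_small:
  assumes "0 < e"
  shows "\<exists>N. \<forall>w. N \<le> length w \<longrightarrow> (\<forall>x\<in>X. \<forall>y\<in>X.
    dist (word_map (child iP iM iA) w x) (word_map (child iP iM iA) w y) < e)"
proof -
  obtain N where N: "\<forall>x y :: nat \<Rightarrow> real. (\<forall>j<N. x j = y j) \<longrightarrow> dist x y < e"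
    using dist_fun_small[OF assms] by (elim exE)
  show ?thesis
  proof (intro exI[of _ N] allI impI ballI)
    fix w :: "nat list" and x y :: "nat \<Rightarrow> real" assume "N \<le> length w"
    then show "dist (word_map (child iP iM iA) w x) (word_map (child iP iM iA) w y) < e"
      by (intro N[rule_format] word_map_agree) simp
  qed
qed

lemma iP_iA: "iP (iA x) = iA x"
proof
  fix n show "iP (iA x) n = iA x n" by (cases n rule: mod3_cases) simp_all
qed

text \<open>Coordinate 3 is the word with the single letter \<open>rho\<close>: on the line it is
  \<open>kap (rho s)\<close>, so it serves as the projection \<open>r\<close>.\<close>

lemma self_similar_X: "self_similar X Phi (\<lambda>x. x 0) (\<lambda>x. x 3) iP iM iA"
proof
  show "x \<in> range Phi \<or> x \<in> iP ` X \<or> x \<in> iM ` X" if "x \<in> X" for x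
    using X_cases[OF that] by (metis rangeI)
  show "x \<in> iA ` X" if "\<forall>n. x \<in> (iP ^^ n) ` X" for x
    by (rule X_Inter_iP) (rule that[rule_format])
  show "inj_on iP X" "inj_on iM X" "inj_on iA X"
    by (simp_all add: inj_on_def iP_inject iM_inject iA_inject)
  show "iA x 3 = x 0" for x using iA_simps(4)[of x 0] by simp
  show "iP x 3 = x 3" for x using iP_simps(4)[of x 0] by simp
  show "iM x 3 = 0" for x using iM_simps(4)[of x 0] by simp
  show "iP x 0 = 1" "iM x 0 = - 1" "iP (iA x) = iA x" for x by (rule iP_simps iM_simps iP_iA)+
  show "continuous_on X (\<lambda>x. x 0)" "continuous_on X (\<lambda>x. x 3)" by (rule continuous_on_coord)+
qed (fact compact_X Phi_continuous X_def iP_in_X iP_continuous iM_in_X iM_continuous iA_in_X iA_continuous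
    Phi_simps(1) | erule child_copies_small)+

section \<open>A Lusin scheme for the irrational numbers\<close>

lemma kap_Rats_iff: "kap x \<in> \<rat> \<longleftrightarrow> x \<in> \<rat>"
proof
  assume "kap x \<in> \<rat>"
  moreover have "x = kap x / (1 - \<bar>kap x\<bar>)"
    using kap_surj[OF abs_kap_less[of x]] by (simp add: kap_inject)
  ultimately show "x \<in> \<rat>" by (metis Rats_1 Rats_abs_iff Rats_diff Rats_divide)
next
  assume "x \<in> \<rat>"
  then show "kap x \<in> \<rat>" unfolding kap_def by (intro Rats_divide Rats_add Rats_1) simp_all
qed

text \<open>Maps the real line onto the open unit interval to the right of the integer coded by
  \<open>k\<close>. The maps play the role of the inverse branches of the continued fraction
  expansion; as \<open>kap\<close> involves only field operations and absolute values, rationality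
  is preserved in both directions.\<close>

definition unit_map :: "nat \<Rightarrow> real \<Rightarrow> real" where
  "unit_map k x = of_int (int_decode k) + (1 + kap x) / 2"

lemma unit_map_bounds: "of_int (int_decode k) < unit_map k x" "unit_map k x < of_int (int_decode k) + 1"
proof -
  have "- 1 < kap x" "kap x < 1" using abs_kap_less[of x] by (simp_all add: abs_less_iff)
  then show "of_int (int_decode k) < unit_map k x" "unit_map k x < of_int (int_decode k) + 1"
    by (simp_all add: unit_map_def)
qed

lemma unit_map_eq: "unit_map k x = unit_map l y \<Longrightarrow> k = l \<and> x = y"
proof -
  assume eq: "unit_map k x = unit_map l y"
  have "int_decode k = int_decode l"
    using unit_map_bounds[of k x] unit_map_bounds[of l y] eq by linarith
  then have "k = l" by (metis int_decode_inverse)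
  then show ?thesis using eq by (simp add: unit_map_def kap_inject)
qed

lemma unit_map_surj:
  assumes "of_int (int_decode k) < x" "x < of_int (int_decode k) + 1"
  defines "y \<equiv> 2 * (x - of_int (int_decode k)) - 1"
  shows "unit_map k (y / (1 - \<bar>y\<bar>)) = x"
proof -
  have "\<bar>y\<bar> < 1" using assms by auto
  then have "unit_map k (y / (1 - \<bar>y\<bar>)) = of_int (int_decode k) + (1 + y) / 2"
    unfolding unit_map_def by (simp only: kap_surj)
  then show ?thesis by (simp add: y_def field_simps)
qed

lemma unit_map_Rats_iff: "unit_map k x \<in> \<rat> \<longleftrightarrow> x \<in> \<rat>"
proof
  assume "unit_map k x \<in> \<rat>"
  then have "2 * (unit_map k x - of_int (int_decode k)) - 1 \<in> \<rat>" by (intro Rats_diff Rats_mult) simp_all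
  moreover have "2 * (unit_map k x - of_int (int_decode k)) - 1 = kap x" by (simp add: unit_map_def field_simps)
  ultimately show "x \<in> \<rat>" by (simp only: kap_Rats_iff)
next
  assume "x \<in> \<rat>"
  then show "unit_map k x \<in> \<rat>"
    unfolding unit_map_def by (intro Rats_add Rats_divide) (simp_all add: kap_Rats_iff)
qed

lemma unit_map_contraction: "\<bar>unit_map k x - unit_map k y\<bar> \<le> \<bar>x - y\<bar> / 2"
  using kap_lipschitz[of x y] by (simp add: unit_map_def diff_divide_distrib[symmetric])

lemma unit_map_continuous: "continuous_on S (unit_map k)"
  by (rule continuous_on_subset[OF lipschitz_real_continuous[of _ "1/2"]])
    (use unit_map_contraction in auto)

text \<open>The innermost letter maps everything into an interval of length 1, and each further
  letter halves distances; hence the factor 2.\<close>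

lemma unit_map_word_contraction: "w \<noteq> [] \<Longrightarrow> \<bar>word_map unit_map w x - word_map unit_map w y\<bar> \<le> 2 * (1/2) ^ length w"
proof (induction w)
  case (Cons k w)
  show ?case
  proof (cases "w = []")
    case True
    then show ?thesis using unit_map_bounds[of k x] unit_map_bounds[of k y] by (simp add: abs_le_iff)
  next
    case False
    then show ?thesis
      using Cons.IH unit_map_contraction[of k "word_map unit_map w x" "word_map unit_map w y"] by simp
  qed
qed simp

text \<open>If the fractional part is \<open>p / b\<close>, then
  \<open>kap y = (2 * p - b) / b\<close>, and inverting \<open>kap\<close> turns the denominator
  into \<open>2 * (b - p)\<close> or \<open>2 * p\<close>, whichever is smaller than
  \<open>b\<close>. If \<open>2 * p = b\<close>, then \<open>y = 0\<close> with denominator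
  1.\<close>

lemma unit_map_denominator:
  assumes "unit_map k y = of_int a / of_nat b" "0 < b"
  shows "\<exists>a' b'. 0 < b' \<and> b' < b \<and> y = of_int a' / of_nat b'"
proof -
  define n where "n = int_decode k"
  define p where "p = a - n * int b"
  have x: "unit_map k y - of_int n = of_int p / of_nat b"
    using assms by (simp add: p_def field_simps)
  then have ky: "kap y = (2 * of_int p - of_nat b) / of_nat b"
    using assms(2) by (simp add: unit_map_def n_def field_simps)
  have "0 < of_int p / real b" "of_int p / real b < 1"
    using unit_map_bounds[of k y] x by (simp_all add: n_def)
  then have p: "0 < p" "p < int b" using assms(2) by (simp_all add: field_simps) 
  have y: "y = kap y / (1 - \<bar>kap y\<bar>)"
    using kap_surj[OF abs_kap_less[of y]] by (simp add: kap_inject)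
  have b: "real b > 0" using assms(2) by simp
  consider "2 * p = int b" | "2 * p > int b" | "2 * p < int b" by linarith
  then show ?thesis
  proof cases
    case 1
    then have "kap y = 0" using ky by (simp add: of_int_eq_iff[symmetric, where 'a = real] del: of_int_eq_iff)
    then have "y = of_int 0 / of_nat 1" using y by simp
    moreover have "1 < b" using 1 p by linarith
    ultimately show ?thesis by (metis zero_less_one)
  next
    case 2
    then have g: "2 * real_of_int p > real b" by linarith
    define d where "d = nat (2 * (int b - p))"
    have d: "0 < d" "d < b" "real d = 2 * (real b - of_int p)" using 2 p by (auto simp: d_def)
    have "1 - \<bar>kap y\<bar> = real d / real b" using g b unfolding ky d(3) by (simp add: field_simps)
    then have "y = kap y / (real d / real b)" using y by metis
    also have "\<dots> = (2 * of_int p - of_nat b) / of_nat d" unfolding ky using b d(1) by (simp add: field_simps)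
    also have "\<dots> = of_int (2 * p - int b) / of_nat d" by simp
    finally have "y = of_int (2 * p - int b) / of_nat d" .
    then show ?thesis using d by blast
  next
    case 3
    then have g: "2 * real_of_int p < real b" by linarith
    define d where "d = nat (2 * p)"
    have d: "0 < d" "d < b" "real d = 2 * of_int p" using 3 p by (auto simp: d_def)
    have "1 - \<bar>kap y\<bar> = real d / real b" using g b unfolding ky d(3) by (simp add: field_simps abs_if)
    then have "y = kap y / (real d / real b)" using y by metis
    also have "\<dots> = (2 * of_int p - of_nat b) / of_nat d" unfolding ky using b d(1) by (simp add: field_simps)
    also have "\<dots> = of_int (2 * p - int b) / of_nat d" by simp
    finally have "y = of_int (2 * p - int b) / of_nat d" .
    then show ?thesis using d by blast
  qed
qed

text \<open>As in the Euclidean algorithm, denominators decrease while letters are stripped, so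
  after finitely many letters the remaining number is in no range of a
  \<open>unit_map\<close>.\<close>

lemma rational_leaves_words:
  "0 < b \<Longrightarrow> x = of_int a / of_nat b \<Longrightarrow> \<exists>N. \<forall>w. length w = N \<longrightarrow> x \<notin> range (word_map unit_map w)"
proof (induction b arbitrary: x a rule: less_induct)
  case (less b)
  show ?case
  proof (cases "\<exists>k y. x = unit_map k y")
    case False
    have "x \<notin> range (word_map unit_map w)" if "length w = Suc 0" for w
      using that False by (cases w) auto
    then show ?thesis by blast
  next
    case True
    then obtain k y where y: "x = unit_map k y" by blast
    then obtain a' b' where "0 < b'" "b' < b" "y = of_int a' / of_nat b'"
      using unit_map_denominator[of k y a b] less.prems by auto
    then obtain N where N: "\<forall>w. length w = N \<longrightarrow> y \<notin> range (word_map unit_map w)" using less.IH by blast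
    have "x \<notin> range (word_map unit_map w)" if w: "length w = Suc N" for w
    proof
      assume "x \<in> range (word_map unit_map w)"
      then obtain z where z: "x = word_map unit_map w z" by blast
      obtain l v where v: "w = l # v" using w by (cases w) auto
      have "y = word_map unit_map v z" using unit_map_eq[of k y l] y z v by simp
      then have "y \<in> range (word_map unit_map v)" by (rule range_eqI)
      moreover have "length v = N" using w v by simp
      ultimately show False using N by simp
    qed
    then show ?thesis by blast
  qed
qed

lemma word_map_unit_map_Rats: "word_map unit_map w x \<in> \<rat> \<longleftrightarrow> x \<in> \<rat>"
  by (induction w) (simp_all add: unit_map_Rats_iff)

lemma word_map_unit_map_continuous: "continuous_on S (word_map unit_map w)"
  by (rule continuous_on_subset[OF word_map_continuous[of UNIV]]) (simp_all add: unit_map_continuous)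

lemma irrational_branch: "\<exists>x. \<forall>n. x \<in> word_map unit_map (map \<alpha> [0..<n]) ` (UNIV - \<rat>)"
proof -
  let ?w = "\<lambda>n. word_map unit_map (map \<alpha> [0..<n])"
  \<comment> \<open>Closed unit intervals are used because the ranges of the word maps are not
    compact. Interval ends cause no harm: the common point lies in the ranges of words of every
    length and therefore cannot be rational.\<close>
  define I where "I n = {real_of_int (int_decode (\<alpha> n)) .. of_int (int_decode (\<alpha> n)) + 1}" for n
  have "\<exists>x. \<forall>n. x \<in> ?w n ` I n"
  proof (rule compact_decreasing_sequence)
    show "compact (?w n ` I n)" for n
      unfolding I_def by (intro compact_continuous_image word_map_unit_map_continuous) simp
    show "?w n ` I n \<noteq> {}" for n by (simp add: I_def)
    show "?w (Suc n) ` I (Suc n) \<subseteq> ?w n ` I n" for n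
    proof
      fix y assume "y \<in> ?w (Suc n) ` I (Suc n)"
      then obtain x where "y = ?w n (unit_map (\<alpha> n) x)" by (auto simp: word_map_append)
      moreover have "unit_map (\<alpha> n) x \<in> I n" using unit_map_bounds[of "\<alpha> n" x] by (simp add: I_def)
      ultimately show "y \<in> ?w n ` I n" by blast
    qed
  qed
  then obtain x where x: "\<forall>n. x \<in> ?w n ` I n" by (elim exE)
  have "x \<notin> \<rat>"
  proof
    assume "x \<in> \<rat>"
    then obtain a b where "0 < b" "x = of_int a / of_int b" by (rule Rats_cases')
    then have "0 < nat b" "x = of_int a / of_nat (nat b)" by simp_all
    then obtain N where N: "\<forall>w. length w = N \<longrightarrow> x \<notin> range (word_map unit_map w)"
      using rational_leaves_words[of "nat b" x a] by (auto simp only:)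
    have "x \<in> range (?w N)" using x[rule_format, of N] by (rule subsetD[OF image_mono[OF subset_UNIV]])
    then show False using N by simp
  qed
  have "x \<in> ?w n ` (UNIV - \<rat>)" for n
  proof -
    obtain y where y: "x = ?w n y" using x[rule_format, of n] by (elim imageE)
    then have "y \<notin> \<rat>" using \<open>x \<notin> \<rat>\<close> by (simp add: word_map_unit_map_Rats)
    then show ?thesis using y by (intro image_eqI[of _ _ y]) simp_all
  qed
  then show ?thesis by (intro exI[of _ x] allI)
qed

lemma unit_map_open_map:
  assumes "openin (top_of_set (UNIV - \<rat>)) U"
  shows "openin (top_of_set (UNIV - \<rat>)) (unit_map k ` U)"
proof -
  obtain T where T: "open T" "U = (UNIV - \<rat>) \<inter> T" using assms by (auto simp: openin_open)
  define n where "n = real_of_int (int_decode k)"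
  define g where "g x = (2 * (x - n) - 1) / (1 - \<bar>2 * (x - n) - 1\<bar>)" for x
  have g: "unit_map k (g x) = x" if "x \<in> {n<..<n+1}" for x
    using unit_map_surj[of k x] that by (simp add: g_def n_def)
  have ran: "unit_map k y \<in> {n<..<n+1}" for y using unit_map_bounds[of k y] by (simp add: n_def)
  have "continuous_on {n<..<n+1} g"
    unfolding g_def by (intro continuous_intros) auto
  then have "open ({n<..<n+1} \<inter> g -` T)" using T(1) by (intro continuous_open_preimage) auto
  moreover have "unit_map k ` U = (UNIV - \<rat>) \<inter> ({n<..<n+1} \<inter> g -` T)"
  proof (intro equalityI subsetI)
    fix x assume "x \<in> unit_map k ` U"
    then obtain y where y: "y \<in> T" "y \<notin> \<rat>" "x = unit_map k y" using T(2) by blast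
    have "g x = y" using unit_map_eq[of k "g x" k y] g[of x] ran[of y] y(3) by simp
    then show "x \<in> (UNIV - \<rat>) \<inter> ({n<..<n+1} \<inter> g -` T)" using y ran[of y] by (simp add: unit_map_Rats_iff)
  next
    fix x assume x: "x \<in> (UNIV - \<rat>) \<inter> ({n<..<n+1} \<inter> g -` T)"
    then have "x = unit_map k (g x)" "g x \<in> T" using g[of x] by auto
    moreover from this(1) have "g x \<notin> \<rat>" using x unit_map_Rats_iff[of k "g x"] by auto
    ultimately show "x \<in> unit_map k ` U" using T(2) by blast
  qed
  ultimately show ?thesis by (auto simp: openin_open)
qed

lemma irrational_lusin_scheme: "lusin_scheme (UNIV - \<rat>) (\<lambda>w. word_map unit_map w ` (UNIV - \<rat>))"
proof (rule lusin_scheme_word_map)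
  show "unit_map k x \<in> UNIV - \<rat>" if "x \<in> UNIV - \<rat>" for k x using that by (simp add: unit_map_Rats_iff)
  show "inj_on (unit_map k) (UNIV - \<rat>)" for k by (rule inj_onI) (use unit_map_eq in blast)
  show "\<exists>k. x \<in> unit_map k ` (UNIV - \<rat>)" if x: "x \<in> UNIV - \<rat>" for x
  proof -
    define k where "k = int_encode \<lfloor>x\<rfloor>"
    have "x \<noteq> of_int \<lfloor>x\<rfloor>" using x by (metis DiffD2 Rats_of_int)
    then have "of_int \<lfloor>x\<rfloor> < x" "x < of_int \<lfloor>x\<rfloor> + 1" by linarith+
    moreover have "int_decode k = \<lfloor>x\<rfloor>" by (simp add: k_def)
    ultimately have b: "of_int (int_decode k) < x" "x < of_int (int_decode k) + 1" by simp_all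
    obtain z where z: "unit_map k z = x" using unit_map_surj[OF b] by blast
    then have "z \<in> UNIV - \<rat>" using x unit_map_Rats_iff[of k z] by auto
    then show ?thesis using z by blast
  qed
  show "k = l" if "unit_map k x = unit_map l y" for k l x y using unit_map_eq[OF that] ..
  fix \<alpha> :: "nat \<Rightarrow> nat" and x U
  assume x: "\<forall>n. x \<in> word_map unit_map (map \<alpha> [0..<n]) ` (UNIV - \<rat>)" and U: "open U" "x \<in> U"
  obtain e where e: "0 < e" "ball x e \<subseteq> U" using U open_contains_ball by blast
  obtain m where m: "(1/2::real) ^ m < e" using real_arch_pow_inv[OF e(1), of "1/2"] by auto
  \<comment> \<open>The additional letter absorbs the factor 2 of
    \<open>unit_map_word_contraction\<close>.\<close>
  have "word_map unit_map (map \<alpha> [0..<Suc m]) ` (UNIV - \<rat>) \<subseteq> ball x e"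
  proof
    fix y assume "y \<in> word_map unit_map (map \<alpha> [0..<Suc m]) ` (UNIV - \<rat>)"
    then obtain v where v: "y = word_map unit_map (map \<alpha> [0..<Suc m]) v" by blast
    obtain u where u: "x = word_map unit_map (map \<alpha> [0..<Suc m]) u" using x by blast
    have "\<bar>x - y\<bar> \<le> 2 * (1/2) ^ length (map \<alpha> [0..<Suc m])"
      unfolding u v by (rule unit_map_word_contraction) simp
    then show "y \<in> ball x e" using m by (simp add: dist_real_def)
  qed
  then show "\<exists>n. word_map unit_map (map \<alpha> [0..<n]) ` (UNIV - \<rat>) \<subseteq> U" using e(2) by blast
qed (use unit_map_open_map irrational_branch in auto)

theorem mainTheorem2:
  shows "\<exists>(X :: (nat \<Rightarrow> real) set) d.
    continuum X d \<and> chainable X d \<and> Suslinian X d \<and>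
    subtopology (Metric_space.mtopology X d) (end_points X d)
      homeomorphic_space top_of_set (UNIV - \<rat> :: real set)"
proof -
  interpret self_similar X Phi "\<lambda>x. x 0" "\<lambda>x. x 3" iP iM iA by (rule self_similar_X)
  have "X \<inter> E = E" using E_subset by (rule Int_absorb1)
  then have "subtopology (Metric_space.mtopology X dist) (end_points X dist) = top_of_set E"
    by (simp only: mtopology_dist end_points_eq subtopology_subtopology)
  moreover have "top_of_set E homeomorphic_space top_of_set (UNIV - \<rat> :: real set)"
    by (rule lusin_schemes_homeomorphic[OF E_lusin_scheme irrational_lusin_scheme])
  ultimately have "subtopology (Metric_space.mtopology X dist) (end_points X dist)
      homeomorphic_space top_of_set (UNIV - \<rat> :: real set)" by (simp only:)
  then show ?thesis
    by (intro exI[of _ X] exI[of _ dist] conjI continuum_X chainable_X Suslinian_X)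
qed

end
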